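(* Consider the dual risk model with causal dependence and proportional gains described in the context. Let $\tau_x$ be the time to ruin starting from $x$, let $\alpha>0$, and let $\tau(s,\alpha)=\int_0^\infty e^{-sx}E(e^{-\alpha\tau_x})\,dx$. For $i=0,1$ let $a_i(s)=\frac{s}{1+a_i}$, and for $l,m\ge 0$ let $a_{l,m}(s)=\frac{s}{(1+a_0)^l(1+a_1)^m}$. Let $\chi_0(s)=E(e^{-sB}1(T\ge B))$, $\chi_1(s)=E(e^{-sB}1(T<B))$, $\widehat\chi_i(s)=\frac{\chi_i(s)}{1+a_i}$, and $$\tilde L_{1,0}(s,\alpha)=\widehat\chi_0(s+\alpha)\sum_{j=1}^{K}q_j\frac{\mu_j}{\mu_j-a_0(s)},\qquad \tilde L_{0,1}(s,\alpha)=\widehat\chi_1(s+\alpha)\sum_{i=1}^{L}h_i\frac{\nu_i}{\nu_i-a_1(s)},$$ $$\tilde K(s,\alpha)=\frac{1-\phi(s+\alpha)}{s+\alpha}-\widehat\chi_0(s+\alpha)\sum_{j=1}^{K}q_j\frac{\mu_j}{\mu_j-a_0(s)}\tau(\mu_j,\alpha)-\widehat\chi_1(s+\alpha)\sum_{i=1}^{L}h_i\frac{\nu_i}{\nu_i-a_1(s)}\tau(\nu_i,\alpha).$$ Define $\tilde L_{l,m}(s,\alpha)$, $l,m\ge 0$, recursively by $\tilde L_{0,0}(s,\alpha)=1$ and, for $l+m\ge 1$, $$\tilde L_{l,m}(s,\alpha)=\tilde L_{l-1,m}(s,\alpha)\tilde L_{1,0}(a_{l-1,m}(s),\alpha)+\tilde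 L_{l,m-1}(s,\alpha)\tilde L_{0,1}(a_{l,m-1}(s),\alpha),$$ where terms with a negative index are $0$. Then, for every $s$ with $\mathrm{Re}(s)>0$ outside the set $\{\mu_i(1+a_0)^{l+1}(1+a_1)^m,\ \nu_i(1+a_0)^{l}(1+a_1)^{m+1}: l,m\ge 0\}$ (all $i$), $$\tau(s,\alpha)=\lim_{n\to\infty}\sum_{l=0}^{n}\tilde L_{l,n-l}(s,\alpha)+\sum_{j=0}^{\infty}\sum_{l=0}^{j}\tilde L_{l,j-l}(s,\alpha)\tilde K(a_{l,j-l}(s),\alpha).$$ The values $\tau(\mu_j,\alpha)$, $j=1,\dots,K$, and $\tau(\nu_i,\alpha)$, $i=1,\dots,L$, are obtained by solving the system of $K+L$ linear equations derived by substituting $s=\mu_j$, $j=1,\dots,K$, and $s=\nu_i$, $i=1,\dots,L$, in this identity (values at removable singularities being understood as limits).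
   Context: Model. The surplus $U(t)$ starts at $U(0)=x>0$ and decreases at unit rate between gains. Gain interarrival times $B_i>0$ are i.i.d. (generic $B$) with c.d.f. $B(\cdot)$, density, Laplace–Stieltjes transform $\phi(s)=E(e^{-sB})$ and finite mean; thresholds $T_i$ are i.i.d. (generic $T$), independent of the $B_i$, with c.d.f. $T(\cdot)$. If the surplus just before the $i$-th gain is $u>0$, then it jumps to $(1+a_0)u+C_i^{(0)}$ when $T_i\ge B_i$, and to $(1+a_1)u+C_i^{(1)}$ when $T_i<B_i$. Here $a_0,a_1>0$ are constants, and the $C_i^{(0)}$ (resp. $C_i^{(1)}$) are i.i.d., independent of everything else, hyperexponential with c.d.f. $\sum_{i=1}^{K}q_i(1-e^{-\mu_i x})$ (resp. $\sum_{i=1}^{L}h_i(1-e^{-\nu_i x})$), with $q_i,h_i\geq 0$, $\sum_i q_i=\sum_i h_i=1$, $\mu_i,\nu_i>0$. The time to ruin is $\tau_x=\inf\{t\ge0:U(t)=0\}$ given $U(0)=x$ ($=\infty$ if the surplus never hits $0$, with $e^{-\alpha\infty}=0$). *)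

theory Defs
  imports "HOL-Probability.Probability"
begin

text \<open>
  The data of the dual risk model. Gains are numbered from \<open>0\<close>, so \<open>gapB R n\<close> is the time between
  the \<open>n\<close>-th and the \<open>(n+1)\<close>-st gain (time \<open>0\<close> counting as the \<open>0\<close>-th), and the index \<open>0\<close> also serves
  as the generic copy of \<open>B\<close> and \<open>T\<close>. The hyperexponential mixtures are indexed by \<open>{1..nK R}\<close> and
  \<open>{1..nL R}\<close>, with weights \<open>wq\<close>, \<open>wh\<close> and rates \<open>mu\<close>, \<open>nu\<close>.
\<close>

record 'w dual_risk =
  base :: "'w measure"
  gapB :: "nat \<Rightarrow> 'w \<Rightarrow> real"
  thrT :: "nat \<Rightarrow> 'w \<Rightarrow> real"
  gainC0 :: "nat \<Rightarrow> 'w \<Rightarrow> real"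
  gainC1 :: "nat \<Rightarrow> 'w \<Rightarrow> real"
  a0 :: real
  a1 :: real
  nK :: nat
  wq :: "nat \<Rightarrow> real"
  mu :: "nat \<Rightarrow> real"
  nL :: nat
  wh :: "nat \<Rightarrow> real"
  nu :: "nat \<Rightarrow> real"

definition hyperexp_cdf :: "nat \<Rightarrow> (nat \<Rightarrow> real) \<Rightarrow> (nat \<Rightarrow> real) \<Rightarrow> real \<Rightarrow> real" where
  "hyperexp_cdf n p r x = (if x < 0 then 0 else \<Sum>i=1..n. p i * (1 - exp (- (r i * x))))"

locale dual_risk_model = prob_space "base R" for R :: "'w dual_risk" +
  assumes indep:
      "indep_vars (\<lambda>_. borel)
         (case_sum (case_sum (gapB R) (thrT R)) (case_sum (gainC0 R) (gainC1 R))) UNIV"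
    and gap_pos: "\<And>n w. w \<in> space (base R) \<Longrightarrow> gapB R n w > 0"
    and gap_density: "\<exists>b. \<forall>n. distributed (base R) lborel (gapB R n) b"
    and gap_mean: "integrable (base R) (gapB R 0)"
    and thr_ident: "\<And>n. distr (base R) borel (thrT R n) = distr (base R) borel (thrT R 0)"
    and gain0_cdf:
      "\<And>n x. cdf (distr (base R) borel (gainC0 R n)) x = hyperexp_cdf (nK R) (wq R) (mu R) x"
    and gain1_cdf:
      "\<And>n x. cdf (distr (base R) borel (gainC1 R n)) x = hyperexp_cdf (nL R) (wh R) (nu R) x"
    and a_pos: "a0 R > 0" "a1 R > 0"
    and wq_nonneg: "\<And>i. i \<in> {1..nK R} \<Longrightarrow> wq R i \<ge> 0"
    and wh_nonneg: "\<And>i. i \<in> {1..nL R} \<Longrightarrow> wh R i \<ge> 0"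
    and wq_sum: "(\<Sum>i=1..nK R. wq R i) = 1"
    and wh_sum: "(\<Sum>i=1..nL R. wh R i) = 1"
    and mu_pos: "\<And>i. i \<in> {1..nK R} \<Longrightarrow> mu R i > 0"
    and nu_pos: "\<And>i. i \<in> {1..nL R} \<Longrightarrow> nu R i > 0"

definition gain_time :: "'w dual_risk \<Rightarrow> nat \<Rightarrow> 'w \<Rightarrow> real" where
  "gain_time R n w = (\<Sum>k<n. gapB R k w)"

text \<open>
  \<open>level R x w n\<close> is the surplus at the \<open>n\<close>-th gain time, the gain included. The model prescribes a
  gain only when the surplus before it is positive; otherwise ruin has already occurred, and the
  path is continued without gains, which does not affect the ruin time.
\<close>

primrec level :: "'w dual_risk \<Rightarrow> real \<Rightarrow> 'w \<Rightarrow> nat \<Rightarrow> real" where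
  "level R x w 0 = x"
| "level R x w (Suc n) =
     (let u = level R x w n - gapB R n w in
      if u > 0 then
        (if thrT R n w \<ge> gapB R n w then (1 + a0 R) * u + gainC0 R n w
         else (1 + a1 R) * u + gainC1 R n w)
      else u)"

text \<open>Infinitely many gains before \<open>t\<close> (where \<open>card\<close> is \<open>0\<close>) occur with probability \<open>0\<close> only.\<close>

definition num_gains :: "'w dual_risk \<Rightarrow> real \<Rightarrow> 'w \<Rightarrow> nat" where
  "num_gains R t w = card {n. n > 0 \<and> gain_time R n w \<le> t}"

definition surplus :: "'w dual_risk \<Rightarrow> real \<Rightarrow> real \<Rightarrow> 'w \<Rightarrow> real" where
  "surplus R x t w =
     level R x w (num_gains R t w) - (t - gain_time R (num_gains R t w) w)"

definition ruin_time :: "'w dual_risk \<Rightarrow> real \<Rightarrow> 'w \<Rightarrow> ereal" where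
  "ruin_time R x w = Inf (ereal ` {t. t \<ge> 0 \<and> surplus R x t w = 0})"

definition discount :: "real \<Rightarrow> ereal \<Rightarrow> real" where
  "discount \<alpha> t = (if t = \<infinity> then 0 else exp (- (\<alpha> * real_of_ereal t)))"

definition tau :: "'w dual_risk \<Rightarrow> real \<Rightarrow> complex \<Rightarrow> complex" where
  "tau R \<alpha> s =
     (LINT x:{0<..}|lborel.
        exp (- (s * of_real x)) * of_real (\<integral>w. discount \<alpha> (ruin_time R x w) \<partial>base R))"

definition phi :: "'w dual_risk \<Rightarrow> complex \<Rightarrow> complex" where
  "phi R s = (\<integral>w. exp (- (s * of_real (gapB R 0 w))) \<partial>base R)"

definition chi0 :: "'w dual_risk \<Rightarrow> complex \<Rightarrow> complex" where
  "chi0 R s =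
     (\<integral>w. exp (- (s * of_real (gapB R 0 w))) * of_bool (thrT R 0 w \<ge> gapB R 0 w) \<partial>base R)"

definition chi1 :: "'w dual_risk \<Rightarrow> complex \<Rightarrow> complex" where
  "chi1 R s =
     (\<integral>w. exp (- (s * of_real (gapB R 0 w))) * of_bool (thrT R 0 w < gapB R 0 w) \<partial>base R)"

definition chi0_hat :: "'w dual_risk \<Rightarrow> complex \<Rightarrow> complex" where
  "chi0_hat R s = chi0 R s / of_real (1 + a0 R)"

definition chi1_hat :: "'w dual_risk \<Rightarrow> complex \<Rightarrow> complex" where
  "chi1_hat R s = chi1 R s / of_real (1 + a1 R)"

definition scale :: "'w dual_risk \<Rightarrow> nat \<Rightarrow> nat \<Rightarrow> complex \<Rightarrow> complex" where
  "scale R l m s = s / of_real ((1 + a0 R) ^ l * (1 + a1 R) ^ m)"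

definition L10 :: "'w dual_risk \<Rightarrow> real \<Rightarrow> complex \<Rightarrow> complex" where
  "L10 R \<alpha> s =
     chi0_hat R (s + of_real \<alpha>) *
     (\<Sum>j=1..nK R. of_real (wq R j) *
        (of_real (mu R j) / (of_real (mu R j) - s / of_real (1 + a0 R))))"

definition L01 :: "'w dual_risk \<Rightarrow> real \<Rightarrow> complex \<Rightarrow> complex" where
  "L01 R \<alpha> s =
     chi1_hat R (s + of_real \<alpha>) *
     (\<Sum>i=1..nL R. of_real (wh R i) *
        (of_real (nu R i) / (of_real (nu R i) - s / of_real (1 + a1 R))))"

text \<open>
  The arguments \<open>u\<close> and \<open>v\<close> stand for the values \<open>\<tau>(\<mu>\<^sub>j, \<alpha>)\<close> and \<open>\<tau>(\<nu>\<^sub>i, \<alpha>)\<close>; they are kept as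
  parameters because these values are the unknowns of the linear system.
\<close>

definition Ktil ::
  "'w dual_risk \<Rightarrow> real \<Rightarrow> (nat \<Rightarrow> complex) \<Rightarrow> (nat \<Rightarrow> complex) \<Rightarrow> complex \<Rightarrow> complex" where
  "Ktil R \<alpha> u v s =
     (1 - phi R (s + of_real \<alpha>)) / (s + of_real \<alpha>)
     - chi0_hat R (s + of_real \<alpha>) *
       (\<Sum>j=1..nK R. of_real (wq R j) *
          (of_real (mu R j) / (of_real (mu R j) - s / of_real (1 + a0 R))) * u j)
     - chi1_hat R (s + of_real \<alpha>) *
       (\<Sum>i=1..nL R. of_real (wh R i) *
          (of_real (nu R i) / (of_real (nu R i) - s / of_real (1 + a1 R))) * v i)"

fun Ltil :: "'w dual_risk \<Rightarrow> real \<Rightarrow> complex \<Rightarrow> nat \<Rightarrow> nat \<Rightarrow> complex" where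
  "Ltil R \<alpha> s 0 0 = 1"
| "Ltil R \<alpha> s (Suc l) 0 = Ltil R \<alpha> s l 0 * L10 R \<alpha> (scale R l 0 s)"
| "Ltil R \<alpha> s 0 (Suc m) = Ltil R \<alpha> s 0 m * L01 R \<alpha> (scale R 0 m s)"
| "Ltil R \<alpha> s (Suc l) (Suc m) =
     Ltil R \<alpha> s l (Suc m) * L10 R \<alpha> (scale R l (Suc m) s)
     + Ltil R \<alpha> s (Suc l) m * L01 R \<alpha> (scale R (Suc l) m s)"

definition Ldiag :: "'w dual_risk \<Rightarrow> real \<Rightarrow> complex \<Rightarrow> nat \<Rightarrow> complex" where
  "Ldiag R \<alpha> s n = (\<Sum>l=0..n. Ltil R \<alpha> s l (n - l))"

definition LKdiag ::
  "'w dual_risk \<Rightarrow> real \<Rightarrow> (nat \<Rightarrow> complex) \<Rightarrow> (nat \<Rightarrow> complex) \<Rightarrow> complex \<Rightarrow> nat \<Rightarrow> complex" where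
  "LKdiag R \<alpha> u v s j =
     (\<Sum>l=0..j. Ltil R \<alpha> s l (j - l) * Ktil R \<alpha> u v (scale R l (j - l) s))"

definition tau_series ::
  "'w dual_risk \<Rightarrow> real \<Rightarrow> (nat \<Rightarrow> complex) \<Rightarrow> (nat \<Rightarrow> complex) \<Rightarrow> complex \<Rightarrow> complex" where
  "tau_series R \<alpha> u v s = lim (Ldiag R \<alpha> s) + (\<Sum>j. LKdiag R \<alpha> u v s j)"

definition sing :: "'w dual_risk \<Rightarrow> complex set" where
  "sing R =
     {of_real (mu R i * (1 + a0 R) ^ (l + 1) * (1 + a1 R) ^ m) | i l m. i \<in> {1..nK R}} \<union>
     {of_real (nu R i * (1 + a0 R) ^ l * (1 + a1 R) ^ (m + 1)) | i l m. i \<in> {1..nL R}}"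

text \<open>
  \<open>F\<close> takes the value \<open>z\<close> at \<open>s\<close>, where at a point of the exceptional set \<open>S\<close> the value is the limit
  (in particular, the singularity is then required to be removable).
\<close>

definition takes_value :: "complex set \<Rightarrow> (complex \<Rightarrow> complex) \<Rightarrow> complex \<Rightarrow> complex \<Rightarrow> bool" where
  "takes_value S F s z \<longleftrightarrow> (if s \<in> S then (F \<longlongrightarrow> z) (at s) else F s = z)"

definition solves_system ::
  "'w dual_risk \<Rightarrow> real \<Rightarrow> (nat \<Rightarrow> complex) \<Rightarrow> (nat \<Rightarrow> complex) \<Rightarrow> bool" where
  "solves_system R \<alpha> u v \<longleftrightarrow>
     (\<forall>j\<in>{1..nK R}. takes_value (sing R) (tau_series R \<alpha> u v) (of_real (mu R j)) (u j)) \<and>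
     (\<forall>i\<in>{1..nL R}. takes_value (sing R) (tau_series R \<alpha> u v) (of_real (nu R i)) (v i))"

end

theory Submission
  imports Defs "HOL-Complex_Analysis.Complex_Analysis" "HOL-Real_Asymp.Real_Asymp"
begin

text \<open>
  Let \<open>f x\<close> be the expected discount factor at ruin. Conditioning on the first gain gives
  \<open>f = psi + P f\<close> with an operator \<open>P\<close> that contracts the supremum norm. Its Laplace transform is
  \<open>\<tau> = K + T \<tau>\<close> with \<open>T \<Phi> s = L\<^sub>1\<^sub>0 s \<Phi> (s / (1 + a\<^sub>0)) + L\<^sub>0\<^sub>1 s \<Phi> (s / (1 + a\<^sub>1))\<close>, and the diagonal sums
  over \<open>L\<^sub>l\<^sub>,\<^sub>m\<close> are the iterates of \<open>T\<close>. Near \<open>0\<close> the operator \<open>T\<close> contracts, and iterating it moves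
  every argument to \<open>0\<close>; hence the series converges geometrically, while the limit of the diagonal
  sums is \<open>0\<close>.

  For uniqueness, let \<open>G\<close> be the difference of the series belonging to two solutions of the linear
  system. By the equations of the system all singularities of \<open>G\<close> are removable, so \<open>G\<close> extends
  holomorphically to \<open>Re s > - \<alpha> / 2\<close>; the functional equation gives the decay \<open>1 / norm s\<close>, so that
  Bromwich inversion represents \<open>G\<close> as the Laplace transform of a bounded function \<open>g\<close>. Then \<open>G\<close> is
  also the transform of \<open>P\<^sup>n g\<close> for every \<open>n\<close>, and \<open>P\<^sup>n g\<close> tends to \<open>0\<close> uniformly.
\<close>

section \<open>Laplace transforms of bounded functions\<close>

text \<open>An exponential gain of rate m turns a transform F into the divided difference m (F s - F
  m) / (m - s), which has no pole. Both the unknowns and the poles of the series come from splitting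
  it: the part with F s goes into T, the part with F m into K. The transform of P f is free of poles
  in the right half-plane, whereas T and K separately are not.

  Two facts obstruct a direct uniqueness proof. T contracts only near 0, so the homogeneous equation
  for G does not bound G globally; and a solution of the system is a bare vector, not attached to
  any function on which P could act. No determinant is computed. The equations of the system are
  just what allows the two parts to be recombined into divided differences, one dilation step at a
  time; this produces the continuation of G and then, by inverting each divided difference instead
  of G, the function g. With g at hand the contraction of P replaces the missing contraction of
  T.\<close>

definition laplace :: "(real \<Rightarrow> complex) \<Rightarrow> complex \<Rightarrow> complex" where
  "laplace k s = (LINT x:{0<..}|lborel. exp (- (s * of_real x)) * k x)"

lemma exp_integral_Ioi:
  fixes c :: real
  assumes "c > 0"
  shows "integrable lborel (\<lambda>x. indicator {0<..} x * exp (- (c * x)))"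
    and "(\<integral>x. indicator {0<..} x * exp (- (c * x)) \<partial>lborel) = 1 / c"
  using integrable_I0i_exp_mscale[OF assms] LBINT_I0i_exp_mscale[OF assms]
  by (simp_all add: set_integrable_def interval_lebesgue_integral_0_infty
      set_lebesgue_integral_def mult.commute)

text \<open>The decay rate \<beta> is general because the expected discount decays like exp (-
  \<alpha> x), which bounds its transform to the left of the imaginary axis as well; bounded
  functions are the case \<beta> = 0.\<close>

lemma laplace_integrable:
  assumes [measurable]: "k \<in> borel_measurable borel"
    and k: "\<And>x. x > 0 \<Longrightarrow> norm (k x) \<le> C * exp (- (\<beta> * x))" and s: "Re s > - \<beta>"
  shows "integrable lborel (\<lambda>x. indicator {0<..} x *\<^sub>R (exp (- (s * of_real x)) * k x))"
    and "norm (laplace k s) \<le> C / (Re s + \<beta>)"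
proof -
  have e: "norm (indicator {0<..} x *\<^sub>R (exp (- (s * of_real x)) * k x))
      \<le> C * (indicator {0<..} x * exp (- ((Re s + \<beta>) * x)))" for x
    using k[of x] mult_left_mono[of "norm (k x)" "C * exp (- (\<beta> * x))" "exp (- (Re s * x))"]
    by (auto simp: indicator_def norm_mult mult_exp_exp algebra_simps)
  have p: "Re s + \<beta> > 0" using s by simp
  have i: "integrable lborel (\<lambda>x. C * (indicator {0<..} x * exp (- ((Re s + \<beta>) * x))))"
    using exp_integral_Ioi(1)[OF p] by simp
  show I: "integrable lborel (\<lambda>x. indicator {0<..} x *\<^sub>R (exp (- (s * of_real x)) * k x))"
    by (rule Bochner_Integration.integrable_bound[OF i]) (use e in \<open>auto intro: order_trans[OF _ abs_ge_self]\<close>)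
  have "norm (laplace k s) \<le> (\<integral>x. C * (indicator {0<..} x * exp (- ((Re s + \<beta>) * x))) \<partial>lborel)"
    unfolding laplace_def set_lebesgue_integral_def
    by (intro integral_norm_bound[THEN order_trans] integral_mono integrable_norm I i e)
  also have "\<dots> = C / (Re s + \<beta>)"
    using exp_integral_Ioi[OF p] by simp
  finally show "norm (laplace k s) \<le> C / (Re s + \<beta>)" .
qed

lemma laplace_bounded:
  assumes "k \<in> borel_measurable borel" "\<And>x. norm (k x) \<le> C" "Re s > 0"
  shows "integrable lborel (\<lambda>x. indicator {0<..} x *\<^sub>R (exp (- (s * of_real x)) * k x))"
    and "norm (laplace k s) \<le> C / Re s"
  using laplace_integrable[of k C 0 s] assms by auto

lemma laplace_cong: "(\<And>x. x > 0 \<Longrightarrow> k x = k' x) \<Longrightarrow> laplace k s = laplace k' s"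
  unfolding laplace_def by (intro set_lebesgue_integral_cong) auto

lemma laplace_add:
  assumes "k \<in> borel_measurable borel" "\<And>x. norm (k x) \<le> C"
    and "k' \<in> borel_measurable borel" "\<And>x. norm (k' x) \<le> C'" "Re s > 0"
  shows "laplace (\<lambda>x. k x + k' x) s = laplace k s + laplace k' s"
  using laplace_bounded(1)[OF assms(1,2,5)] laplace_bounded(1)[OF assms(3,4,5)]
  by (simp add: laplace_def set_lebesgue_integral_def distrib_left scaleR_add_right)

lemma laplace_sum:
  assumes "\<And>j. j \<in> I \<Longrightarrow> k j \<in> borel_measurable borel" "\<And>j x. j \<in> I \<Longrightarrow> norm (k j x) \<le> C j" "Re s > 0"
  shows "laplace (\<lambda>x. \<Sum>j\<in>I. p j * k j x) s = (\<Sum>j\<in>I. p j * laplace (k j) s)"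
proof -
  have "integrable lborel (\<lambda>x. p j * (indicator {0<..} x *\<^sub>R (exp (- (s * of_real x)) * k j x)))" if "j \<in> I" for j
    by (intro integrable_mult_right laplace_bounded(1)[OF assms(1,2)[OF that] assms(3)])
  then have "(\<integral>x. (\<Sum>j\<in>I. p j * (indicator {0<..} x *\<^sub>R (exp (- (s * of_real x)) * k j x))) \<partial>lborel)
      = (\<Sum>j\<in>I. p j * laplace (k j) s)"
    unfolding laplace_def set_lebesgue_integral_def
    by (subst Bochner_Integration.integral_sum) (simp_all only: integral_mult_right_zero)
  then show ?thesis
    by (simp add: laplace_def set_lebesgue_integral_def sum_distrib_left scaleR_sum_right mult.left_commute)
qed

text \<open>Values at points of \<open>sing R\<close> are prescribed as limits; continuity of
  transforms is what carries identities over to these points.\<close>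

lemma laplace_tendsto:
  assumes [measurable]: "k \<in> borel_measurable borel" and k: "\<And>x. norm (k x) \<le> C" and s: "Re s > 0"
  shows "(laplace k \<longlongrightarrow> laplace k s) (at s)"
proof (subst tendsto_at_iff_sequentially, intro allI impI)
  fix z :: "nat \<Rightarrow> complex"
  assume z: "z \<longlonglongrightarrow> s"
  then have "(\<lambda>n. Re (z n)) \<longlonglongrightarrow> Re s" by (intro tendsto_intros)
  \<comment> \<open>Half the real part is the decay rate of a single majorant for all late terms of
    the sequence.\<close>
  then have "eventually (\<lambda>n. Re (z n) > Re s / 2) sequentially"
    using s by (intro order_tendstoD) auto
  then obtain N where N: "\<And>n. n \<ge> N \<Longrightarrow> Re (z n) > Re s / 2"
    by (auto simp: eventually_sequentially)
  have p: "Re s / 2 > 0" using s by simp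
  have i: "integrable lborel (\<lambda>x. C * (indicator {0<..} x * exp (- ((Re s / 2) * x))))"
    using exp_integral_Ioi(1)[OF p] by simp
  have "(\<lambda>n. laplace k (z (n + N))) \<longlonglongrightarrow> laplace k s"
    unfolding laplace_def set_lebesgue_integral_def
  proof (rule integral_dominated_convergence[OF _ _ i])
    show "AE x in lborel. (\<lambda>n. indicator {0<..} x *\<^sub>R (exp (- (z (n + N) * of_real x)) * k x))
        \<longlonglongrightarrow> indicator {0<..} x *\<^sub>R (exp (- (s * of_real x)) * k x)"
      by (intro AE_I2 tendsto_intros LIMSEQ_ignore_initial_segment z)
    show "AE x in lborel. norm (indicator {0<..} x *\<^sub>R (exp (- (z (n + N) * of_real x)) * k x))
        \<le> C * (indicator {0<..} x * exp (- ((Re s / 2) * x)))" for n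
    proof (intro AE_I2)
      fix x :: real
      have "x > 0 \<Longrightarrow> Re s / 2 * x \<le> Re (z (n + N)) * x"
        using N[of "n + N"] by (intro mult_right_mono) auto
      then have "x > 0 \<Longrightarrow> exp (- (Re (z (n + N)) * x)) * norm (k x) \<le> exp (- ((Re s / 2) * x)) * C"
        by (intro mult_mono) (auto simp: k)
      then show "norm (indicator {0<..} x *\<^sub>R (exp (- (z (n + N) * of_real x)) * k x))
        \<le> C * (indicator {0<..} x * exp (- ((Re s / 2) * x)))"
        by (auto simp: indicator_def norm_mult mult.commute)
    qed
  qed auto
  then show "(laplace k \<circ> z) \<longlonglongrightarrow> laplace k s"
    by (simp add: comp_def LIMSEQ_offset)
qed

text \<open>The substitution x = B + y / c under the expectation separates the factor exp (- s B)
  from the transform of \<open>k\<close>; the dilation costs a factor 1 / c and divides the argument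
  by c. This is the source of the divisors in \<open>chi0_hat\<close>, \<open>chi1_hat\<close> and
  of the arguments s / (1 + a).\<close>

lemma (in prob_space) laplace_kernel:
  fixes B :: "'a \<Rightarrow> real" and J :: "'a \<Rightarrow> complex"
  assumes [measurable]: "random_variable borel B" "J \<in> borel_measurable M" "k \<in> borel_measurable borel"
    and B: "\<And>w. w \<in> space M \<Longrightarrow> B w > 0" and J: "\<And>w. w \<in> space M \<Longrightarrow> norm (J w) \<le> 1"
    and k: "\<And>x. norm (k x) \<le> C" and c: "c > 0" and s: "Re s > 0"
  shows "laplace (\<lambda>x. \<integral>w. J w * of_bool (B w < x) * k (c * (x - B w)) \<partial>M) s
    = (\<integral>w. exp (- (s * of_real (B w))) * J w \<partial>M) / of_real c * laplace k (s / of_real c)"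
proof -
  interpret pair_sigma_finite M lborel ..
  let ?F = "\<lambda>w x. indicator {0<..} x *\<^sub>R
    (exp (- (s * of_real x)) * (J w * of_bool (B w < x) * k (c * (x - B w))))"
  have C: "C \<ge> 0" using k[of 0] norm_ge_zero order_trans by blast
  have i0: "integrable (M \<Otimes>\<^sub>M lborel) (\<lambda>(w, x). C * (indicator {0<..} x * exp (- (Re s * x))))"
  proof (rule Fubini_integrable)
    show "AE w in M. integrable lborel (\<lambda>y. case (w, y) of (w, x) \<Rightarrow> C * (indicator {0<..} x * exp (- (Re s * x))))"
      using exp_integral_Ioi(1)[OF s] by simp
  qed auto
  have int: "integrable (M \<Otimes>\<^sub>M lborel) (\<lambda>(w, x). ?F w x)"
  proof (rule Bochner_Integration.integrable_bound[OF i0], goal_cases)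
    case 1
    show ?case by measurable
  next
    case 2
    have "norm (?F w x) \<le> C * (indicator {0<..} x * exp (- (Re s * x)))" if "w \<in> space M" for w x
    proof -
      have "norm (J w * of_bool (B w < x) * k (c * (x - B w))) \<le> 1 * 1 * C"
        unfolding norm_mult by (intro mult_mono J k that) (auto simp: C)
      then have "exp (- (Re s * x)) * norm (J w * of_bool (B w < x) * k (c * (x - B w))) \<le> exp (- (Re s * x)) * C"
        by (intro mult_left_mono) auto
      then show ?thesis
        by (auto simp: indicator_def norm_mult mult_ac)
    qed
    then show ?case by (auto intro!: AE_I2 order_trans[OF _ abs_ge_self] simp: space_pair_measure)
  qed
  have inner: "(\<integral>x. ?F w x \<partial>lborel) = exp (- (s * of_real (B w))) * J w / of_real c * laplace k (s / of_real c)"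
    if w: "w \<in> space M" for w
  proof -
    have "(\<integral>x. ?F w x \<partial>lborel) = \<bar>1 / c\<bar> *\<^sub>R (\<integral>y. ?F w (B w + (1 / c) * y) \<partial>lborel)"
      using c by (intro lborel_integral_real_affine) auto
    also have "(\<integral>y. ?F w (B w + (1 / c) * y) \<partial>lborel) =
      (\<integral>y. (exp (- (s * of_real (B w))) * J w) * (indicator {0<..} y *\<^sub>R (exp (- (s / of_real c * of_real y)) * k y)) \<partial>lborel)"
    proof (rule Bochner_Integration.integral_cong[OF refl])
      fix y :: real
      have e: "exp (- (s * of_real (B w + 1 / c * y))) = exp (- (s * of_real (B w))) * exp (- (s / of_real c * of_real y))"
        by (simp add: mult_exp_exp algebra_simps)
      \<comment> \<open>Since \<open>B w\<close> is positive, the restriction to positive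
        \<open>x\<close> is implied by \<open>B w < x\<close>.\<close>
      have "y > 0 \<Longrightarrow> B w + y / c > 0" using B[OF w] c by (simp add: add_pos_pos)
      then show "?F w (B w + (1 / c) * y) = (exp (- (s * of_real (B w))) * J w) * (indicator {0<..} y *\<^sub>R (exp (- (s / of_real c * of_real y)) * k y))"
        unfolding e using c by (auto simp: indicator_def zero_less_divide_iff mult_ac)
    qed
    also have "\<dots> = (exp (- (s * of_real (B w))) * J w) * laplace k (s / of_real c)"
      unfolding laplace_def set_lebesgue_integral_def by (rule integral_mult_right_zero)
    finally show ?thesis using c by (simp add: scaleR_conv_of_real)
  qed
  have "laplace (\<lambda>x. \<integral>w. J w * of_bool (B w < x) * k (c * (x - B w)) \<partial>M) s = (\<integral>x. (\<integral>w. ?F w x \<partial>M) \<partial>lborel)"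
    by (simp add: laplace_def set_lebesgue_integral_def)
  also have "\<dots> = (\<integral>w. (\<integral>x. ?F w x \<partial>lborel) \<partial>M)"
    by (rule Fubini_integral[OF int])
  also have "\<dots> = (\<integral>w. exp (- (s * of_real (B w))) * J w / of_real c * laplace k (s / of_real c) \<partial>M)"
    by (intro Bochner_Integration.integral_cong refl inner)
  finally show ?thesis by simp
qed

text \<open>\<open>exp_shift m k v\<close> is the expectation of \<open>k (v + C)\<close> for \<open>C\<close> exponential with rate \<open>m\<close>.\<close>

definition exp_shift :: "real \<Rightarrow> (real \<Rightarrow> complex) \<Rightarrow> real \<Rightarrow> complex" where
  "exp_shift m k v = (LINT c:{0<..}|lborel. of_real (m * exp (- (m * c))) * k (v + c))"

lemma exp_shift_measurable [measurable]:
  assumes [measurable]: "k \<in> borel_measurable borel"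
  shows "exp_shift m k \<in> borel_measurable borel"
  unfolding exp_shift_def[abs_def] set_lebesgue_integral_def by measurable

lemma exp_shift_integrable:
  assumes [measurable]: "k \<in> borel_measurable borel" and k: "\<And>x. norm (k x) \<le> C" and m: "m > 0"
  shows "integrable lborel (\<lambda>c. indicator {0<..} c *\<^sub>R (of_real (m * exp (- (m * c))) * k (v + c)))"
    and "norm (exp_shift m k v) \<le> C"
proof -
  have e: "norm (indicator {0<..} c *\<^sub>R (of_real (m * exp (- (m * c))) * k (v + c)))
      \<le> C * m * (indicator {0<..} c * exp (- (m * c)))" for c
    using mult_left_mono[OF k[of "v + c"], of "m * exp (- (m * c))"] m
    by (auto simp: indicator_def norm_mult mult_ac)
  have i: "integrable lborel (\<lambda>c. C * m * (indicator {0<..} c * exp (- (m * c))))"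
    using exp_integral_Ioi(1)[OF m] by simp
  show I: "integrable lborel (\<lambda>c. indicator {0<..} c *\<^sub>R (of_real (m * exp (- (m * c))) * k (v + c)))"
    by (rule Bochner_Integration.integrable_bound[OF i]) (use e in \<open>auto intro: order_trans[OF _ abs_ge_self]\<close>)
  have "norm (exp_shift m k v) \<le> (\<integral>c. C * m * (indicator {0<..} c * exp (- (m * c))) \<partial>lborel)"
    unfolding exp_shift_def set_lebesgue_integral_def
    by (intro integral_norm_bound[THEN order_trans] integral_mono integrable_norm I i e)
  also have "\<dots> = C"
    using exp_integral_Ioi(2)[OF m] m by simp
  finally show "norm (exp_shift m k v) \<le> C" .
qed

lemma exp_integral_bounded_interval:
  fixes z :: complex
  assumes "z \<noteq> 0" "y \<ge> 0"
  shows "(\<integral>v. indicator {0..y} v *\<^sub>R exp (z * of_real v) \<partial>lborel) = (exp (z * of_real y) - 1) / z"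
proof -
  have "has_bochner_integral lborel (\<lambda>v. indicator {0..y} v *\<^sub>R exp (z * of_real v))
      (exp (z * of_real y) / z - exp (z * of_real 0) / z)"
    by (rule has_bochner_integral_FTC_Icc[OF assms(2)])
       (auto intro!: derivative_eq_intros has_vector_derivative_real_field continuous_intros simp: assms)
  then show ?thesis
    by (simp add: has_bochner_integral_integral_eq diff_divide_distrib)
qed

text \<open>Interchanging the integrals leaves, for each landing point y = v + c, the integral of
  exp ((m - s) v) over 0 < v < y. Its two boundary terms produce exp (- s y) and exp (- m y), hence
  the transforms at s and at m, which together form a divided difference.\<close>

lemma laplace_exp_shift:
  assumes [measurable]: "k \<in> borel_measurable borel" and k: "\<And>x. norm (k x) \<le> C"
    and m: "m > 0" and s: "Re s > 0" "s \<noteq> of_real m"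
  shows "laplace (exp_shift m k) s = of_real m * (laplace k s - laplace k (of_real m)) / (of_real m - s)"
proof -
  let ?F = "\<lambda>v y. (indicator {0<..} v * indicator {0<..} (y - v)) *\<^sub>R
     (exp (- (s * of_real v)) * (of_real (m * exp (- (m * (y - v)))) * k y))"
  have C: "C \<ge> 0" using k[of 0] norm_ge_zero order_trans by blast
  have shift: "(\<integral>y. g y \<partial>lborel) = (\<integral>c. g (v + c) \<partial>lborel)" for g :: "real \<Rightarrow> 'b::{banach,second_countable_topology}" and v
    using lborel_integral_real_affine[of 1 g v] by simp
  \<comment> \<open>The majorant is a product in \<open>v\<close> and \<open>y - v\<close>, so its
    integrability reduces to two exponential integrals.\<close>
  let ?H = "\<lambda>v y. (indicator {0<..} v * exp (- (Re s * v))) * (C * m * (indicator {0<..} (y - v) * exp (- (m * (y - v)))))"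
  have iH: "integrable lborel (\<lambda>y. C * m * (indicator {0<..} (y - v) * exp (- (m * (y - v)))))" for v :: real
    using lborel_integrable_real_affine[OF exp_integral_Ioi(1)[OF m], of 1 "-v"] by simp
  have vH: "(\<integral>y. C * m * (indicator {0<..} (y - v) * exp (- (m * (y - v)))) \<partial>lborel) = C" for v :: real
    using exp_integral_Ioi(2)[OF m] m by (subst shift[of _ v]) simp
  have i0: "integrable (lborel \<Otimes>\<^sub>M lborel) (\<lambda>(v, y). ?H v y)"
  proof (rule lborel_pair.Fubini_integrable)
    show "(\<lambda>(v, y). ?H v y) \<in> borel_measurable (lborel \<Otimes>\<^sub>M lborel)" by measurable
    show "AE v in lborel. integrable lborel (\<lambda>y. case (v, y) of (v, y) \<Rightarrow> ?H v y)"
      using iH by (intro AE_I2) simp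
    have "(\<integral>y. norm (case (v, y) of (v, y) \<Rightarrow> ?H v y) \<partial>lborel) = indicator {0<..} v * exp (- (Re s * v)) * C" for v
    proof -
      have "(\<integral>y. norm (case (v, y) of (v, y) \<Rightarrow> ?H v y) \<partial>lborel) = (\<integral>y. ?H v y \<partial>lborel)"
        using C m by (intro Bochner_Integration.integral_cong) (auto simp: abs_mult)
      also have "\<dots> = indicator {0<..} v * exp (- (Re s * v)) * C"
        using vH[of v] by simp
      finally show ?thesis .
    qed
    then show "integrable lborel (\<lambda>v. \<integral>y. norm (case (v, y) of (v, y) \<Rightarrow> ?H v y) \<partial>lborel)"
      using exp_integral_Ioi(1)[OF s(1)] by simp
  qed
  have int: "integrable (lborel \<Otimes>\<^sub>M lborel) (\<lambda>(v, y). ?F v y)"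
  proof (rule Bochner_Integration.integrable_bound[OF i0], goal_cases)
    case 1
    show ?case by measurable
  next
    case 2
    have "norm (?F v y) \<le> ?H v y" for v y
      using mult_left_mono[OF k[of y], of "exp (- (Re s * v)) * (m * exp (- (m * (y - v))))"] m
      by (auto simp: indicator_def norm_mult mult_ac)
    then show ?case by (auto intro!: AE_I2 order_trans[OF _ abs_ge_self])
  qed
  have "laplace (exp_shift m k) s = (\<integral>v. (\<integral>y. ?F v y \<partial>lborel) \<partial>lborel)"
    unfolding laplace_def set_lebesgue_integral_def
  proof (rule Bochner_Integration.integral_cong[OF refl])
    fix v :: real
    have "(\<integral>y. ?F v y \<partial>lborel) = (\<integral>c. ?F v (v + c) \<partial>lborel)" by (rule shift)
    also have "\<dots> = (\<integral>c. (indicator {0<..} v *\<^sub>R exp (- (s * of_real v))) * (indicator {0<..} c *\<^sub>R (of_real (m * exp (- (m * c))) * k (v + c))) \<partial>lborel)"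
      by (intro Bochner_Integration.integral_cong) (auto simp: indicator_def)
    also have "\<dots> = (indicator {0<..} v *\<^sub>R exp (- (s * of_real v))) * exp_shift m k v"
      unfolding exp_shift_def set_lebesgue_integral_def by (rule integral_mult_right_zero)
    finally show "indicator {0<..} v *\<^sub>R (exp (- (s * of_real v)) * exp_shift m k v) = (\<integral>y. ?F v y \<partial>lborel)"
      by simp
  qed
  also have "\<dots> = (\<integral>y. (\<integral>v. ?F v y \<partial>lborel) \<partial>lborel)"
    by (rule lborel_pair.Fubini_integral[OF int, symmetric])
  also have "\<dots> = (\<integral>y. of_real m / (of_real m - s) * (indicator {0<..} y *\<^sub>R (exp (- (s * of_real y)) * k y)
     - indicator {0<..} y *\<^sub>R (exp (- (of_real m * of_real y)) * k y)) \<partial>lborel)"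
  proof (rule Bochner_Integration.integral_cong[OF refl])
    fix y :: real
    have ms: "of_real m - s \<noteq> 0" using s by auto
    show "(\<integral>v. ?F v y \<partial>lborel) = of_real m / (of_real m - s) * (indicator {0<..} y *\<^sub>R (exp (- (s * of_real y)) * k y)
     - indicator {0<..} y *\<^sub>R (exp (- (of_real m * of_real y)) * k y))"
    proof (cases "y > 0")
      case False
      then have z: "(\<lambda>v. ?F v y) = (\<lambda>_. 0)" by (auto simp: fun_eq_iff indicator_def)
      have "(\<integral>v. ?F v y \<partial>lborel) = 0" unfolding z by simp
      then show ?thesis using False by simp
    next
      case True
      have e: "exp (- (s * of_real v)) * of_real (m * exp (- (m * (y - v)))) = of_real m * exp (- (of_real m * of_real y)) * exp ((of_real m - s) * of_real v)" for v
      proof -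
        have "of_real (exp (- (m * (y - v)))) = exp (- (of_real m * (of_real y - of_real v)) :: complex)"
          by (simp flip: exp_of_real)
        then show ?thesis by (simp add: mult_exp_exp algebra_simps)
      qed
      have "(\<integral>v. ?F v y \<partial>lborel) = (\<integral>v. of_real m * exp (- (of_real m * of_real y)) * k y * (indicator {0..y} v *\<^sub>R exp ((of_real m - s) * of_real v)) \<partial>lborel)"
      proof (rule integral_cong_AE)
        show "AE v in lborel. ?F v y = of_real m * exp (- (of_real m * of_real y)) * k y * (indicator {0..y} v *\<^sub>R exp ((of_real m - s) * of_real v))"
          using AE_lborel_singleton[of 0] AE_lborel_singleton[of y]
        proof eventually_elim
          case (elim v)
          show ?case
          proof (cases "0 < v \<and> v < y")
            case True
            then show ?thesis using arg_cong[OF e[of v], of "\<lambda>t. t * k y"] by (simp add: indicator_def mult.assoc mult.left_commute)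
          next
            case False
            then show ?thesis using elim by (auto simp: indicator_def)
          qed
        qed
      qed auto
      also have "\<dots> = of_real m * exp (- (of_real m * of_real y)) * k y * ((exp ((of_real m - s) * of_real y) - 1) / (of_real m - s))"
        using exp_integral_bounded_interval[OF ms, of y] True by (simp only: integral_mult_right_zero)
      also have "\<dots> = of_real m / (of_real m - s) * ((exp (- (of_real m * of_real y)) * exp ((of_real m - s) * of_real y) - exp (- (of_real m * of_real y))) * k y)"
        by (simp add: algebra_simps diff_divide_distrib)
      also have "exp (- (of_real m * of_real y)) * exp ((of_real m - s) * of_real y) = exp (- (s * of_real y))"
        by (simp add: mult_exp_exp algebra_simps)
      finally show ?thesis using True by (simp add: algebra_simps)
    qed
  qed
  also have "\<dots> = of_real m / (of_real m - s) * (laplace k s - laplace k (of_real m))"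
    using laplace_bounded(1)[OF assms(1,2) s(1)] laplace_bounded(1)[OF assms(1,2), of "of_real m"] m
    by (simp add: laplace_def set_lebesgue_integral_def)
  finally show ?thesis by simp
qed

text \<open>The contribution of ruin before the first gain: from level x it occurs at time x, on the
  event x \<le> B. After Fubini the inner integral runs over 0 < x \<le> B and is
  elementary.\<close>

lemma (in prob_space) laplace_truncated_exp:
  fixes B :: "'a \<Rightarrow> real" and \<alpha> :: real
  assumes [measurable]: "random_variable borel B"
    and B: "\<And>w. w \<in> space M \<Longrightarrow> B w > 0" and \<alpha>: "\<alpha> > 0" and s: "Re s > 0"
  shows "laplace (\<lambda>x. \<integral>w. of_bool (x \<le> B w) * exp (- (of_real \<alpha> * of_real x)) \<partial>M) s
    = (1 - (\<integral>w. exp (- ((s + of_real \<alpha>) * of_real (B w))) \<partial>M)) / (s + of_real \<alpha>)"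
proof -
  interpret pair_sigma_finite M lborel ..
  let ?F = "\<lambda>w x. indicator {0<..} x *\<^sub>R
    (exp (- (s * of_real x)) * (of_bool (x \<le> B w) * exp (- (of_real \<alpha> * of_real x))))"
  have i0: "integrable (M \<Otimes>\<^sub>M lborel) (\<lambda>(w, x). indicator {0<..} x * exp (- (Re s * x)))"
  proof (rule Fubini_integrable)
    show "AE w in M. integrable lborel (\<lambda>y. case (w, y) of (w, x) \<Rightarrow> indicator {0<..} x * exp (- (Re s * x)))"
      using exp_integral_Ioi(1)[OF s] by simp
  qed auto
  have int: "integrable (M \<Otimes>\<^sub>M lborel) (\<lambda>(w, x). ?F w x)"
  proof (rule Bochner_Integration.integrable_bound[OF i0], goal_cases)
    case 1
    show ?case by measurable
  next
    case 2
    have "norm (?F w x) \<le> indicator {0<..} x * exp (- (Re s * x))" for w x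
      using \<alpha> by (auto simp: indicator_def norm_mult)
    then show ?case by (auto intro!: AE_I2 order_trans[OF _ abs_ge_self])
  qed
  let ?z = "s + of_real \<alpha>"
  have z: "?z \<noteq> 0" using s \<alpha> by (auto simp: complex_eq_iff)
  have inner: "(\<integral>x. ?F w x \<partial>lborel) = (1 - exp (- (?z * of_real (B w)))) / ?z"
    if w: "w \<in> space M" for w
  proof -
    have "(\<integral>x. ?F w x \<partial>lborel) = (\<integral>x. indicator {0..B w} x *\<^sub>R exp ((- ?z) * of_real x) \<partial>lborel)"
    proof (rule integral_cong_AE)
      show "AE x in lborel. ?F w x = indicator {0..B w} x *\<^sub>R exp ((- ?z) * of_real x)"
        using AE_lborel_singleton[of 0]
        by eventually_elim (auto simp: indicator_def mult_exp_exp algebra_simps)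
    qed auto
    also have "\<dots> = (exp ((- ?z) * of_real (B w)) - 1) / (- ?z)"
      using z B[OF w] by (intro exp_integral_bounded_interval) (auto simp: neg_equal_iff_equal simp del: minus_add_distrib)
    also have "\<dots> = (1 - exp (- (?z * of_real (B w)))) / ?z"
      by (metis minus_diff_eq minus_divide_divide mult_minus_left)
    finally show ?thesis .
  qed
  have "norm (exp (- (?z * of_real (B w)))) \<le> 1" if "w \<in> space M" for w
    using mult_nonneg_nonneg[of "Re s + \<alpha>" "B w"] B[OF that] s \<alpha> by simp
  then have ie: "integrable M (\<lambda>w. exp (- (?z * of_real (B w))))"
    by (intro integrable_const_bound[of _ 1]) auto
  have "laplace (\<lambda>x. \<integral>w. of_bool (x \<le> B w) * exp (- (of_real \<alpha> * of_real x)) \<partial>M) s = (\<integral>x. (\<integral>w. ?F w x \<partial>M) \<partial>lborel)"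
    by (simp add: laplace_def set_lebesgue_integral_def)
  also have "\<dots> = (\<integral>w. (\<integral>x. ?F w x \<partial>lborel) \<partial>M)"
    by (rule Fubini_integral[OF int])
  also have "\<dots> = (\<integral>w. (1 - exp (- (?z * of_real (B w)))) / ?z \<partial>M)"
    by (intro Bochner_Integration.integral_cong refl inner)
  also have "\<dots> = (1 - (\<integral>w. exp (- (?z * of_real (B w))) \<partial>M)) / ?z"
    using ie by (simp add: prob_space)
  finally show ?thesis .
qed

section \<open>Holomorphy of the transforms of a gap\<close>

lemma (in prob_space) exp_transform_integrable:
  fixes B :: "'a \<Rightarrow> real" and J :: "'a \<Rightarrow> complex"
  assumes [measurable]: "random_variable borel B" "J \<in> borel_measurable M"
    and B: "\<And>w. w \<in> space M \<Longrightarrow> B w > 0" and J: "\<And>w. norm (J w) \<le> 1" and s: "Re s \<ge> 0"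
  shows "integrable M (\<lambda>w. exp (- (s * of_real (B w))) * J w)"
proof (rule integrable_const_bound[of _ 1])
  have "norm (exp (- (s * of_real (B w))) * J w) \<le> 1 * 1" if "w \<in> space M" for w
    unfolding norm_mult using B[OF that] s J[of w] by (intro mult_mono) auto
  then show "AE w in M. norm (exp (- (s * of_real (B w))) * J w) \<le> 1" by auto
qed auto

text \<open>Differentiation under the integral sign by dominated convergence; the factor
  \<open>B w\<close> brought down by the derivative is absorbed by the exponential, whose rate at
  \<open>s\<close> is positive.\<close>

lemma (in prob_space) exp_transform_holomorphic:
  fixes B :: "'a \<Rightarrow> real" and J :: "'a \<Rightarrow> complex"
  assumes [measurable]: "random_variable borel B" "J \<in> borel_measurable M"
    and B: "\<And>w. w \<in> space M \<Longrightarrow> B w > 0" and J: "\<And>w. norm (J w) \<le> 1"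
  shows "(\<lambda>s. \<integral>w. exp (- (s * of_real (B w))) * J w \<partial>M) holomorphic_on {s. Re s > 0}"
proof (rule holomorphic_onI)
  fix s :: complex assume "s \<in> {s. Re s > 0}"
  then have s: "Re s > 0" by simp
  \<comment> \<open>For z within 2 c of \<open>s\<close> the difference quotient costs exp (2 c B)
    B, against exp (- 4 c B) available at \<open>s\<close>; the remaining exp (- 2 c B) B is at most
    1 / c.\<close>
  define c where "c = Re s / 4"
  have c: "c > 0" using s by (simp add: c_def)
  let ?X = "\<lambda>s. \<integral>w. exp (- (s * of_real (B w))) * J w \<partial>M"
  let ?D = "\<integral>w. - of_real (B w) * exp (- (s * of_real (B w))) * J w \<partial>M"
  have "((\<lambda>y. (?X y - ?X s) / (y - s)) \<longlongrightarrow> ?D) (at s)"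
  proof (subst tendsto_at_iff_sequentially, intro allI impI)
    fix z :: "nat \<Rightarrow> complex"
    assume zs: "\<forall>i. z i \<in> UNIV - {s}" and z: "z \<longlonglongrightarrow> s"
    from z have "eventually (\<lambda>n. norm (z n - s) < 2 * c) sequentially"
      using c by (auto simp: tendsto_iff dist_norm)
    then obtain N where N: "\<And>n. n \<ge> N \<Longrightarrow> norm (z n - s) < 2 * c"
      by (auto simp: eventually_sequentially)
    have zpos: "Re (z (n + N)) \<ge> 0" for n
      using N[of "n + N"] abs_Re_le_cmod[of "z (n + N) - s"] c unfolding c_def by auto
    let ?q = "\<lambda>n w. (exp (- (z (n + N) * of_real (B w))) - exp (- (s * of_real (B w)))) / (z (n + N) - s) * J w"
    have "(\<lambda>n. \<integral>w. ?q n w \<partial>M) \<longlonglongrightarrow> ?D"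
    proof (rule integral_dominated_convergence[where w="\<lambda>w. 1 / c"])
      show "AE w in M. (\<lambda>n. ?q n w) \<longlonglongrightarrow> - of_real (B w) * exp (- (s * of_real (B w))) * J w"
      proof (intro AE_I2 tendsto_mult tendsto_const)
        fix w
        have "((\<lambda>y. exp (- (y * of_real (B w)))) has_field_derivative - of_real (B w) * exp (- (s * of_real (B w)))) (at s)"
          by (auto intro!: derivative_eq_intros)
        then have "((\<lambda>y. (exp (- (y * of_real (B w))) - exp (- (s * of_real (B w)))) / (y - s)) \<longlongrightarrow> - of_real (B w) * exp (- (s * of_real (B w)))) (at s)"
          by (simp add: has_field_derivative_iff)
        moreover have "filterlim (\<lambda>n. z (n + N)) (at s) sequentially"
          using LIMSEQ_ignore_initial_segment[OF z, of N] zs by (auto simp: filterlim_at)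
        ultimately show "(\<lambda>n. (exp (- (z (n + N) * of_real (B w))) - exp (- (s * of_real (B w)))) / (z (n + N) - s)) \<longlonglongrightarrow> - of_real (B w) * exp (- (s * of_real (B w)))"
          by (rule filterlim_compose)
      qed
      show "AE w in M. norm (?q n w) \<le> 1 / c" for n
      proof (intro AE_I2)
        fix w assume w: "w \<in> space M"
        let ?b = "B w" and ?h = "- (z (n + N) - s) * of_real (B w)"
        have hb: "norm ?h \<le> 2 * c * ?b"
          unfolding norm_mult using N[of "n + N"] B[OF w] c by (intro mult_mono) (auto simp: norm_minus_commute[of s "z (n + N)"])
        have "norm (exp ?h - (\<Sum>k\<le>0. ?h ^ k / fact k)) \<le> exp \<bar>Re ?h\<bar> * norm ?h ^ Suc 0 / fact 0"
          by (rule Taylor_exp)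
        then have "norm (exp ?h - 1) \<le> exp \<bar>Re ?h\<bar> * norm ?h" by simp
        also have "\<dots> \<le> exp (2 * c * ?b) * norm ?h"
          using hb abs_Re_le_cmod[of ?h] by (intro mult_right_mono) (auto intro: order_trans)
        finally have e1: "norm (exp ?h - 1) \<le> exp (2 * c * ?b) * norm ?h" .
        have "exp (- (z (n + N) * of_real ?b)) - exp (- (s * of_real ?b)) = exp (- (s * of_real ?b)) * (exp ?h - 1)"
          by (simp add: algebra_simps mult_exp_exp)
        then have "norm (exp (- (z (n + N) * of_real ?b)) - exp (- (s * of_real ?b))) \<le> exp (- (4 * c * ?b)) * (exp (2 * c * ?b) * norm ?h)"
          using mult_left_mono[OF e1, of "exp (- (4 * c * ?b))"] by (simp add: norm_mult c_def)
        also have "\<dots> = exp (- (2 * c * ?b)) * ?b * norm (z (n + N) - s)"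
          using B[OF w] by (simp add: norm_mult norm_minus_commute[of s] mult_exp_exp flip: mult.assoc)
        also have "exp (- (2 * c * ?b)) * ?b \<le> 1 / c"
        proof -
          have "c * ?b \<le> exp (2 * c * ?b)"
            using exp_ge_add_one_self[of "2 * c * ?b"] mult_pos_pos[OF c B[OF w]] by linarith
          then show ?thesis using c by (simp add: exp_minus field_simps)
        qed
        finally have e2: "norm (exp (- (z (n + N) * of_real ?b)) - exp (- (s * of_real ?b))) \<le> 1 / c * norm (z (n + N) - s)"
          by (simp add: mult_right_mono)
        have nz: "norm (z (n + N) - s) > 0" using zs by auto
        have "norm ((exp (- (z (n + N) * of_real ?b)) - exp (- (s * of_real ?b))) / (z (n + N) - s)) \<le> 1 / c"
          unfolding norm_divide using e2 nz by (simp add: pos_divide_le_eq)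
        then have "norm (?q n w) \<le> 1 / c * 1"
          unfolding norm_mult using J[of w] c by (intro mult_mono) auto
        then show "norm (?q n w) \<le> 1 / c" by simp
      qed
    qed auto
    moreover have "(\<integral>w. ?q n w \<partial>M) = (?X (z (n + N)) - ?X s) / (z (n + N) - s)" for n
    proof -
      have "?X (z (n + N)) - ?X s
        = (\<integral>w. exp (- (z (n + N) * of_real (B w))) * J w - exp (- (s * of_real (B w))) * J w \<partial>M)"
        using exp_transform_integrable[OF assms zpos[of n]] exp_transform_integrable[OF assms, of s] s
        by (subst Bochner_Integration.integral_diff) auto
      then show ?thesis
        by (simp flip: integral_divide_zero add: diff_divide_distrib left_diff_distrib)
    qed
    ultimately have "(\<lambda>n. (?X (z (n + N)) - ?X s) / (z (n + N) - s)) \<longlonglongrightarrow> ?D"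
      by (simp only:)
    then show "((\<lambda>y. (?X y - ?X s) / (y - s)) \<circ> z) \<longlonglongrightarrow> ?D"
      unfolding comp_def by (rule LIMSEQ_offset[of _ N])
  qed
  then have "((\<lambda>s. \<integral>w. exp (- (s * of_real (B w))) * J w \<partial>M) has_field_derivative ?D) (at s)"
    by (simp add: has_field_derivative_iff)
  then show "(\<lambda>s. \<integral>w. exp (- (s * of_real (B w))) * J w \<partial>M) field_differentiable (at s within {s. Re s > 0})"
    using field_differentiable_at_within field_differentiable_def by blast
qed

section \<open>Bromwich inversion for quadratically decaying transforms\<close>

lemma integrable_inverse_1_plus_square_real:
  "integrable lborel (\<lambda>y::real. 1 / (1 + y\<^sup>2))"
  using integrable_inverse_1_plus_square
  by (simp add: set_integrable_def einterval_iff inverse_eq_divide)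

lemma integrable_norm_le:
  fixes f :: "'a \<Rightarrow> 'b::{banach, second_countable_topology}"
  assumes "integrable M g" "f \<in> borel_measurable M" "\<And>x. x \<in> space M \<Longrightarrow> norm (f x) \<le> g x"
  shows "integrable M f"
  by (rule Bochner_Integration.integrable_bound[OF assms(1,2)])
     (auto intro!: AE_I2 order_trans[OF assms(3) abs_ge_self])

text \<open>Cauchy's formula on a rectangle whose left side lies on the imaginary axis: the other
  three sides have length of order r and an integrand of order r^-3, so only the left side survives.
  The margin \<delta> makes \<open>E\<close> holomorphic across that side.\<close>

lemma cauchy_right_half_plane:
  fixes E :: "complex \<Rightarrow> complex"
  assumes hol: "E holomorphic_on {z. Re z > - \<delta>}" and \<delta>: "\<delta> > 0"
    and bound: "\<And>z. Re z \<ge> 0 \<Longrightarrow> norm (E z) \<le> C / (1 + (norm z)\<^sup>2)" and s: "Re s > 0"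
  shows "(\<integral>y. E (Complex 0 y) / (s - Complex 0 y) \<partial>lborel) = 2 * of_real pi * E s"
proof -
  have C: "C \<ge> 0" using bound[of 0] by simp (metis norm_ge_zero order_trans)
  let ?f = "\<lambda>w. E w / (w - s)"
  let ?g = "\<lambda>y. E (Complex 0 y) / (s - Complex 0 y)"
  have contE: "continuous_on {z. Re z > - \<delta>} E" by (rule holomorphic_on_imp_continuous_on[OF hol])
  have nz: "s - Complex 0 y \<noteq> 0" for y using s by (auto simp: complex_eq_iff)
  have cg: "continuous_on UNIV ?g"
  proof -
    have "continuous_on UNIV (\<lambda>y. E (Complex 0 y))"
      by (rule continuous_on_compose2[OF contE]) (use \<delta> in \<open>auto intro!: continuous_intros simp: Complex_eq\<close>)
    then show ?thesis using nz by (intro continuous_intros) (auto simp: Complex_eq intro!: continuous_intros)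
  qed
  have [measurable]: "?g \<in> borel_measurable borel" by (rule borel_measurable_continuous_onI[OF cg])
  have gb: "norm (?g y) \<le> (C / Re s) * (1 / (1 + y\<^sup>2))" for y
  proof -
    have "norm (E (Complex 0 y)) \<le> C / (1 + y\<^sup>2)" using bound[of "Complex 0 y"] by (simp add: cmod_def)
    moreover have "norm (s - Complex 0 y) \<ge> Re s" using complex_Re_le_cmod[of "s - Complex 0 y"] by simp
    ultimately have "norm (?g y) \<le> (C / (1 + y\<^sup>2)) / Re s"
      unfolding norm_divide using s C by (intro frac_le) auto
    then show ?thesis by (simp add: mult.commute)
  qed
  have ig: "integrable lborel ?g"
    by (rule integrable_norm_le[OF integrable_mult_right[OF integrable_inverse_1_plus_square_real, of "C / Re s"] _ gb]) simp
  \<comment> \<open>The condition \<open>r > 2 * norm s\<close> puts \<open>s\<close> inside the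
    rectangle and keeps the three far sides at distance at least r / 2 from it.\<close>
  have rect: "norm (2 * of_real pi * E s - (\<integral>y. indicator {- r..r} y *\<^sub>R ?g y \<partial>lborel)) \<le> 8 * C / r\<^sup>2"
    if r: "r > 2 * norm s" "r > 0" for r :: real
  proof -
    define a1 where "a1 = Complex 0 (- r)"
    define a2 where "a2 = Complex r (- r)"
    define a3 where "a3 = Complex r r"
    define a4 where "a4 = Complex 0 r"
    note a_defs = a1_def a2_def a3_def a4_def
    let ?I = "\<integral>y. indicator {- r..r} y *\<^sub>R ?g y \<partial>lborel" and ?R = "path_image (rectpath a1 a3)"
    let ?c1 = "contour_integral (linepath a1 a2) ?f" and ?c2 = "contour_integral (linepath a2 a3) ?f"
      and ?c3 = "contour_integral (linepath a3 a4) ?f" and ?c4 = "contour_integral (linepath a4 a1) ?f"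
    have sr: "\<bar>Re s\<bar> < r" "\<bar>Im s\<bar> < r"
      using r abs_Re_le_cmod[of s] abs_Im_le_cmod[of s] norm_ge_zero[of s] by linarith+
    have sbox: "s \<in> box a1 a3"
      using sr s by (auto simp: in_box_complex_iff a_defs)
    have pim: "?R = cbox a1 a3 - box a1 a3"
      using r by (intro path_image_rectpath_cbox_minus_box) (auto simp: a_defs)
    have cb: "Re z \<ge> 0" if "z \<in> cbox a1 a3" for z
      using that by (auto simp: in_cbox_complex_iff a_defs)
    have prange: "?R \<subseteq> {z. Re z > - \<delta>} - {s}"
    proof
      fix z assume "z \<in> ?R"
      then have z: "z \<in> cbox a1 a3" "z \<notin> box a1 a3" using pim by auto
      then show "z \<in> {z. Re z > - \<delta>} - {s}" using cb[OF z(1)] sbox \<delta> by auto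
    qed
    have "(?f has_contour_integral (2 * pi) * \<i> * winding_number (rectpath a1 a3) s * E s) (rectpath a1 a3)"
    proof (rule Cauchy_integral_formula_convex_simple[OF _ hol])
      show "convex {z. Re z > - \<delta>}" by (rule convex_halfspace_Re_gt)
      show "s \<in> interior {z. Re z > - \<delta>}"
        using s \<delta> by (subst interior_open) (auto simp: open_halfspace_Re_gt)
      show "?R \<subseteq> {z. Re z > - \<delta>} - {s}"
        by (rule prange)
    qed auto
    then have tot: "(?f has_contour_integral (2 * pi) * \<i> * E s) (rectpath a1 a3)"
      using winding_number_rectpath[OF sbox] by simp
    have rp: "rectpath a1 a3 = linepath a1 a2 +++ linepath a2 a3 +++ linepath a3 a4 +++ linepath a4 a1"
      by (simp add: rectpath_def a_defs Let_def)
    have seg: "closed_segment a1 a2 \<subseteq> ?R" "closed_segment a2 a3 \<subseteq> ?R"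
       "closed_segment a3 a4 \<subseteq> ?R" "closed_segment a4 a1 \<subseteq> ?R"
      unfolding rp by (auto simp: path_image_join)
    have ci: "?f contour_integrable_on linepath a b" if "closed_segment a b \<subseteq> ?R" for a b
    proof (rule contour_integrable_continuous_linepath)
      have "closed_segment a b \<subseteq> {z. Re z > - \<delta>} - {s}"
        using that prange by (rule order_trans)
      then show "continuous_on (closed_segment a b) ?f"
        by (intro continuous_intros continuous_on_subset[OF contE]) auto
    qed
    note cis = ci[OF seg(1)] ci[OF seg(2)] ci[OF seg(3)] ci[OF seg(4)]
    have "contour_integral (rectpath a1 a3) ?f = ?c1 + (?c2 +
       (?c3 + ?c4))"
      unfolding rp using cis by (simp add: contour_integrable_join)
    then have sum: "(2 * pi) * \<i> * E s = ?c1 + ?c2 +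
       ?c3 + ?c4"
      using contour_integral_unique[OF tot] by simp
    have bd: "norm (contour_integral (linepath a b) ?f) \<le> 2 * C / r ^ 3 * norm (b - a)"
      if sub: "closed_segment a b \<subseteq> ?R" and far: "\<And>z. z \<in> closed_segment a b \<Longrightarrow> norm z \<ge> r" for a b
    proof (rule contour_integral_bound_linepath[OF ci[OF sub]])
      fix z assume z: "z \<in> closed_segment a b"
      then have "Re z \<ge> 0" using sub pim cb by blast
      then have "norm (E z) \<le> C / (1 + (norm z)\<^sup>2)" by (rule bound)
      also have "\<dots> \<le> C / r\<^sup>2"
      proof (rule divide_left_mono)
        show "r\<^sup>2 \<le> 1 + (norm z)\<^sup>2" using power_mono[OF far[OF z], of 2] r by linarith
        show "0 < (1 + (norm z)\<^sup>2) * r\<^sup>2" using r by (intro mult_pos_pos add_pos_nonneg) auto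
      qed (rule C)
      finally have e1: "norm (E z) \<le> C / r\<^sup>2" .
      have e2: "norm (z - s) \<ge> r / 2" using far[OF z] r norm_triangle_ineq2[of z s] by linarith
      have "norm (E z / (z - s)) \<le> (C / r\<^sup>2) / (r / 2)"
        unfolding norm_divide using e1 e2 r C by (intro frac_le) auto
      then show "norm (E z / (z - s)) \<le> 2 * C / r ^ 3" by (simp add: power2_eq_square power3_eq_cube mult_ac)
    qed (use C r in auto)
    have far1: "norm z \<ge> r" if "z \<in> closed_segment a1 a2" for z
    proof -
      have "Im z = - r" using that unfolding closed_segment_def a_defs by clarsimp (simp add: algebra_simps)
      then show ?thesis using abs_Im_le_cmod[of z] r by simp
    qed
    have far2: "norm z \<ge> r" if "z \<in> closed_segment a2 a3" for z
    proof -
      have "Re z = r" using that unfolding closed_segment_def a_defs by clarsimp (simp add: algebra_simps)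
      then show ?thesis using abs_Re_le_cmod[of z] r by simp
    qed
    have far3: "norm z \<ge> r" if "z \<in> closed_segment a3 a4" for z
    proof -
      have "Im z = r" using that unfolding closed_segment_def a_defs by clarsimp (simp add: algebra_simps)
      then show ?thesis using abs_Im_le_cmod[of z] r by simp
    qed
    have len: "norm (a2 - a1) = r" "norm (a3 - a2) = 2 * r" "norm (a4 - a3) = r"
      using r(2) by (auto simp: a_defs cmod_eq_Re cmod_eq_Im)
    have b1: "norm (?c1) \<le> 2 * C / r ^ 3 * r" using bd[OF seg(1) far1] len by simp
    have b2: "norm (?c2) \<le> 2 * C / r ^ 3 * (2 * r)" using bd[OF seg(2) far2] len by simp
    have b3: "norm (?c3) \<le> 2 * C / r ^ 3 * r" using bd[OF seg(3) far3] len by simp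
    \<comment> \<open>The left side is traversed downwards, and \<open>?f\<close> has denominator z
      - s where \<open>?g\<close> has s - z; the two signs cancel.\<close>
    have "?c4 = - contour_integral (linepath a1 a4) ?f"
      using contour_integral_reversepath[of "linepath a1 a4" ?f] by simp
    also have "contour_integral (linepath a1 a4) ?f = \<i> * integral {- r..r} (\<lambda>y. ?f (Complex 0 y))"
      using r by (intro contour_integral_linepath_same_Re) (auto simp: a_defs)
    also have "integral {- r..r} (\<lambda>y. ?f (Complex 0 y)) = - integral {- r..r} ?g"
      by (subst Henstock_Kurzweil_Integration.integral_neg[symmetric]) (metis minus_diff_eq minus_divide_right)
    also have "integral {- r..r} ?g = ?I"
      using set_borel_integral_eq_integral(2)[of "{- r..r}" ?g] integrable_mult_indicator[OF _ ig, of "{- r..r}"]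
      by (simp add: set_integrable_def set_lebesgue_integral_def)
    finally have left: "?c4 = \<i> * ?I"
      by simp
    have e: "\<i> * (2 * of_real pi * E s - ?I)
      = ?c1 + ?c2 + ?c3"
      using sum left by (simp add: algebra_simps)
    have "norm (2 * of_real pi * E s - ?I)
      = norm (\<i> * (2 * of_real pi * E s - ?I))"
      by (simp only: norm_mult norm_ii mult_1)
    also have "\<dots> = norm (?c1 + ?c2 + ?c3)"
      by (simp only: e)
    also have "\<dots> \<le> 2 * C / r ^ 3 * r + 2 * C / r ^ 3 * (2 * r) + 2 * C / r ^ 3 * r"
      by (intro norm_triangle_le add_mono b1 b2 b3)
    also have "\<dots> = 8 * C / r\<^sup>2 " using r by (simp add: field_simps power2_eq_square power3_eq_cube)
    finally show ?thesis .
  qed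
  have "(\<lambda>n. \<integral>y. indicator {- real n..real n} y *\<^sub>R ?g y \<partial>lborel) \<longlonglongrightarrow> (\<integral>y. ?g y \<partial>lborel)"
  proof (rule integral_dominated_convergence[OF _ _ integrable_norm[OF ig]])
    show "AE y in lborel. (\<lambda>n. indicator {- real n..real n} y *\<^sub>R ?g y) \<longlonglongrightarrow> ?g y"
    proof (intro AE_I2 tendsto_eventually)
      fix y :: real
      obtain N where "\<bar>y\<bar> \<le> real N" using real_arch_simple by blast
      then show "\<forall>\<^sub>F n in sequentially. indicator {- real n..real n} y *\<^sub>R ?g y = ?g y"
        by (intro eventually_sequentiallyI[of N]) (auto simp: indicator_def)
    qed
  qed (auto simp: indicator_def)
  then have l1: "(\<lambda>n. norm (2 * of_real pi * E s - (\<integral>y. indicator {- real n..real n} y *\<^sub>R ?g y \<partial>lborel)))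
      \<longlonglongrightarrow> norm (2 * of_real pi * E s - (\<integral>y. ?g y \<partial>lborel))"
    by (intro tendsto_intros)
  obtain N where N: "real N > 2 * norm s" using reals_Archimedean2 by blast
  have "(\<lambda>n. 8 * C / (real n)\<^sup>2) \<longlonglongrightarrow> 0" by real_asymp
  then have "norm (2 * of_real pi * E s - (\<integral>y. ?g y \<partial>lborel)) \<le> 0"
    by (rule LIMSEQ_le[OF l1]) (use N in \<open>auto intro!: exI[of _ N] rect order.strict_trans1[of 0 "2 * norm s"]\<close>)
  then show ?thesis by simp
qed

text \<open>The constant 1 is fixed by \<open>exp_shift\<close>, so \<open>laplace_exp_shift\<close>
  becomes a linear equation for its transform. The rate Re z + 1 differs from z because the real
  parts differ.\<close>

lemma laplace_one:
  assumes z: "Re z > 0"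
  shows "laplace (\<lambda>_. 1) z = 1 / z"
proof -
  define m where "m = Re z + 1"
  have m: "m > 0" "z \<noteq> of_real m" using z by (auto simp: m_def complex_eq_iff)
  have e: "(\<integral>x. indicator {0<..} x *\<^sub>R (complex_of_real (exp (- (m * x)))) \<partial>lborel) = of_real (1 / m)"
    unfolding exp_integral_Ioi(2)[OF m(1), symmetric]
    by (subst integral_complex_of_real[symmetric]) (auto simp: scaleR_conv_of_real indicator_def intro!: Bochner_Integration.integral_cong)
  have "exp_shift m (\<lambda>_. 1) v = of_real m * (\<integral>x. indicator {0<..} x *\<^sub>R (complex_of_real (exp (- (m * x)))) \<partial>lborel)" for v
    unfolding exp_shift_def set_lebesgue_integral_def by (subst integral_mult_right_zero[symmetric]) (simp add: mult_ac)
  then have sh: "exp_shift m (\<lambda>_. 1) = (\<lambda>_. 1)" using m e by auto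
  have lm: "laplace (\<lambda>_. 1) (of_real m) = 1 / of_real m"
    using e unfolding laplace_def set_lebesgue_integral_def by (simp add: exp_of_real flip: of_real_mult of_real_minus)
  have "laplace (\<lambda>_. 1) z = of_real m * (laplace (\<lambda>_. 1) z - 1 / of_real m) / (of_real m - z)"
    using laplace_exp_shift[of "\<lambda>_. 1" 1 m z] m z unfolding sh lm by simp
  then show ?thesis using m z by (auto simp: divide_simps algebra_simps split: if_splits)
qed

text \<open>The witness is the inversion integral along the imaginary axis. Quadratic decay makes it
  converge absolutely, so Fubini applies, and integrating over x first reproduces the Cauchy kernel
  1 / (s - i y).\<close>

lemma bromwich:
  fixes E :: "complex \<Rightarrow> complex"
  assumes hol: "E holomorphic_on {z. Re z > - \<delta>}" and \<delta>: "\<delta> > 0"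
    and bound: "\<And>z. Re z \<ge> 0 \<Longrightarrow> norm (E z) \<le> C / (1 + (norm z)\<^sup>2)"
  shows "\<exists>g C'. g \<in> borel_measurable borel \<and> (\<forall>x. norm (g x) \<le> C') \<and> (\<forall>s. Re s > 0 \<longrightarrow> laplace g s = E s)"
proof -
  have C: "C \<ge> 0" using bound[of 0] by simp (metis norm_ge_zero order_trans)
  have contE: "continuous_on {z. Re z > - \<delta>} E" by (rule holomorphic_on_imp_continuous_on[OF hol])
  have cE: "continuous_on UNIV (\<lambda>y. E (Complex 0 y))"
    by (rule continuous_on_compose2[OF contE]) (use \<delta> in \<open>auto intro!: continuous_intros simp: Complex_eq\<close>)
  have [measurable]: "(\<lambda>y. E (Complex 0 y)) \<in> borel_measurable borel" by (rule borel_measurable_continuous_onI[OF cE])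
  have Eb: "norm (E (Complex 0 y)) \<le> C * (1 / (1 + y\<^sup>2))" for y
    using bound[of "Complex 0 y"] by (simp add: cmod_def)
  define K where "K = (\<integral>y. C * (1 / (1 + (y::real)\<^sup>2)) \<partial>lborel)"
  have iC: "integrable lborel (\<lambda>y::real. C * (1 / (1 + y\<^sup>2)))"
    by (intro integrable_mult_right integrable_inverse_1_plus_square_real)
  define g where "g x = (\<integral>y. E (Complex 0 y) * exp (\<i> * of_real (x * y)) \<partial>lborel) / (2 * of_real pi)" for x :: real
  have g_meas: "g \<in> borel_measurable borel" unfolding g_def[abs_def] by measurable
  have gb: "norm (g x) \<le> K" for x
  proof -
    have b: "norm (E (Complex 0 y) * exp (\<i> * of_real (x * y))) \<le> C * (1 / (1 + y\<^sup>2))" for y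
      using Eb[of y] by (simp add: norm_mult)
    have i: "integrable lborel (\<lambda>y. E (Complex 0 y) * exp (\<i> * of_real (x * y)))"
      by (rule integrable_norm_le[OF iC _ b]) simp
    have "norm (\<integral>y. E (Complex 0 y) * exp (\<i> * of_real (x * y)) \<partial>lborel) \<le> K"
      unfolding K_def by (intro integral_norm_bound[THEN order_trans] integral_mono integrable_norm i iC b)
    moreover have "K \<ge> 0" unfolding K_def using C by (intro integral_nonneg_AE AE_I2) auto
    ultimately have "norm (g x) \<le> K / 1"
      unfolding g_def norm_divide using pi_gt3 by (intro frac_le) (auto simp: norm_mult)
    then show ?thesis by simp
  qed
  have "laplace g s = E s" if s: "Re s > 0" for s
  proof -
    let ?H = "\<lambda>x y. (indicator {0<..} x * exp (- (Re s * x))) * (C * (1 / (1 + y\<^sup>2)))"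
    let ?F = "\<lambda>x y. indicator {0<..} x *\<^sub>R (exp (- (s * of_real x)) * (E (Complex 0 y) * exp (\<i> * of_real (x * y))))"
    have i0: "integrable (lborel \<Otimes>\<^sub>M lborel) (\<lambda>(x, y). ?H x y)"
      proof (rule lborel_pair.Fubini_integrable)
        show "AE x in lborel. integrable lborel (\<lambda>y. case (x, y) of (x, y) \<Rightarrow> ?H x y)"
          unfolding prod.case by (intro AE_I2 integrable_mult_right integrable_inverse_1_plus_square_real)
        have e: "(\<integral>y. norm (case (x, y) of (x, y) \<Rightarrow> ?H x y) \<partial>lborel)
           = K * (indicator {0<..} x * exp (- (Re s * x)))" for x
        proof -
          have "(\<integral>y. norm (case (x, y) of (x, y) \<Rightarrow> ?H x y) \<partial>lborel)
             = (\<integral>y. ?H x y \<partial>lborel)"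
            using C by (intro Bochner_Integration.integral_cong) (auto simp: abs_mult add_nonneg_nonneg)
          also have "\<dots> = (indicator {0<..} x * exp (- (Re s * x))) * K"
            unfolding K_def by (rule integral_mult_right_zero)
          finally show ?thesis by simp
        qed
        show "integrable lborel (\<lambda>x. \<integral>y. norm (case (x, y) of (x, y) \<Rightarrow> ?H x y) \<partial>lborel)"
          unfolding e by (intro integrable_mult_right exp_integral_Ioi(1)[OF s])
      qed measurable
    have "norm (?F x y) \<le> ?H x y" for x y
      using mult_left_mono[OF Eb[of y], of "exp (- (Re s * x))"] by (auto simp: indicator_def norm_mult)
    then have int: "integrable (lborel \<Otimes>\<^sub>M lborel) (\<lambda>(x, y). ?F x y)"
      by (intro integrable_norm_le[OF i0]) auto
    have inner: "(\<integral>x. ?F x y \<partial>lborel) = E (Complex 0 y) / (s - Complex 0 y)" for y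
    proof -
      let ?z = "s - Complex 0 y"
      have "(\<integral>x. ?F x y \<partial>lborel) = (\<integral>x. E (Complex 0 y) * (indicator {0<..} x *\<^sub>R (exp (- (?z * of_real x)) * 1)) \<partial>lborel)"
      proof (intro Bochner_Integration.integral_cong refl)
        fix x :: real
        have "exp (- (s * of_real x)) * exp (\<i> * of_real (x * y)) = exp (- (?z * of_real x))"
          by (simp add: mult_exp_exp Complex_eq algebra_simps)
        then show "?F x y = E (Complex 0 y) * (indicator {0<..} x *\<^sub>R (exp (- (?z * of_real x)) * 1))"
          by (simp add: mult_ac)
      qed
      also have "\<dots> = E (Complex 0 y) * laplace (\<lambda>_. 1) ?z"
        unfolding laplace_def set_lebesgue_integral_def by (rule integral_mult_right_zero)
      also have "laplace (\<lambda>_. 1) ?z = 1 / ?z"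
        using s by (intro laplace_one) auto
      finally show ?thesis by simp
    qed
    have "laplace g s = (\<integral>x. (\<integral>y. ?F x y \<partial>lborel) / (2 * of_real pi) \<partial>lborel)"
      unfolding laplace_def set_lebesgue_integral_def
    proof (rule Bochner_Integration.integral_cong[OF refl])
      fix x :: real
      have "(\<integral>y. ?F x y \<partial>lborel) = (\<integral>y. (indicator {0<..} x *\<^sub>R exp (- (s * of_real x))) * (E (Complex 0 y) * exp (\<i> * of_real (x * y))) \<partial>lborel)"
        by (simp add: mult.assoc)
      also have "\<dots> = (indicator {0<..} x *\<^sub>R exp (- (s * of_real x))) * (\<integral>y. E (Complex 0 y) * exp (\<i> * of_real (x * y)) \<partial>lborel)"
        by (rule integral_mult_right_zero)
      finally show "indicator {0<..} x *\<^sub>R (exp (- (s * of_real x)) * g x) = (\<integral>y. ?F x y \<partial>lborel) / (2 * of_real pi)"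
        by (simp add: g_def scaleR_conv_of_real)
    qed
    also have "\<dots> = (\<integral>x. (\<integral>y. ?F x y \<partial>lborel) \<partial>lborel) / (2 * of_real pi)"
      by (rule integral_divide_zero)
    also have "(\<integral>x. (\<integral>y. ?F x y \<partial>lborel) \<partial>lborel) = (\<integral>y. (\<integral>x. ?F x y \<partial>lborel) \<partial>lborel)"
      by (rule lborel_pair.Fubini_integral[OF int, symmetric])
    also have "\<dots> = 2 * of_real pi * E s"
      unfolding inner by (rule cauchy_right_half_plane[OF hol \<delta> bound s])
    finally show ?thesis by simp
  qed
  then show ?thesis using g_meas gb by blast
qed

section \<open>The hyperexponential gains\<close>

text \<open>The analogue of \<open>exp_shift\<close> for a hyperexponential gain, see
  \<open>expectation_hyperexponential\<close>.\<close>

definition hyper_shift :: "nat \<Rightarrow> (nat \<Rightarrow> real) \<Rightarrow> (nat \<Rightarrow> real) \<Rightarrow> (real \<Rightarrow> complex) \<Rightarrow> real \<Rightarrow> complex" where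
  "hyper_shift n p r k v = (\<Sum>j=1..n. of_real (p j) * exp_shift (r j) k v)"

lemma hyper_shift_measurable [measurable]:
  assumes [measurable]: "k \<in> borel_measurable borel"
  shows "hyper_shift n p r k \<in> borel_measurable borel"
  unfolding hyper_shift_def[abs_def] by measurable

lemma hyper_shift_bounded:
  assumes "k \<in> borel_measurable borel" "\<And>x. norm (k x) \<le> C"
    and "\<And>i. i \<in> {1..n} \<Longrightarrow> p i \<ge> 0" "(\<Sum>i=1..n. p i) = 1" "\<And>i. i \<in> {1..n} \<Longrightarrow> r i > 0"
  shows "norm (hyper_shift n p r k v) \<le> C"
proof -
  have "norm (hyper_shift n p r k v) \<le> (\<Sum>j=1..n. norm (of_real (p j) * exp_shift (r j) k v))"
    unfolding hyper_shift_def by (rule norm_sum)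
  also have "\<dots> \<le> (\<Sum>j=1..n. p j * C)"
    using assms exp_shift_integrable(2)[OF assms(1,2)]
    by (intro sum_mono) (auto simp: norm_mult intro!: mult_left_mono)
  also have "\<dots> = C" using assms(4) by (simp flip: sum_distrib_right)
  finally show ?thesis .
qed

text \<open>A c.d.f. determines the law, so it suffices that the mixture of exponential densities
  has the same c.d.f.; the expectation then becomes an integral against that mixture.\<close>

lemma (in prob_space) expectation_hyperexponential:
  fixes X :: "'a \<Rightarrow> real"
  assumes [measurable]: "random_variable borel X" and cdf: "\<And>x. cdf (distr M borel X) x = hyperexp_cdf n p r x"
    and p: "\<And>i. i \<in> {1..n} \<Longrightarrow> p i \<ge> 0" "(\<Sum>i=1..n. p i) = 1" and r: "\<And>i. i \<in> {1..n} \<Longrightarrow> r i > 0"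
    and k [measurable]: "k \<in> borel_measurable borel" and kb: "\<And>x. norm (k x) \<le> C"
  shows "(\<integral>w. k (v + X w) \<partial>M) = hyper_shift n p r k v"
proof -
  define g where "g c = (\<Sum>j=1..n. p j * exponential_density (r j) c)" for c
  have [measurable]: "g \<in> borel_measurable borel" unfolding g_def[abs_def] by measurable
  have dn: "exponential_density (r j) c \<ge> 0" if "j \<in> {1..n}" for j c
    using r[OF that] by (auto simp: exponential_density_def)
  have g0: "g c \<ge> 0" for c unfolding g_def using p dn by (intro sum_nonneg mult_nonneg_nonneg) auto
  define D where "D = density lborel (\<lambda>c. ennreal (g c))"
  have em: "emeasure D A = (\<Sum>j=1..n. ennreal (p j) * emeasure (density lborel (exponential_density (r j))) A)"
    if [measurable]: "A \<in> sets borel" for A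
  proof -
    have "emeasure D A = (\<integral>\<^sup>+c. ennreal (g c) * indicator A c \<partial>lborel)"
      unfolding D_def by (subst emeasure_density) auto
    also have "\<dots> = (\<integral>\<^sup>+c. (\<Sum>j=1..n. ennreal (p j) * (ennreal (exponential_density (r j) c) * indicator A c)) \<partial>lborel)"
    proof (rule nn_integral_cong)
      fix c :: real
      have "ennreal (g c) = (\<Sum>j=1..n. ennreal (p j) * ennreal (exponential_density (r j) c))"
        unfolding g_def using p dn by (subst sum_ennreal[symmetric]) (auto simp: ennreal_mult intro!: sum.cong mult_nonneg_nonneg)
      then show "ennreal (g c) * indicator A c = (\<Sum>j=1..n. ennreal (p j) * (ennreal (exponential_density (r j) c) * indicator A c))"
        by (simp add: sum_distrib_right mult.assoc)
    qed
    also have "\<dots> = (\<Sum>j=1..n. ennreal (p j) * (\<integral>\<^sup>+c. ennreal (exponential_density (r j) c) * indicator A c \<partial>lborel))"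
      by (subst nn_integral_sum) (auto simp: nn_integral_cmult)
    also have "\<dots> = (\<Sum>j=1..n. ennreal (p j) * emeasure (density lborel (exponential_density (r j))) A)"
      by (intro sum.cong refl) (subst emeasure_density, auto)
    finally show ?thesis .
  qed
  have pn: "(\<Sum>j=1..n. ennreal (p j)) = 1" using p by (subst sum_ennreal) auto
  have D: "prob_space D"
  proof
    have "emeasure D (space D) = emeasure D UNIV" by (simp add: D_def)
    also have "\<dots> = (\<Sum>j=1..n. ennreal (p j) * emeasure (density lborel (exponential_density (r j))) UNIV)"
      by (rule em) simp
    also have "\<dots> = (\<Sum>j=1..n. ennreal (p j) * 1)"
    proof (intro sum.cong refl arg_cong2[of _ _ _ _ "(*)"])
      fix j assume "j \<in> {1..n}"
      then have "prob_space (density lborel (exponential_density (r j)))" by (intro prob_space_exponential_density r)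
      from prob_space.emeasure_space_1[OF this] show "emeasure (density lborel (exponential_density (r j))) UNIV = 1" by simp
    qed
    finally show "emeasure D (space D) = 1" using pn by simp
  qed
  have rD: "real_distribution D"
    using D by (auto simp: real_distribution_def real_distribution_axioms_def D_def)
  have "cdf D = cdf (distr M borel X)"
  proof
    fix x
    have "emeasure D {..x} = (\<Sum>j=1..n. ennreal (p j) * ennreal (erlang_CDF 0 (r j) x))"
      by (subst em) (auto intro!: sum.cong simp: emeasure_erlang_density r)
    also have "\<dots> = ennreal (\<Sum>j=1..n. p j * erlang_CDF 0 (r j) x)"
      using p r by (subst sum_ennreal[symmetric]) (auto simp: ennreal_mult intro!: sum.cong mult_nonneg_nonneg)
    finally have "measure D {..x} = (\<Sum>j=1..n. p j * erlang_CDF 0 (r j) x)"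
      unfolding measure_def using p r by (simp only:) (intro enn2real_ennreal sum_nonneg mult_nonneg_nonneg erlang_CDF_nonneg; simp)
    also have "\<dots> = hyperexp_cdf n p r x"
      by (auto simp: hyperexp_cdf_def erlang_CDF_0 intro!: sum.cong)
    finally show "cdf D x = cdf (distr M borel X) x" using cdf[of x] by (simp add: cdf_def2)
  qed
  then have eq: "distr M borel X = D"
    by (intro cdf_unique) (use rD in auto)
  have "(\<integral>w. k (v + X w) \<partial>M) = (\<integral>c. k (v + c) \<partial>distr M borel X)"
    by (subst integral_distr) auto
  also have "\<dots> = (\<integral>c. g c *\<^sub>R k (v + c) \<partial>lborel)"
    unfolding eq D_def by (subst integral_density) (auto simp: g0)
  also have "\<dots> = (\<integral>c. (\<Sum>j=1..n. of_real (p j) * (indicator {0<..} c *\<^sub>R (of_real (r j * exp (- (r j * c))) * k (v + c)))) \<partial>lborel)"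
  proof (rule integral_cong_AE)
    show "AE c in lborel. g c *\<^sub>R k (v + c) = (\<Sum>j=1..n. of_real (p j) * (indicator {0<..} c *\<^sub>R (of_real (r j * exp (- (r j * c))) * k (v + c))))"
      using AE_lborel_singleton[of 0]
    proof eventually_elim
      case (elim c)
      have "exponential_density (r j) c = indicator {0<..} c * (r j * exp (- (r j * c)))" for j
        using elim by (auto simp: exponential_density_def indicator_def mult.commute)
      then show ?case
        by (simp add: g_def scaleR_sum_left scaleR_conv_of_real sum_distrib_left sum_distrib_right mult_ac)
    qed
  qed auto
  also have "\<dots> = (\<Sum>j=1..n. of_real (p j) * exp_shift (r j) k v)"
    unfolding exp_shift_def set_lebesgue_integral_def
    by (subst Bochner_Integration.integral_sum)
       (auto simp only: integral_mult_right_zero intro!: integrable_mult_right exp_shift_integrable(1)[OF k kb] r)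
  finally show ?thesis by (simp add: hyper_shift_def)
qed

text \<open>Fubini for the product law: \<open>Y\<close> may be averaged over an independent copy
  while \<open>X\<close> is held fixed. Every conditioning on the past of the chain takes this
  form.\<close>

lemma (in prob_space) indep_expectation:
  fixes h :: "'b \<times> 'b \<Rightarrow> complex"
  assumes indep: "indep_var S X T Y" and h [measurable]: "h \<in> borel_measurable (S \<Otimes>\<^sub>M T)"
    and int: "integrable M (\<lambda>w. h (X w, Y w))"
  shows "(\<integral>w. h (X w, Y w) \<partial>M) = (\<integral>w. (\<integral>w'. h (X w, Y w') \<partial>M) \<partial>M)"
proof -
  have X [measurable]: "random_variable S X" and Y [measurable]: "random_variable T Y"
    and eq: "distr M S X \<Otimes>\<^sub>M distr M T Y = distr M (S \<Otimes>\<^sub>M T) (\<lambda>w. (X w, Y w))"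
    using indep unfolding indep_var_distribution_eq by auto
  interpret X: prob_space "distr M S X" by (rule prob_space_distr[OF X])
  interpret Y: prob_space "distr M T Y" by (rule prob_space_distr[OF Y])
  interpret pair_sigma_finite "distr M S X" "distr M T Y" ..
  have int': "integrable (distr M S X \<Otimes>\<^sub>M distr M T Y) h"
    unfolding eq using int by (subst integrable_distr_eq) auto
  have "(\<integral>w. h (X w, Y w) \<partial>M) = integral\<^sup>L (distr M S X \<Otimes>\<^sub>M distr M T Y) h"
    unfolding eq by (subst integral_distr) auto
  also have "\<dots> = (\<integral>x. (\<integral>y. h (x, y) \<partial>distr M T Y) \<partial>distr M S X)"
    by (rule integral_fst'[OF int', symmetric])
  also have "\<dots> = (\<integral>w. (\<integral>y. h (X w, y) \<partial>distr M T Y) \<partial>M)"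
    by (subst integral_distr) auto
  also have "\<dots> = (\<integral>w. (\<integral>w'. h (X w, Y w') \<partial>M) \<partial>M)"
  proof (intro Bochner_Integration.integral_cong refl)
    fix w assume "w \<in> space M"
    then have "X w \<in> space S" using X by (rule measurable_space[rotated])
    then show "(\<integral>y. h (X w, y) \<partial>distr M T Y) = (\<integral>w'. h (X w, Y w') \<partial>M)"
      by (subst integral_distr) auto
  qed
  finally show ?thesis .
qed

lemma norm_mult_le_bound:
  fixes a b :: "'a::real_normed_algebra"
  shows "norm a \<le> 1 \<Longrightarrow> norm b \<le> C \<Longrightarrow> norm (a * b) \<le> C"
  using norm_mult_ineq[of a b] mult_mono[of "norm a" 1 "norm b" C] by simp

section \<open>Laplace inversion of divided differences\<close>

text \<open>The denominator is m - z, hence the minus sign of the derivative at m. The number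
  \<open>c\<close> is kept apart from \<open>h m\<close> because m may lie outside the region in
  which \<open>h\<close> is known.\<close>

definition divided_diff :: "(complex \<Rightarrow> complex) \<Rightarrow> complex \<Rightarrow> complex \<Rightarrow> complex \<Rightarrow> complex" where
  "divided_diff h c m z = (if z = m then - deriv h m else (h z - c) / (m - z))"

text \<open>Matching \<open>c\<close> with \<open>h m\<close> removes the singularity, and is
  demanded only if m lies in \<open>S\<close>: while a continuation has not yet reached a rate,
  nothing has to be matched there.\<close>

lemma divided_diff_holomorphic:
  assumes h: "h holomorphic_on S" "open S" and c: "m \<in> S \<Longrightarrow> h m = c"
  shows "divided_diff h c m holomorphic_on S"
proof (cases "m \<in> S")
  case True
  have "(\<lambda>z. - (if z = m then deriv h m else (h z - h m) / (z - m))) holomorphic_on S"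
    by (intro holomorphic_intros pole_lemma_open h)
  also have "(\<lambda>z. - (if z = m then deriv h m else (h z - h m) / (z - m))) = divided_diff h c m"
    unfolding divided_diff_def[abs_def] using c[OF True] by (auto simp: fun_eq_iff minus_divide_right)
  finally show ?thesis .
next
  case False
  have "(\<lambda>z. (h z - c) / (m - z)) holomorphic_on S"
    using False by (intro holomorphic_intros h) auto
  then show ?thesis
    by (rule holomorphic_transform) (use False in \<open>auto simp: divided_diff_def\<close>)
qed

lemma bounded_by_inverse_power:
  fixes f :: "complex \<Rightarrow> complex"
  assumes f: "continuous_on {z. Re z \<ge> 0} f"
    and far: "\<And>z. Re z \<ge> 0 \<Longrightarrow> norm z \<ge> r \<Longrightarrow> norm (f z) \<le> C / (norm z)\<^sup>2" and r: "r \<ge> 1"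
  shows "\<exists>C'. \<forall>z. Re z \<ge> 0 \<longrightarrow> norm (f z) \<le> C' / (1 + (norm z)\<^sup>2)"
proof -
  have "compact ({z. Re z \<ge> 0} \<inter> cball 0 r)"
    by (intro closed_Int_compact closed_halfspace_Re_ge) auto
  then have "compact (f ` ({z. Re z \<ge> 0} \<inter> cball 0 r))"
    by (intro compact_continuous_image continuous_on_subset[OF f]) auto
  from compact_imp_bounded[OF this] obtain D where D': "\<forall>y\<in>f ` ({z. Re z \<ge> 0} \<inter> cball 0 r). norm y \<le> D"
    unfolding bounded_iff ..
  have D: "norm (f z) \<le> D" if "Re z \<ge> 0" "norm z \<le> r" for z
    using D' that by auto
  have D0: "D \<ge> 0" using order_trans[OF norm_ge_zero D[of 0]] r by simp
  have C0: "C \<ge> 0"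
  proof -
    have "0 \<le> C / (norm (of_real r :: complex))\<^sup>2" using order_trans[OF norm_ge_zero far[of "of_real r"]] r by simp
    then show ?thesis using r by (simp add: zero_le_divide_iff)
  qed
  \<comment> \<open>Inside radius \<open>r\<close> compactness supplies \<open>D\<close>, and 1 +
    (norm z)^2 is at most 1 + r^2; outside, 1 + (norm z)^2 is at most twice (norm z)^2.\<close>
  have "norm (f z) \<le> (D * (1 + r\<^sup>2) + 2 * C) / (1 + (norm z)\<^sup>2)" if z: "Re z \<ge> 0" for z
  proof (cases "norm z \<le> r")
    case True
    have "norm (f z) * (1 + (norm z)\<^sup>2) \<le> D * (1 + r\<^sup>2)"
      using D[OF z True] True D0 by (intro mult_mono add_mono power_mono) auto
    then have "norm (f z) * (1 + (norm z)\<^sup>2) \<le> D * (1 + r\<^sup>2) + 2 * C" using C0 by simp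
    then show ?thesis by (simp add: pos_le_divide_eq add_pos_nonneg)
  next
    case False
    have n1: "(norm z)\<^sup>2 \<ge> 1" using False r power_mono[of 1 "norm z" 2] by simp
    have "norm (f z) \<le> C / (norm z)\<^sup>2" using far[OF z] False by simp
    moreover have "0 < (norm z)\<^sup>2" using n1 by linarith
    ultimately have "norm (f z) * (norm z)\<^sup>2 \<le> C" by (simp only: pos_le_divide_eq)
    moreover have "norm (f z) * (1 + (norm z)\<^sup>2) \<le> norm (f z) * (2 * (norm z)\<^sup>2)"
      using n1 by (intro mult_left_mono) auto
    moreover have "D * (1 + r\<^sup>2) \<ge> 0" using D0 by (intro mult_nonneg_nonneg add_nonneg_nonneg) auto
    ultimately have "norm (f z) * (1 + (norm z)\<^sup>2) \<le> D * (1 + r\<^sup>2) + 2 * C" by linarith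
    then show ?thesis by (simp add: pos_le_divide_eq add_pos_nonneg)
  qed
  then show ?thesis by blast
qed

lemma laplace_cmult: "laplace (\<lambda>x. c * k x) s = c * laplace k s"
proof -
  have "laplace (\<lambda>x. c * k x) s = (\<integral>x. c * (indicator {0<..} x *\<^sub>R (exp (- (s * of_real x)) * k x)) \<partial>lborel)"
    unfolding laplace_def set_lebesgue_integral_def by (intro Bochner_Integration.integral_cong) auto
  also have "\<dots> = c * laplace k s"
    unfolding laplace_def set_lebesgue_integral_def by (rule integral_mult_right_zero)
  finally show ?thesis .
qed

text \<open>The absolute value keeps the function bounded on the whole line, as the bounds on
  transformed functions range over all reals.\<close>

lemma laplace_exp_decay:
  assumes "Re s > 0"
  shows "laplace (\<lambda>x. of_real (exp (- \<bar>x\<bar>))) s = 1 / (s + 1)"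
proof -
  have "laplace (\<lambda>x. of_real (exp (- \<bar>x\<bar>))) s = laplace (\<lambda>_. 1) (s + 1)"
    unfolding laplace_def
    by (rule set_lebesgue_integral_cong) (auto simp: exp_of_real[symmetric] mult_exp_exp algebra_simps)
  then show ?thesis using laplace_one[of "s + 1"] assms by simp
qed

text \<open>If the Laplace transform of \<open>g\<close> decays like \<open>1 / norm z\<close>, then its smoothing by an exponential
  distribution is \<open>m c / (z + 1)\<close> up to an error of order \<open>1 / (norm z)\<^sup>2\<close>, to which Bromwich inversion applies.\<close>

lemma divided_diff_is_laplace:
  fixes m :: real
  assumes h: "h holomorphic_on {z. Re z > - \<delta>}" and \<delta>: "\<delta> > 0" and m: "m > 0" and c: "h (of_real m) = c"
    and far: "\<And>z. Re z \<ge> 0 \<Longrightarrow> norm z \<ge> r \<Longrightarrow> norm (h z) \<le> C / norm z" and r: "r \<ge> 1"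
  shows "\<exists>g D. g \<in> borel_measurable borel \<and> (\<forall>x. norm (g x) \<le> D) \<and>
    (\<forall>z. Re z > 0 \<longrightarrow> laplace g z = of_real m * divided_diff h c (of_real m) z)"
proof -
  \<comment> \<open>The subtracted term 1 / (z + 1) has a pole at -1.\<close>
  let ?\<delta> = "min \<delta> 1"
  define E where "E z = of_real m * divided_diff h c (of_real m) z - of_real m * c * (1 / (z + 1))" for z
  have sub: "{z. Re z > - ?\<delta>} \<subseteq> {z. Re z > - \<delta>}" by auto
  have hol: "E holomorphic_on {z. Re z > - ?\<delta>}"
  proof -
    have "divided_diff h c (of_real m) holomorphic_on {z. Re z > - \<delta>}"
      by (intro divided_diff_holomorphic h open_halfspace_Re_gt c)
    then have "divided_diff h c (of_real m) holomorphic_on {z. Re z > - ?\<delta>}"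
      by (rule holomorphic_on_subset[OF _ sub])
    moreover have "z + 1 \<noteq> 0" if "Re z > - ?\<delta>" for z
    proof
      assume "z + 1 = 0"
      then have "Re (z + 1) = 0" by (simp only: complex.sel zero_complex.sel)
      then show False using that by simp
    qed
    ultimately show ?thesis unfolding E_def[abs_def] by (intro holomorphic_intros) simp_all
  qed
  have C0: "C \<ge> 0"
  proof -
    have "0 \<le> C / norm (of_real r :: complex)" using order_trans[OF norm_ge_zero far[of "of_real r"]] r by simp
    then show ?thesis using r by (simp add: zero_le_divide_iff)
  qed
  have "\<exists>C'. \<forall>z. Re z \<ge> 0 \<longrightarrow> norm (E z) \<le> C' / (1 + (norm z)\<^sup>2)"
  proof (rule bounded_by_inverse_power)
    show "continuous_on {z. 0 \<le> Re z} E"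
      by (rule continuous_on_subset[OF holomorphic_on_imp_continuous_on[OF hol]]) (use \<delta> in auto)
    show "max r (2 * m) \<ge> 1" using r by simp
    fix z assume z: "0 \<le> Re z" "max r (2 * m) \<le> norm z"
    have nz: "norm z > 0" using z r by auto
    have zm: "norm (z - of_real m) \<ge> norm z / 2" using z norm_triangle_ineq2[of z "of_real m"] m by auto
    have z1: "norm (z + 1) \<ge> norm z"
    proof -
      have "(norm z)\<^sup>2 \<le> (norm (z + 1))\<^sup>2" 
        using z unfolding cmod_power2 by (simp add: power2_eq_square algebra_simps)
      then show ?thesis by (rule power2_le_imp_le) simp
    qed
    have ne: "z \<noteq> of_real m" "z + 1 \<noteq> 0" "z - of_real m \<noteq> 0" "of_real m - z \<noteq> 0" using zm z1 nz by auto
    \<comment> \<open>The terms of order 1 / norm z coming from c / (m - z) and c / (z + 1) cancel;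
      what remains has a product of two denominators.\<close>
    have "E z = of_real m * c * (of_real (1 + m) / ((z - of_real m) * (z + 1))) - of_real m * (h z / (z - of_real m))"
      using ne unfolding E_def divided_diff_def by (simp add: divide_simps) (simp add: algebra_simps)
    also have "norm \<dots> \<le> norm (of_real m * c * (of_real (1 + m) / ((z - of_real m) * (z + 1)))) + norm (of_real m * (h z / (z - of_real m)))"
      by (rule norm_triangle_ineq4)
    also have "\<dots> \<le> 2 * m * norm c * (1 + m) / (norm z)\<^sup>2 + 2 * m * C / (norm z)\<^sup>2"
    proof (rule add_mono)
      have "norm ((z - of_real m) * (z + 1)) \<ge> norm z / 2 * norm z"
        unfolding norm_mult using zm z1 by (intro mult_mono) auto
      then have "(m * norm c * (1 + m)) / norm ((z - of_real m) * (z + 1)) \<le> (m * norm c * (1 + m)) / (norm z / 2 * norm z)"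
        using nz m by (intro divide_left_mono mult_pos_pos) (auto simp: ne)
      then show "norm (of_real m * c * (of_real (1 + m) / ((z - of_real m) * (z + 1)))) \<le> 2 * m * norm c * (1 + m) / (norm z)\<^sup>2"
        using m by (simp add: norm_mult norm_divide power2_eq_square mult_ac del: of_real_add)
      have "norm (h z) / norm (z - of_real m) \<le> (C / norm z) / (norm z / 2)"
        using far[OF z(1)] z zm nz C0 by (intro frac_le) auto
      then have "m * (norm (h z) / norm (z - of_real m)) \<le> m * ((C / norm z) / (norm z / 2))"
        using m by (intro mult_left_mono) auto
      then show "norm (of_real m * (h z / (z - of_real m))) \<le> 2 * m * C / (norm z)\<^sup>2"
        using m by (simp add: norm_mult norm_divide power2_eq_square mult_ac)
    qed
    also have "\<dots> = (2 * m * norm c * (1 + m) + 2 * m * C) / (norm z)\<^sup>2" by (rule add_divide_distrib[symmetric])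
    finally show "norm (E z) \<le> (2 * m * norm c * (1 + m) + 2 * m * C) / (norm z)\<^sup>2" .
  qed
  then obtain C' where "\<And>z. Re z \<ge> 0 \<Longrightarrow> norm (E z) \<le> C' / (1 + (norm z)\<^sup>2)" by blast
  from bromwich[OF hol _ this] \<delta> obtain g D where g: "g \<in> borel_measurable borel" "\<And>x. norm (g x) \<le> D" "\<And>s. Re s > 0 \<Longrightarrow> laplace g s = E s"
    by auto
  let ?g = "\<lambda>x. g x + of_real m * c * of_real (exp (- \<bar>x\<bar>))"
  have b: "norm (of_real m * c * of_real (exp (- \<bar>x\<bar>))) \<le> norm (of_real m * c)" for x
    unfolding norm_mult[of "of_real m * c"] by (intro mult_left_le) auto
  have [measurable]: "g \<in> borel_measurable borel" by (rule g)
  have "laplace ?g z = of_real m * divided_diff h c (of_real m) z" if "Re z > 0" for z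
  proof -
    have "laplace ?g z = laplace g z + laplace (\<lambda>x. of_real m * c * of_real (exp (- \<bar>x\<bar>))) z"
      by (rule laplace_add[OF g(1,2) _ b that]) simp
    then show ?thesis
      unfolding laplace_cmult laplace_exp_decay[OF that] g(3)[OF that] E_def by simp
  qed
  moreover have "norm (?g x) \<le> D + norm (of_real m * c)" for x
    by (intro norm_triangle_le add_mono g b)
  moreover have "?g \<in> borel_measurable borel" by simp
  ultimately show ?thesis by blast
qed

text \<open>Beyond twice the largest rate every denominator is at least norm z / 2, and the weights
  sum to 1. Each application of the functional equation thus gains a factor 1 / norm z.\<close>

lemma mixture_divided_diff_bound:
  fixes p r :: "nat \<Rightarrow> real" and c :: "nat \<Rightarrow> complex"
  assumes p: "\<And>j. j \<in> {1..n} \<Longrightarrow> p j \<ge> 0" "(\<Sum>j=1..n. p j) = 1"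
    and r: "\<And>j. j \<in> {1..n} \<Longrightarrow> 0 < r j \<and> r j \<le> W" and c: "\<And>j. j \<in> {1..n} \<Longrightarrow> norm (c j) \<le> D"
    and z: "norm z \<ge> 2 * W" "norm z > 0"
  shows "norm (\<Sum>j=1..n. of_real (p j) * (of_real (r j) * divided_diff h (c j) (of_real (r j)) z)) \<le> 2 * W * (norm (h z) + D) / norm z"
proof -
  let ?C = "2 * W * (norm (h z) + D) / norm z"
  have "norm (\<Sum>j=1..n. of_real (p j) * (of_real (r j) * divided_diff h (c j) (of_real (r j)) z)) \<le> (\<Sum>j=1..n. p j * ?C)"
  proof (rule order_trans[OF norm_sum sum_mono])
    fix j assume j: "j \<in> {1..n}"
    have far: "norm (of_real (r j) - z) \<ge> norm z / 2"
      using norm_triangle_ineq3[of "of_real (r j) :: complex" z] r[OF j] z by simp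
    then have ne: "z \<noteq> of_real (r j)" using z by auto
    have hc: "norm (h z - c j) \<le> norm (h z) + D" using norm_triangle_ineq4[of "h z" "c j"] c[OF j] by linarith
    have "norm (divided_diff h (c j) (of_real (r j)) z) \<le> (norm (h z) + D) / (norm z / 2)"
      using ne hc far z unfolding divided_diff_def by (simp add: norm_divide del: divide_divide_eq_right) (intro frac_le order_trans[OF norm_ge_zero hc]; simp)
    then have "r j * norm (divided_diff h (c j) (of_real (r j)) z) \<le> W * ((norm (h z) + D) / (norm z / 2))"
      using r[OF j] by (intro mult_mono) auto
    then have "p j * (r j * norm (divided_diff h (c j) (of_real (r j)) z)) \<le> p j * ?C"
      using p(1)[OF j] by (intro mult_left_mono) (auto simp: mult_ac)
    then show "norm (of_real (p j) * (of_real (r j) * divided_diff h (c j) (of_real (r j)) z)) \<le> p j * ?C"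
      using p(1)[OF j] r[OF j] by (simp only: norm_mult norm_of_real abs_of_nonneg less_imp_le)
  qed
  also have "\<dots> = ?C" using p(2) by (simp flip: sum_distrib_right sum_divide_distrib)
  finally show ?thesis .
qed

section \<open>The ruin time in terms of the embedded chain\<close>

lemma num_gains_eq:
  assumes pos: "\<And>n. gapB R n w > 0" and t: "gain_time R n w \<le> t" "t < gain_time R (Suc n) w"
  shows "num_gains R t w = n"
proof -
  have mono: "strict_mono (\<lambda>n. gain_time R n w)"
    by (rule strict_monoI_Suc) (simp add: gain_time_def pos)
  have "{m. m > 0 \<and> gain_time R m w \<le> t} = {1..n}"
  proof (intro set_eqI iffI)
    fix m assume "m \<in> {m. m > 0 \<and> gain_time R m w \<le> t}"
    then have "gain_time R m w < gain_time R (Suc n) w" "m > 0" using t by auto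
    then show "m \<in> {1..n}" using strict_mono_less[OF mono] by fastforce
  next
    fix m assume "m \<in> {1..n}"
    then have "gain_time R m w \<le> gain_time R n w" using strict_mono_less_eq[OF mono] by auto
    then show "m \<in> {m. m > 0 \<and> gain_time R m w \<le> t}" using t \<open>m \<in> {1..n}\<close> by auto
  qed
  then show ?thesis by (simp add: num_gains_def)
qed

text \<open>Between gains the surplus falls linearly from \<open>level\<close>, so a zero in gap n
  requires a level below the length of that gap; the inequality is strict because at the next gain
  time the gain is already included.\<close>

lemma surplus_zero_iff:
  assumes pos: "\<And>n. gapB R n w > 0" and t: "t \<ge> 0"
  shows "surplus R x t w = 0 \<longleftrightarrow>
    (\<exists>n. 0 \<le> level R x w n \<and> level R x w n < gapB R n w \<and> t = gain_time R n w + level R x w n)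
    \<or> ((\<forall>n. gain_time R n w \<le> x) \<and> t = x)"
proof (cases "\<forall>n. gain_time R n w \<le> t")
  case True
  have "num_gains R t w = 0"
  proof -
    have "{n. n > 0 \<and> gain_time R n w \<le> t} = {0<..}" using True by auto
    moreover have "infinite {0::nat<..}" by (rule infinite_Ioi)
    ultimately show ?thesis by (simp add: num_gains_def)
  qed
  moreover have "t \<noteq> gain_time R n w + level R x w n" if "level R x w n < gapB R n w" for n
    using True[rule_format, of "Suc n"] that by (simp add: gain_time_def)
  ultimately show ?thesis using True by (auto simp: surplus_def gain_time_def)
next
  case False
  then have ex: "\<exists>n. gain_time R n w > t" by (auto simp: not_le)
  define m where "m = (LEAST n. gain_time R n w > t)"
  have m: "gain_time R m w > t" unfolding m_def by (rule LeastI_ex[OF ex])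
  have "m \<noteq> 0" using m t by (cases m) (auto simp: gain_time_def)
  then obtain n where n: "m = Suc n" by (cases m) auto
  have "\<not> gain_time R n w > t" using not_less_Least[of n "\<lambda>n. gain_time R n w > t"] n unfolding m_def by auto
  then have n1: "gain_time R n w \<le> t" and n2: "t < gain_time R (Suc n) w" using m n by auto
  have "surplus R x t w = level R x w n - (t - gain_time R n w)"
    using num_gains_eq[OF pos n1 n2] by (simp add: surplus_def)
  moreover have "n' = n" if "0 \<le> level R x w n'" "level R x w n' < gapB R n' w" "t = gain_time R n' w + level R x w n'" for n'
    using num_gains_eq[OF pos, of n' t] num_gains_eq[OF pos n1 n2] that by (simp add: gain_time_def)
  moreover have "\<not> ((\<forall>n. gain_time R n w \<le> x) \<and> t = x)" using False by auto
  moreover have "gain_time R (Suc n) w = gain_time R n w + gapB R n w" by (simp add: gain_time_def)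
  ultimately show ?thesis using n1 n2 by (auto intro!: exI[of _ n])
qed

lemma gain_time_nonneg: "(\<And>n. gapB R n w > 0) \<Longrightarrow> gain_time R n w \<ge> 0"
  unfolding gain_time_def by (intro sum_nonneg) (auto intro: less_imp_le)

text \<open>The second argument of \<open>inf\<close> accounts for accumulating gain times: after the accumulation point
  \<open>num_gains\<close> is the cardinality of an infinite set, that is \<open>0\<close>, and the surplus is \<open>x - t\<close>. The formula
  holds on the whole sample space, so it also yields the measurability of the ruin time.\<close>

lemma ruin_time_eq:
  assumes pos: "\<And>n. gapB R n w > 0" and x: "x > 0"
  shows "ruin_time R x w =
    inf (INF n. if 0 \<le> level R x w n \<and> level R x w n < gapB R n w then ereal (gain_time R n w + level R x w n) else \<infinity>)
        (if \<forall>n. gain_time R n w \<le> x then ereal x else \<infinity>)"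
    (is "_ = inf (INF n. ?a n) ?b")
proof (rule antisym)
  let ?Z = "{t. t \<ge> 0 \<and> surplus R x t w = 0}"
  have Z: "t \<in> ?Z \<longleftrightarrow> (\<exists>n. 0 \<le> level R x w n \<and> level R x w n < gapB R n w \<and> t = gain_time R n w + level R x w n)
    \<or> ((\<forall>n. gain_time R n w \<le> x) \<and> t = x)" for t
    using surplus_zero_iff[of R w t x] gain_time_nonneg[of R w] pos x by (auto simp: add_nonneg_nonneg)
  show "ruin_time R x w \<le> inf (INF n. ?a n) ?b"
    unfolding ruin_time_def
  proof (intro inf_greatest INF_greatest)
    fix n
    show "Inf (ereal ` ?Z) \<le> ?a n"
    proof (cases "0 \<le> level R x w n \<and> level R x w n < gapB R n w")
      case True
      then have "gain_time R n w + level R x w n \<in> ?Z" using Z by blast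
      then show ?thesis using True by (auto intro!: Inf_lower)
    qed auto
  next
    show "Inf (ereal ` ?Z) \<le> ?b"
    proof (cases "\<forall>n. gain_time R n w \<le> x")
      case True
      then have "x \<in> ?Z" using Z by blast
      then show ?thesis using True by (auto intro!: Inf_lower)
    qed auto
  qed
  show "inf (INF n. ?a n) ?b \<le> ruin_time R x w"
    unfolding ruin_time_def
  proof (rule Inf_greatest)
    fix y assume "y \<in> ereal ` ?Z"
    then obtain t where t: "t \<in> ?Z" "y = ereal t" by auto
    from t(1)[unfolded Z] show "inf (INF n. ?a n) ?b \<le> y"
    proof (elim disjE exE conjE)
      fix n assume n: "0 \<le> level R x w n" "level R x w n < gapB R n w" "t = gain_time R n w + level R x w n"
      then have "(INF n. ?a n) \<le> y" using t by (intro INF_lower2[of n]) auto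
      then show ?thesis by (rule le_infI1)
    next
      assume "\<forall>n. gain_time R n w \<le> x" "t = x"
      then show ?thesis using t by (intro le_infI2) auto
    qed
  qed
qed

text \<open>Gains only raise the surplus, so ruin cannot occur before time x. This yields the decay
  exp (- \<alpha> x) of the expected discount and thereby the bound on \<open>tau\<close> to the
  left of the imaginary axis.\<close>

lemma gain_time_plus_level_ge:
  assumes pos: "\<And>n. gapB R n w > 0" and a: "a0 R > 0" "a1 R > 0"
    and C: "\<And>n. gainC0 R n w > 0" "\<And>n. gainC1 R n w > 0"
  shows "x \<le> gain_time R n w + level R x w n"
proof (induction n)
  case (Suc n)
  let ?u = "level R x w n - gapB R n w"
  have "?u \<le> (1 + a0 R) * ?u + gainC0 R n w" "?u \<le> (1 + a1 R) * ?u + gainC1 R n w" if "?u > 0"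
  proof -
    have "1 * ?u \<le> (1 + a0 R) * ?u" "1 * ?u \<le> (1 + a1 R) * ?u"
      using a that by (intro mult_right_mono; simp)+
    then show "?u \<le> (1 + a0 R) * ?u + gainC0 R n w" "?u \<le> (1 + a1 R) * ?u + gainC1 R n w"
      using C[of n] unfolding mult_1 by (meson add_increasing2 less_imp_le)+
  qed
  then have "?u \<le> level R x w (Suc n)" by (auto simp: Let_def)
  then show ?case using Suc by (simp add: gain_time_def)
qed (simp add: gain_time_def)

text \<open>At most one summand is nonzero: the one for the gap in which ruin occurs.\<close>

lemma discount_ruin_time_sums:
  assumes pos: "\<And>n. gapB R n w > 0" and a: "a0 R > 0" "a1 R > 0"
    and C: "\<And>n. gainC0 R n w > 0" "\<And>n. gainC1 R n w > 0"
    and unb: "\<exists>n. gain_time R n w > x" and x: "x > 0" and \<alpha>: "\<alpha> > 0"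
  shows "(\<lambda>n. of_bool (0 < level R x w n \<and> level R x w n \<le> gapB R n w) * exp (- (\<alpha> * (gain_time R n w + level R x w n))))
      sums discount \<alpha> (ruin_time R x w)"
    and "discount \<alpha> (ruin_time R x w) \<le> exp (- (\<alpha> * x))"
proof -
  let ?l = "level R x w" and ?S = "\<lambda>n. gain_time R n w" and ?B = "\<lambda>n. gapB R n w"
  let ?t = "\<lambda>n. of_bool (0 < ?l n \<and> ?l n \<le> ?B n) * exp (- (\<alpha> * (?S n + ?l n)))"
  have rt: "ruin_time R x w = (INF n. if 0 \<le> ?l n \<and> ?l n < ?B n then ereal (?S n + ?l n) else \<infinity>)"
  proof -
    have "\<not> (\<forall>n. ?S n \<le> x)" using unb by (auto simp: not_le)
    then show ?thesis by (simp only: ruin_time_eq[OF pos x] if_False) simp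
  qed
  have up: "?l (Suc n) > 0" if "?l n > ?B n" for n
    using that a C[of n] by (auto simp: Let_def intro!: add_pos_pos mult_pos_pos)
  have down: "?l (Suc n) = ?l n - ?B n" if "?l n \<le> ?B n" for n
    using that by (auto simp: Let_def)
  have "?t sums discount \<alpha> (ruin_time R x w) \<and> discount \<alpha> (ruin_time R x w) \<le> exp (- (\<alpha> * x))"
  proof (cases "\<exists>n. ?l n \<le> ?B n")
    case False
    then have gt: "?l n > ?B n" for n by (auto simp: not_le)
    then have e: "(\<lambda>n. if 0 \<le> ?l n \<and> ?l n < ?B n then ereal (?S n + ?l n) else \<infinity>) = (\<lambda>_. \<infinity>)"
      by (intro ext if_not_P) (meson less_asym)
    have "ruin_time R x w = \<infinity>" unfolding rt e by simp
    then have "discount \<alpha> (ruin_time R x w) = 0" by (simp add: discount_def)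
    moreover have "?t = (\<lambda>_. 0)" using gt by (auto simp: fun_eq_iff not_le)
    ultimately show ?thesis by simp
  next
    case True
    define N where "N = (LEAST n. ?l n \<le> ?B n)"
    have N: "?l N \<le> ?B N" unfolding N_def by (rule LeastI_ex[OF True])
    have before: "?l n > ?B n" if "n < N" for n using not_less_Least[of n "\<lambda>n. ?l n \<le> ?B n"] that by (auto simp: N_def not_le)
    have lN: "?l N > 0"
    proof (cases N)
      case (Suc n)
      then show ?thesis using up[of n] before[of n] by simp
    qed (use x in simp)
    \<comment> \<open>Right after gap \<open>N\<close> the level can be exactly 0, namely if the
      surplus vanishes at the gain time; from then on it is strictly negative.\<close>
    have after: "?l (Suc N + k) \<le> 0 \<and> (k > 0 \<longrightarrow> ?l (Suc N + k) < 0)" for k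
    proof (induction k)
      case 0
      then show ?case using down[OF N] N by simp
    next
      case (Suc k)
      have "?l (Suc N + k) \<le> ?B (Suc N + k)" using Suc pos[of "Suc N + k"] by linarith
      from down[OF this] show ?case using Suc pos[of "Suc N + k"] by simp
    qed
    have tN: "?t n = (if n = N then exp (- (\<alpha> * (?S N + ?l N))) else 0)" for n
    proof -
      consider "n < N" | "n = N" | k where "n = Suc N + k" by (metis less_imp_Suc_add linorder_neqE_nat add_Suc)
      then show ?thesis
      proof cases
        case 1 then show ?thesis using before[of n] by auto
      next
        case 2 then show ?thesis using N lN by simp
      next
        case 3 then show ?thesis using after[of k] by auto
      qed
    qed
    \<comment> \<open>A surplus reaching 0 exactly at a gain time is counted by the summand in gap
      \<open>N\<close> (with \<open>\<le>\<close>), but by the formula for the ruin time in gap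
      \<open>Suc N\<close> (with \<open><\<close>); both give the same time.\<close>
    have val: "?S n + ?l n = ?S N + ?l N" if n: "0 \<le> ?l n" "?l n < ?B n" for n
    proof -
      consider "n < N" | "n = N" | "n = Suc N" | k where "n = Suc N + Suc k"
        by (metis less_imp_Suc_add linorder_neqE_nat add_Suc add_Suc_right add_0_right not0_implies_Suc)
      then show ?thesis
      proof cases
        case 1 then show ?thesis using before[of n] n by auto
      next
        case 3
        then show ?thesis using down[OF N] by (simp add: gain_time_def)
      next
        case 4 then show ?thesis using after[of "Suc k"] n by auto
      qed auto
    qed
    have ex: "\<exists>n. 0 \<le> ?l n \<and> ?l n < ?B n"
    proof (cases "?l N = ?B N")
      case True
      then have "?l (Suc N) = 0" using down[OF N] by simp
      then show ?thesis using pos[of "Suc N"] by (intro exI[of _ "Suc N"]) simp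
    next
      case False
      then show ?thesis using N lN by (intro exI[of _ N]) auto
    qed
    have "ruin_time R x w = ereal (?S N + ?l N)"
      unfolding rt
    proof (rule antisym)
      from ex obtain n where n: "0 \<le> ?l n" "?l n < ?B n" by blast
      then show "(INF n. if 0 \<le> ?l n \<and> ?l n < ?B n then ereal (?S n + ?l n) else \<infinity>) \<le> ereal (?S N + ?l N)"
        using val[OF n] by (intro INF_lower2[of n]) auto
      show "ereal (?S N + ?l N) \<le> (INF n. if 0 \<le> ?l n \<and> ?l n < ?B n then ereal (?S n + ?l n) else \<infinity>)"
        using val by (intro INF_greatest) auto
    qed
    then have d: "discount \<alpha> (ruin_time R x w) = exp (- (\<alpha> * (?S N + ?l N)))" by (simp add: discount_def)
    moreover have "?t sums exp (- (\<alpha> * (?S N + ?l N)))"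
      unfolding tN by (rule sums_single)
    moreover have "\<alpha> * x \<le> \<alpha> * (?S N + ?l N)"
      using gain_time_plus_level_ge[OF pos a C] \<alpha> by (intro mult_left_mono) auto
    ultimately show ?thesis by simp
  qed
  then show "?t sums discount \<alpha> (ruin_time R x w)" "discount \<alpha> (ruin_time R x w) \<le> exp (- (\<alpha> * x))" by auto
qed

lemma discount_bounded: "\<alpha> > 0 \<Longrightarrow> t \<ge> 0 \<Longrightarrow> 0 \<le> discount \<alpha> t \<and> discount \<alpha> t \<le> 1"
  by (cases t) (auto simp: discount_def)

lemma ruin_time_nonneg: "ruin_time R x w \<ge> 0"
  unfolding ruin_time_def by (auto intro!: Inf_greatest)

lemma scale_div:
  "scale R l m s / of_real (1 + a0 R) = scale R (Suc l) m s"
  "scale R l m s / of_real (1 + a1 R) = scale R l (Suc m) s"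
  by (simp_all add: scale_def mult_ac)

section \<open>The embedded chain\<close>

definition past :: "nat \<Rightarrow> ((nat + nat) + (nat + nat)) set" where
  "past n = {i. case_sum (case_sum id id) (case_sum id id) i < n}"

lemma past_iff [simp]:
  "Inl (Inl k) \<in> past n \<longleftrightarrow> k < n" "Inl (Inr k) \<in> past n \<longleftrightarrow> k < n"
  "Inr (Inl k) \<in> past n \<longleftrightarrow> k < n" "Inr (Inr k) \<in> past n \<longleftrightarrow> k < n"
  by (simp_all add: past_def)

lemma past_SucD:
  assumes "past (Suc n) \<subseteq> I"
  shows "past n \<subseteq> I" "Inl (Inl n) \<in> I" "Inl (Inr n) \<in> I" "Inr (Inl n) \<in> I" "Inr (Inr n) \<in> I"
proof -
  have "past n \<subseteq> past (Suc n)" unfolding past_def by auto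
  with assms show "past n \<subseteq> I" by (rule order_trans[rotated])
qed (rule subsetD[OF assms]; simp)+

text \<open>The indices \<open>Inl (Inl n)\<close>, \<open>Inl (Inr n)\<close>, \<open>Inr (Inl n)\<close>, \<open>Inr (Inr n)\<close> stand for the inputs
  \<open>B\<^sub>n\<close>, \<open>T\<^sub>n\<close>, \<open>C\<^sub>n\<^sup>0\<close>, \<open>C\<^sub>n\<^sup>1\<close>. Writing the chain as a function of the family of inputs that depends on \<open>past n\<close>
  only makes it independent of the inputs with number \<open>n\<close>.\<close>

primrec path_level :: "'w dual_risk \<Rightarrow> real \<Rightarrow> ((nat + nat) + (nat + nat) \<Rightarrow> real) \<Rightarrow> nat \<Rightarrow> real" where
  "path_level R x p 0 = x"
| "path_level R x p (Suc n) =
     (let u = path_level R x p n - p (Inl (Inl n)) in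
      if u > 0 then
        (if p (Inl (Inr n)) \<ge> p (Inl (Inl n)) then (1 + a0 R) * u + p (Inr (Inl n))
         else (1 + a1 R) * u + p (Inr (Inr n)))
      else u)"

definition path_time :: "nat \<Rightarrow> ((nat + nat) + (nat + nat) \<Rightarrow> real) \<Rightarrow> real" where
  "path_time n p = (\<Sum>k<n. p (Inl (Inl k)))"

lemma path_level_measurable:
  "past n \<subseteq> I \<Longrightarrow> (\<lambda>p. path_level R x p n) \<in> borel_measurable (Pi\<^sub>M I (\<lambda>_. borel))"
proof (induction n)
  case (Suc n)
  note I = past_SucD[OF Suc.prems]
  have [measurable]: "(\<lambda>p. p i) \<in> borel_measurable (Pi\<^sub>M I (\<lambda>_. borel :: real measure))" if "i \<in> I" for i
    using measurable_component_singleton[OF that, of "\<lambda>_. borel"] .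
  note [measurable] = Suc.IH[OF I(1)] I(2-5)
  show ?case unfolding path_level.simps Let_def by measurable
qed simp

lemma path_time_measurable:
  assumes "past n \<subseteq> I"
  shows "path_time n \<in> borel_measurable (Pi\<^sub>M I (\<lambda>_. borel))"
proof -
  have "Inl (Inl k) \<in> I" if "k < n" for k
    using that by (intro subsetD[OF assms]) simp
  then show ?thesis
    unfolding path_time_def[abs_def] by (intro borel_measurable_sum measurable_component_singleton) auto
qed

text \<open>Independence is available for restricted families, whose other coordinates are
  \<open>undefined\<close>; the chain up to n does not see them.\<close>

lemma path_level_restrict: "past n \<subseteq> I \<Longrightarrow> path_level R x (restrict p I) n = path_level R x p n"
proof (induction n)
  case (Suc n)
  note I = past_SucD[OF Suc.prems]
  show ?case using Suc.IH[OF I(1)] I(2-5) by simp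
qed simp

lemma path_time_restrict:
  assumes "past n \<subseteq> I"
  shows "path_time n (restrict p I) = path_time n p"
proof -
  have "Inl (Inl k) \<in> I" if "k < n" for k
    using that by (intro subsetD[OF assms]) simp
  then show ?thesis unfolding path_time_def by (intro sum.cong) auto
qed

section \<open>Laws of the inputs and almost sure properties of the paths\<close>

locale discounted_risk_model = dual_risk_model R for R :: "'w dual_risk" +
  fixes \<alpha> :: real
  assumes discount_rate_pos: "\<alpha> > 0"
begin

abbreviation "down0 s \<equiv> s / complex_of_real (1 + a0 R)"
abbreviation "down1 s \<equiv> s / complex_of_real (1 + a1 R)"
abbreviation "hat0 s \<equiv> chi0_hat R (s + of_real \<alpha>)"
abbreviation "hat1 s \<equiv> chi1_hat R (s + of_real \<alpha>)"

abbreviation input :: "(nat + nat) + (nat + nat) \<Rightarrow> 'w \<Rightarrow> real" where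
  "input \<equiv> case_sum (case_sum (gapB R) (thrT R)) (case_sum (gainC0 R) (gainC1 R))"

lemma level_eq_path: "level R x w n = path_level R x (\<lambda>i. input i w) n"
  by (induction n) (simp_all add: Let_def)

lemma gain_time_eq_path: "gain_time R n w = path_time n (\<lambda>i. input i w)"
  by (simp add: gain_time_def path_time_def)

lemma input_measurable: "random_variable borel (input i)"
  using indep unfolding indep_vars_def by auto

lemma gap_measurable [measurable]: "random_variable borel (gapB R n)"
  and thr_measurable [measurable]: "random_variable borel (thrT R n)"
  and gain0_measurable [measurable]: "random_variable borel (gainC0 R n)"
  and gain1_measurable [measurable]: "random_variable borel (gainC1 R n)"
  using input_measurable[of "Inl (Inl n)"] input_measurable[of "Inl (Inr n)"]
    input_measurable[of "Inr (Inl n)"] input_measurable[of "Inr (Inr n)"] by simp_all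

lemma level_measurable [measurable]: "random_variable borel (\<lambda>w. level R x w n)"
  by (induction n) (simp_all add: Let_def)

lemma gain_time_measurable [measurable]: "random_variable borel (gain_time R n)"
  unfolding gain_time_def[abs_def] by measurable

lemma gain_time_ge_0: "w \<in> space (base R) \<Longrightarrow> gain_time R n w \<ge> 0"
  by (rule gain_time_nonneg) (rule gap_pos)

lemma gap_distr: "distr (base R) borel (gapB R n) = distr (base R) borel (gapB R 0)"
proof -
  obtain b where b: "\<And>n. distributed (base R) lborel (gapB R n) b" using gap_density by blast
  have "distr (base R) borel (gapB R n) = density lborel b" for n
    using distributed_distr_eq_density[OF b, of n] by (simp cong: distr_cong)
  then show ?thesis by simp
qed

text \<open>The branch taken depends on gap and threshold together, so it is their joint law that
  must not depend on n; by independence it is the product of the marginals.\<close>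

lemma gap_thr_distr:
  "distr (base R) (borel \<Otimes>\<^sub>M borel) (\<lambda>w. (gapB R n w, thrT R n w))
    = distr (base R) (borel \<Otimes>\<^sub>M borel) (\<lambda>w. (gapB R 0 w, thrT R 0 w))"
proof -
  have "distr (base R) borel (gapB R n) \<Otimes>\<^sub>M distr (base R) borel (thrT R n)
      = distr (base R) (borel \<Otimes>\<^sub>M borel) (\<lambda>w. (gapB R n w, thrT R n w))" for n
  proof -
    have "indep_var (Pi\<^sub>M {Inl (Inl n)} (\<lambda>_. borel)) (\<lambda>w. restrict (\<lambda>i. input i w) {Inl (Inl n)})
        (Pi\<^sub>M {Inl (Inr n)} (\<lambda>_. borel)) (\<lambda>w. restrict (\<lambda>i. input i w) {Inl (Inr n)})"
      by (rule indep_var_restrict[OF indep]) auto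
    then have "indep_var borel ((\<lambda>p. p (Inl (Inl n))) \<circ> (\<lambda>w. restrict (\<lambda>i. input i w) {Inl (Inl n)}))
        borel ((\<lambda>p. p (Inl (Inr n))) \<circ> (\<lambda>w. restrict (\<lambda>i. input i w) {Inl (Inr n)}))"
      by (rule indep_var_compose) (auto intro!: measurable_component_singleton)
    then show ?thesis by (simp add: comp_def indep_var_distribution_eq)
  qed
  then show ?thesis by (metis gap_distr thr_ident)
qed

lemma gains_pos:
  "AE w in base R. gainC0 R n w > 0" "AE w in base R. gainC1 R n w > 0"
proof -
  have *: "AE w in base R. X w > 0" if [measurable]: "random_variable borel X"
    and c: "cdf (distr (base R) borel X) 0 = hyperexp_cdf k p r 0" for X k p r
  proof -
    have "prob {w \<in> space (base R). X w \<le> 0} = cdf (distr (base R) borel X) 0"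
      by (subst cdf_def2, subst measure_distr) (auto intro!: arg_cong[of _ _ prob])
    also have "\<dots> = 0" using c by (simp add: hyperexp_cdf_def)
    finally have "AE w in base R. w \<notin> {w \<in> space (base R). X w \<le> 0}"
      by (subst (asm) prob_eq_0) auto
    with AE_space show ?thesis by eventually_elim auto
  qed
  show "AE w in base R. gainC0 R n w > 0" "AE w in base R. gainC1 R n w > 0"
    by (rule *[OF _ gain0_cdf], simp) (rule *[OF _ gain1_cdf], simp)
qed

lemma exp_gap_expectation:
  assumes "c > 0"
  shows "integrable (base R) (\<lambda>w. exp (- (c * gapB R n w)))"
    and "(\<integral>w. exp (- (c * gapB R n w)) \<partial>base R) < 1"
proof -
  have b: "exp (- (c * gapB R n w)) < 1" if "w \<in> space (base R)" for w
    using gap_pos[OF that] assms by simp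
  show i: "integrable (base R) (\<lambda>w. exp (- (c * gapB R n w)))"
    by (rule integrable_const_bound[of _ 1]) (use b in \<open>auto intro!: AE_I2 less_imp_le\<close>)
  show "(\<integral>w. exp (- (c * gapB R n w)) \<partial>base R) < 1"
    by (rule expectation_less[OF i]) (use b in auto)
qed

text \<open>Chernoff bound: the probability that the n-th gain time is at most x is bounded by exp x
  times r^n, where r = E exp (- B) < 1. Hence accumulation of gains is a null event.\<close>

lemma gain_times_unbounded: "AE w in base R. \<exists>n. gain_time R n w > x"
proof -
  define r where "r = (\<integral>w. exp (- (1 * gapB R 0 w)) \<partial>base R)"
  have r: "0 \<le> r" "r < 1" unfolding r_def using exp_gap_expectation(2)[of 1 0] by (auto intro!: integral_nonneg_AE)
  have rn: "(\<integral>w. exp (- (1 * gapB R n w)) \<partial>base R) = r" for n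
  proof -
    have "(\<integral>w. exp (- (1 * gapB R n w)) \<partial>base R) = (\<integral>y. exp (- (1 * y)) \<partial>distr (base R) borel (gapB R n))" for n
      by (subst integral_distr) auto
    from this[of n] this[of 0] show ?thesis unfolding r_def by (simp only: gap_distr[of n])
  qed
  define Z where "Z = {w \<in> space (base R). \<forall>n. gain_time R n w \<le> x}"
  have [measurable]: "Z \<in> sets (base R)" unfolding Z_def by measurable
  have "prob Z \<le> exp x * r ^ n" for n
  proof -
    let ?I = "Inl ` Inl ` {..<n} :: ((nat + nat) + (nat + nat)) set"
    have ind: "indep_vars (\<lambda>_. borel) (\<lambda>i w. exp (- (input i w))) ?I"
      by (rule indep_vars_compose2[OF indep_vars_subset[OF indep]]) auto
    have int: "integrable (base R) (\<lambda>w. exp (- (input i w)))" if "i \<in> ?I" for i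
      using that exp_gap_expectation(1)[of 1] by auto
    have pr: "(\<Prod>i\<in>?I. exp (- (input i w))) = exp (- gain_time R n w)" for w
      by (subst prod.reindex; simp add: inj_on_def)+ (simp add: gain_time_def exp_sum sum_negf[symmetric] flip: sum_negf)
    have "(\<integral>w. (\<Prod>i\<in>?I. exp (- (input i w))) \<partial>base R) = (\<Prod>i\<in>?I. \<integral>w. exp (- (input i w)) \<partial>base R)"
      by (rule indep_vars_lebesgue_integral[OF _ ind int]) auto
    also have "\<dots> = (\<Prod>k<n. \<integral>w. exp (- (1 * gapB R k w)) \<partial>base R)"
      by (subst prod.reindex; simp add: inj_on_def)+
    also have "\<dots> = r ^ n" unfolding rn by simp
    finally have e: "(\<integral>w. exp (- gain_time R n w) \<partial>base R) = r ^ n" unfolding pr .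
    have ie: "integrable (base R) (\<lambda>w. exp (- gain_time R n w))"
      using indep_vars_integrable[OF _ ind int] unfolding pr by auto
    have "prob Z = (\<integral>w. indicator Z w \<partial>base R)" by simp
    also have "\<dots> \<le> (\<integral>w. exp x * exp (- gain_time R n w) \<partial>base R)"
    proof (rule integral_mono)
      show "indicator Z w \<le> exp x * exp (- gain_time R n w)" if "w \<in> space (base R)" for w
      proof (cases "w \<in> Z")
        case True
        then have "0 \<le> x - gain_time R n w" by (auto simp: Z_def)
        then have "1 \<le> exp (x - gain_time R n w)" by simp
        then show ?thesis using True by (simp add: exp_diff exp_minus divide_inverse)
      qed simp
      show "integrable (base R) (indicator Z :: _ \<Rightarrow> real)"
        by (rule integrable_const_bound[of _ 1]) (auto simp: indicator_def)
    qed (use ie in auto)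
    also have "\<dots> = exp x * r ^ n" using e by simp
    finally show ?thesis .
  qed
  moreover have "(\<lambda>n. exp x * r ^ n) \<longlonglongrightarrow> exp x * 0"
    using r by (intro tendsto_intros LIMSEQ_power_zero) auto
  ultimately have "prob Z \<le> 0"
    by (intro LIMSEQ_le_const[of "\<lambda>n. exp x * r ^ n"]) auto
  then have "prob Z = 0" using measure_nonneg[of "base R" Z] by linarith
  then have "AE w in base R. w \<notin> Z" by (subst (asm) prob_eq_0) auto
  with AE_space show ?thesis by eventually_elim (auto simp: Z_def not_le)
qed

lemma ruin_time_measurable [measurable]:
  assumes "x > 0"
  shows "(\<lambda>w. ruin_time R x w) \<in> borel_measurable (base R)"
proof (subst measurable_cong)
  show "ruin_time R x w = inf (INF n. if 0 \<le> level R x w n \<and> level R x w n < gapB R n w then ereal (gain_time R n w + level R x w n) else \<infinity>)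
        (if \<forall>n. gain_time R n w \<le> x then ereal x else \<infinity>)" if "w \<in> space (base R)" for w
    by (rule ruin_time_eq) (use gap_pos that assms in auto)
qed measurable

lemma discount_measurable [measurable]: "discount \<alpha> \<in> borel_measurable borel"
  unfolding discount_def[abs_def] by measurable

text \<open>One branch of the first transition, taken on the event \<open>J\<close>:
  \<open>k\<close> is evaluated at the dilated surplus before the random gain, over which
  \<open>hyper_shift\<close> averages separately.\<close>

definition kern :: "('w \<Rightarrow> bool) \<Rightarrow> real \<Rightarrow> (real \<Rightarrow> complex) \<Rightarrow> real \<Rightarrow> complex" where
  "kern J c k y = (\<integral>w. (of_real (exp (- (\<alpha> * gapB R 0 w))) * of_bool (J w)) *
     of_bool (gapB R 0 w < y) * k (c * (y - gapB R 0 w)) \<partial>base R)"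

abbreviation "J0 \<equiv> \<lambda>w. thrT R 0 w \<ge> gapB R 0 w"
abbreviation "J1 \<equiv> \<lambda>w. thrT R 0 w < gapB R 0 w"
abbreviation "shift0 \<equiv> hyper_shift (nK R) (wq R) (mu R)"
abbreviation "shift1 \<equiv> hyper_shift (nL R) (wh R) (nu R)"

text \<open>\<open>trans_op k y\<close> is the discounted expectation of \<open>k\<close> at the level after the first gain,
  starting from level \<open>y\<close>, on the event that this gain occurs before ruin.\<close>

definition trans_op :: "(real \<Rightarrow> complex) \<Rightarrow> real \<Rightarrow> complex" where
  "trans_op k y = kern J0 (1 + a0 R) (shift0 k) y + kern J1 (1 + a1 R) (shift1 k) y"

text \<open>The rate is \<alpha> / 2 rather than \<alpha> so that one constant serves both the
  operator on functions and the coefficients of T on \<open>half\<close>, where the real part of s +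
  \<alpha> exceeds \<alpha> / 2.\<close>

definition rho :: real where
  "rho = (\<integral>w. exp (- ((\<alpha> / 2) * gapB R 0 w)) \<partial>base R)"

lemma rho: "0 \<le> rho" "rho < 1"
  unfolding rho_def using exp_gap_expectation(2)[of "\<alpha> / 2" 0] discount_rate_pos
  by (auto intro!: integral_nonneg_AE)

lemma exp_gap_le_1: "w \<in> space (base R) \<Longrightarrow> norm (of_real (exp (- (\<alpha> * gapB R n w))) :: complex) \<le> 1"
  using gap_pos[of w n] discount_rate_pos by simp

lemma exp_gain_time_le_1: "w \<in> space (base R) \<Longrightarrow> norm (of_real (exp (- (\<alpha> * gain_time R n w))) :: complex) \<le> 1"
  using gain_time_ge_0[of w n] discount_rate_pos by simp

lemma norm_of_bool_le_1: "norm (of_bool b :: complex) \<le> 1"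
  by simp

lemma kern_measurable [measurable]:
  assumes [measurable]: "k \<in> borel_measurable borel" "Measurable.pred (base R) J"
  shows "kern J c k \<in> borel_measurable borel"
  unfolding kern_def[abs_def] by measurable

lemma kern_integrable:
  fixes k :: "real \<Rightarrow> complex"
  assumes [measurable]: "k \<in> borel_measurable borel" "Measurable.pred (base R) J"
    and k: "\<And>x. norm (k x) \<le> C"
  shows "integrable (base R) (\<lambda>w. (of_real (exp (- (\<alpha> * gapB R 0 w))) * of_bool (J w)) *
     of_bool (gapB R 0 w < y) * k (c * (y - gapB R 0 w)))"
proof (rule integrable_const_bound[of _ C], rule AE_I2)
  fix w assume "w \<in> space (base R)"
  then show "norm ((of_real (exp (- (\<alpha> * gapB R 0 w))) * of_bool (J w)) *
     of_bool (gapB R 0 w < y) * k (c * (y - gapB R 0 w))) \<le> C"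
    unfolding mult.assoc by (intro norm_mult_le_bound exp_gap_le_1 norm_of_bool_le_1 k)
qed auto

lemma kern_bounded:
  fixes k :: "real \<Rightarrow> complex"
  assumes "k \<in> borel_measurable borel" "Measurable.pred (base R) J" and k: "\<And>x. norm (k x) \<le> C"
  shows "norm (kern J c k y) \<le> C"
proof -
  have "norm (kern J c k y) \<le> (\<integral>w. C \<partial>base R)"
    unfolding kern_def
  proof (rule order_trans[OF integral_norm_bound], rule integral_mono)
    show "integrable (base R) (\<lambda>w. norm (of_real (exp (- (\<alpha> * gapB R 0 w))) * of_bool (J w) * of_bool (gapB R 0 w < y) * k (c * (y - gapB R 0 w))))"
      by (rule integrable_norm[OF kern_integrable[OF assms]])
    show "norm (of_real (exp (- (\<alpha> * gapB R 0 w))) * of_bool (J w) * of_bool (gapB R 0 w < y) * k (c * (y - gapB R 0 w))) \<le> C"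
      if "w \<in> space (base R)" for w
      unfolding mult.assoc using that by (intro norm_mult_le_bound exp_gap_le_1 norm_of_bool_le_1 k)
  qed auto
  then show ?thesis by (simp add: prob_space)
qed

lemma trans_op_measurable [measurable]:
  assumes [measurable]: "k \<in> borel_measurable borel"
  shows "trans_op k \<in> borel_measurable borel"
  unfolding trans_op_def[abs_def] by measurable

lemma shift0_bounded:
  assumes "k \<in> borel_measurable borel" "\<And>x. norm (k x) \<le> C"
  shows "norm (shift0 k v) \<le> C"
  by (rule hyper_shift_bounded[OF assms wq_nonneg wq_sum mu_pos])

lemma shift1_bounded:
  assumes "k \<in> borel_measurable borel" "\<And>x. norm (k x) \<le> C"
  shows "norm (shift1 k v) \<le> C"
  by (rule hyper_shift_bounded[OF assms wh_nonneg wh_sum nu_pos])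

text \<open>The two branches are disjoint events, so the integrands are added before norms are
  taken; bounding the two kernels separately would lose a factor 2 and with it the
  contraction.\<close>

lemma trans_op_bounded:
  assumes [measurable]: "k \<in> borel_measurable borel" and k: "\<And>x. norm (k x) \<le> C"
  shows "norm (trans_op k y) \<le> rho * C"
proof -
  have C: "C \<ge> 0" using k[of 0] norm_ge_zero order_trans by blast
  let ?i0 = "\<lambda>w. (of_real (exp (- (\<alpha> * gapB R 0 w))) * of_bool (J0 w)) *
     of_bool (gapB R 0 w < y) * shift0 k ((1 + a0 R) * (y - gapB R 0 w))"
  let ?i1 = "\<lambda>w. (of_real (exp (- (\<alpha> * gapB R 0 w))) * of_bool (J1 w)) *
     of_bool (gapB R 0 w < y) * shift1 k ((1 + a1 R) * (y - gapB R 0 w))"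
  have i0: "integrable (base R) ?i0"
    by (rule kern_integrable[OF _ _ shift0_bounded[OF assms(1) k]]) auto
  have i1: "integrable (base R) ?i1"
    by (rule kern_integrable[OF _ _ shift1_bounded[OF assms(1) k]]) auto
  have "trans_op k y = (\<integral>w. ?i0 w + ?i1 w \<partial>base R)"
    unfolding trans_op_def kern_def by (rule Bochner_Integration.integral_add[OF i0 i1, symmetric])
  moreover have "norm (\<integral>w. ?i0 w + ?i1 w \<partial>base R) \<le> (\<integral>w. exp (- ((\<alpha> / 2) * gapB R 0 w)) * C \<partial>base R)"
  proof (rule order_trans[OF integral_norm_bound], rule integral_mono)
    fix w assume w: "w \<in> space (base R)"
    have e: "exp (- (\<alpha> * gapB R 0 w)) \<le> exp (- ((\<alpha> / 2) * gapB R 0 w))"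
      using mult_right_mono[of "\<alpha> / 2" \<alpha> "gapB R 0 w"] gap_pos[OF w, of 0] discount_rate_pos by simp
    have "norm (?i0 w + ?i1 w) \<le> exp (- (\<alpha> * gapB R 0 w)) * C"
      using shift0_bounded[OF assms(1) k] shift1_bounded[OF assms(1) k] C
      by (auto simp: norm_mult intro!: mult_left_mono)
    also have "\<dots> \<le> exp (- ((\<alpha> / 2) * gapB R 0 w)) * C" using e C by (rule mult_right_mono)
    finally show "norm (?i0 w + ?i1 w) \<le> exp (- ((\<alpha> / 2) * gapB R 0 w)) * C" .
  next
    show "integrable (base R) (\<lambda>w. norm (?i0 w + ?i1 w))" using i0 i1 by auto
    show "integrable (base R) (\<lambda>w. exp (- ((\<alpha> / 2) * gapB R 0 w)) * C)"
      using exp_gap_expectation(1)[of "\<alpha> / 2" 0] discount_rate_pos by auto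
  qed
  moreover have "(\<integral>w. exp (- ((\<alpha> / 2) * gapB R 0 w)) * C \<partial>base R) = rho * C"
    unfolding rho_def by (rule integral_mult_left_zero)
  ultimately show ?thesis by (simp only:)
qed

text \<open>The condition \<open>0 < level\<close> encodes survival up to the n-th gain: a level
  that is not positive never becomes positive again.\<close>

definition chain_int :: "(real \<Rightarrow> complex) \<Rightarrow> nat \<Rightarrow> real \<Rightarrow> complex" where
  "chain_int k n x = (\<integral>w. of_real (exp (- (\<alpha> * gain_time R n w))) *
     (of_bool (0 < level R x w n) * k (level R x w n)) \<partial>base R)"

text \<open>Two averages in succession: over the gain, given the past and the pair (B_n, T_n), and
  then over that pair, given the past alone. \<open>rel\<close> and \<open>ic\<close> select one of
  the two branches and its gain.\<close>

lemma branch_step: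
  assumes rel: "Measurable.pred (borel \<Otimes>\<^sub>M borel) (\<lambda>(b, t). rel b t)"
    and ic: "ic = Inr (Inl n) \<or> ic = Inr (Inr n)"
    and sh: "\<And>v. (\<integral>w. k (v + input ic w) \<partial>base R) = k0 v"
    and k [measurable]: "k \<in> borel_measurable borel" and kb: "\<And>x. norm (k x) \<le> C"
    and k0 [measurable]: "k0 \<in> borel_measurable borel" and k0b: "\<And>x. norm (k0 x) \<le> C"
  shows "(\<integral>w. of_real (exp (- (\<alpha> * gain_time R n w))) *
     ((of_real (exp (- (\<alpha> * gapB R n w))) * of_bool (rel (gapB R n w) (thrT R n w))) *
      of_bool (gapB R n w < level R x w n) * k (c * (level R x w n - gapB R n w) + input ic w)) \<partial>base R)
    = (\<integral>w. of_real (exp (- (\<alpha> * gain_time R n w))) *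
     (of_bool (0 < level R x w n) * kern (\<lambda>w. rel (gapB R 0 w) (thrT R 0 w)) c k0 (level R x w n)) \<partial>base R)"
proof -
  let ?b = "Inl (Inl n) :: (nat + nat) + (nat + nat)" and ?t = "Inl (Inr n) :: (nat + nat) + (nat + nat)"
  let ?Q = "insert ?t (insert ?b (past n))"
  have comp: "(\<lambda>p. p i) \<in> borel_measurable (Pi\<^sub>M I (\<lambda>_. borel :: real measure))"
    if "i \<in> I" for i :: "(nat + nat) + (nat + nat)" and I
    using measurable_component_singleton[OF that, of "\<lambda>_. borel"] .
  have relm: "(\<lambda>z. rel (f z) (g z)) \<in> measurable N (count_space UNIV)"
    if [measurable]: "f \<in> borel_measurable N" "g \<in> borel_measurable N" for f g and N :: "'z measure"
    using measurable_compose[OF _ rel, of "\<lambda>z. (f z, g z)" N] by simp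
  have relm': "Measurable.pred (base R) (\<lambda>w. rel (gapB R m w) (thrT R m w))" for m
    by (rule relm) auto
  note [measurable] = relm'

  let ?X = "\<lambda>w. restrict (\<lambda>i. input i w) ?Q" and ?Y = "\<lambda>w. restrict (\<lambda>i. input i w) {ic}"
  define h1 where "h1 = (\<lambda>(p, q). complex_of_real (exp (- (\<alpha> * path_time n p))) *
     ((of_real (exp (- (\<alpha> * p ?b))) * of_bool (rel (p ?b) (p ?t))) *
      of_bool (p ?b < path_level R x p n) * k (c * (path_level R x p n - p ?b) + q ic)))"
  have ind1: "indep_var (Pi\<^sub>M ?Q (\<lambda>_. borel)) ?X (Pi\<^sub>M {ic} (\<lambda>_. borel)) ?Y"
    by (rule indep_var_restrict[OF indep]) (use ic in auto)
  have m1: "h1 \<in> borel_measurable (Pi\<^sub>M ?Q (\<lambda>_. borel) \<Otimes>\<^sub>M Pi\<^sub>M {ic} (\<lambda>_. borel))"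
  proof -
    have [measurable]: "path_time n \<in> borel_measurable (Pi\<^sub>M ?Q (\<lambda>_. borel))"
      "(\<lambda>p. path_level R x p n) \<in> borel_measurable (Pi\<^sub>M ?Q (\<lambda>_. borel))"
      "(\<lambda>p. p ?b) \<in> borel_measurable (Pi\<^sub>M ?Q (\<lambda>_. borel))"
      "(\<lambda>p. p ?t) \<in> borel_measurable (Pi\<^sub>M ?Q (\<lambda>_. borel))"
      "(\<lambda>p. p ic) \<in> borel_measurable (Pi\<^sub>M {ic} (\<lambda>_. borel))"
      by (auto intro!: path_time_measurable path_level_measurable comp)
    have [measurable]: "(\<lambda>p. rel (p ?b) (p ?t)) \<in> measurable (Pi\<^sub>M ?Q (\<lambda>_. borel)) (count_space UNIV)"
      by (rule relm) auto
    show ?thesis unfolding h1_def by measurable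
  qed
  have h1: "h1 (?X w, ?Y w') = of_real (exp (- (\<alpha> * gain_time R n w))) *
     ((of_real (exp (- (\<alpha> * gapB R n w))) * of_bool (rel (gapB R n w) (thrT R n w))) *
      of_bool (gapB R n w < level R x w n) * k (c * (level R x w n - gapB R n w) + input ic w'))" for w w'
  proof -
    have "past n \<subseteq> ?Q" by auto
    note r = path_level_restrict[OF this] path_time_restrict[OF this]
    show ?thesis by (simp add: h1_def level_eq_path gain_time_eq_path r)
  qed
  have "(\<integral>w. h1 (?X w, ?Y w) \<partial>base R) = (\<integral>w. (\<integral>w'. h1 (?X w, ?Y w') \<partial>base R) \<partial>base R)"
  proof (rule indep_expectation[OF ind1 m1])
    show "integrable (base R) (\<lambda>w. h1 (?X w, ?Y w))"
      unfolding h1 using input_measurable[of ic]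
      by (intro integrable_const_bound[of _ C] AE_I2, unfold mult.assoc)
         (intro norm_mult_le_bound exp_gap_le_1 exp_gain_time_le_1 norm_of_bool_le_1 kb, auto)
  qed
  also have "\<dots> = (\<integral>w. of_real (exp (- (\<alpha> * gain_time R n w))) *
     ((of_real (exp (- (\<alpha> * gapB R n w))) * of_bool (rel (gapB R n w) (thrT R n w))) *
      of_bool (gapB R n w < level R x w n) * k0 (c * (level R x w n - gapB R n w))) \<partial>base R)"
    unfolding h1 by (simp only: integral_mult_right_zero sh)
  also have "\<dots> = (\<integral>w. of_real (exp (- (\<alpha> * gain_time R n w))) *
     (of_bool (0 < level R x w n) * kern (\<lambda>w. rel (gapB R 0 w) (thrT R 0 w)) c k0 (level R x w n)) \<partial>base R)"
  proof -
    let ?D = "{?b, ?t}"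
    let ?X = "\<lambda>w. restrict (\<lambda>i. input i w) (past n)" and ?Y = "\<lambda>w. restrict (\<lambda>i. input i w) ?D"
    define F where "F = (\<lambda>y (b, t). (complex_of_real (exp (- (\<alpha> * b))) * of_bool (rel b t)) * of_bool (b < y) * k0 (c * (y - b)))"
    define h2 where "h2 = (\<lambda>(p, q). complex_of_real (exp (- (\<alpha> * path_time n p))) * F (path_level R x p n) (q ?b, q ?t))"
    have ind2: "indep_var (Pi\<^sub>M (past n) (\<lambda>_. borel)) ?X (Pi\<^sub>M ?D (\<lambda>_. borel)) ?Y"
      by (rule indep_var_restrict[OF indep]) auto
    have m2: "h2 \<in> borel_measurable (Pi\<^sub>M (past n) (\<lambda>_. borel) \<Otimes>\<^sub>M Pi\<^sub>M ?D (\<lambda>_. borel))"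
    proof -
      have [measurable]: "path_time n \<in> borel_measurable (Pi\<^sub>M (past n) (\<lambda>_. borel))"
        "(\<lambda>p. path_level R x p n) \<in> borel_measurable (Pi\<^sub>M (past n) (\<lambda>_. borel))"
        "(\<lambda>p. p ?b) \<in> borel_measurable (Pi\<^sub>M ?D (\<lambda>_. borel))"
        "(\<lambda>p. p ?t) \<in> borel_measurable (Pi\<^sub>M ?D (\<lambda>_. borel))"
        by (auto intro!: path_time_measurable path_level_measurable comp)
      have [measurable]: "(\<lambda>p. rel (p ?b) (p ?t)) \<in> measurable (Pi\<^sub>M ?D (\<lambda>_. borel)) (count_space UNIV)"
        by (rule relm) auto
      show ?thesis unfolding h2_def F_def prod.case by measurable
    qed
    have h2: "h2 (?X w, ?Y w') = of_real (exp (- (\<alpha> * gain_time R n w))) * F (level R x w n) (gapB R n w', thrT R n w')" for w w'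
      by (simp add: h2_def level_eq_path gain_time_eq_path path_level_restrict path_time_restrict)
    have Fm: "F y \<in> borel_measurable (borel \<Otimes>\<^sub>M borel)" for y
    proof -
      have [measurable]: "(\<lambda>z. rel (fst z) (snd z)) \<in> measurable (borel \<Otimes>\<^sub>M borel) (count_space UNIV)"
        by (rule relm) auto
      show ?thesis unfolding F_def split_beta' by measurable
    qed
    \<comment> \<open>Equality of the joint laws replaces number \<open>n\<close> by 0. For y \<le>
      0 both sides vanish because gaps are positive.\<close>
    have Fk: "(\<integral>w'. F y (gapB R n w', thrT R n w') \<partial>base R) = of_bool (0 < y) * kern (\<lambda>w. rel (gapB R 0 w) (thrT R 0 w)) c k0 y" for y
    proof -
      have "(\<integral>w'. F y (gapB R m w', thrT R m w') \<partial>base R) = (\<integral>z. F y z \<partial>distr (base R) (borel \<Otimes>\<^sub>M borel) (\<lambda>w. (gapB R m w, thrT R m w)))" for m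
        using Fm by (subst integral_distr) auto
      from this[of n] this[of 0]
      have "(\<integral>w'. F y (gapB R n w', thrT R n w') \<partial>base R) = (\<integral>w'. F y (gapB R 0 w', thrT R 0 w') \<partial>base R)"
        by (simp only: gap_thr_distr[of n])
      also have "\<dots> = of_bool (0 < y) * kern (\<lambda>w. rel (gapB R 0 w) (thrT R 0 w)) c k0 y"
      proof (cases "0 < y")
        case False
        have "F y (gapB R 0 w', thrT R 0 w') = 0" if "w' \<in> space (base R)" for w'
          using gap_pos[OF that, of 0] False by (auto simp: F_def)
        then have "(\<integral>w'. F y (gapB R 0 w', thrT R 0 w') \<partial>base R) = (\<integral>w'. 0 \<partial>base R)"
          by (intro Bochner_Integration.integral_cong) auto
        then show ?thesis using False by simp
      qed (simp add: kern_def F_def)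
      finally show ?thesis .
    qed
    have "(\<integral>w. h2 (?X w, ?Y w) \<partial>base R) = (\<integral>w. (\<integral>w'. h2 (?X w, ?Y w') \<partial>base R) \<partial>base R)"
    proof (rule indep_expectation[OF ind2 m2])
      show "integrable (base R) (\<lambda>w. h2 (?X w, ?Y w))"
        unfolding h2 F_def prod.case
        by (intro integrable_const_bound[of _ C] AE_I2, unfold mult.assoc)
           (intro norm_mult_le_bound exp_gap_le_1 exp_gain_time_le_1 norm_of_bool_le_1 k0b, auto)
    qed
    then show ?thesis
      unfolding h2 by (simp only: integral_mult_right_zero Fk) (simp add: F_def)
  qed
  finally show ?thesis unfolding h1 .
qed

text \<open>The Markov property in backward form: given the first n steps, the next level arises
  from a fresh gap, threshold and gain, so the average over the last step is an application of
  \<open>trans_op\<close> to the test function.\<close>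

lemma chain_step:
  assumes k [measurable]: "k \<in> borel_measurable borel" and kb: "\<And>x. norm (k x) \<le> C"
  shows "chain_int k (Suc n) x = chain_int (trans_op k) n x"
proof -
  let ?e = "\<lambda>w. complex_of_real (exp (- (\<alpha> * gain_time R n w)))"
  let ?b = "\<lambda>w. complex_of_real (exp (- (\<alpha> * gapB R n w)))"
  let ?B = "gapB R n" and ?T = "thrT R n" and ?l = "\<lambda>w. level R x w n"
  let ?i0 = "\<lambda>w. ?e w * ((?b w * of_bool (?T w \<ge> ?B w)) * of_bool (?B w < ?l w) * k ((1 + a0 R) * (?l w - ?B w) + gainC0 R n w))"
  let ?i1 = "\<lambda>w. ?e w * ((?b w * of_bool (?T w < ?B w)) * of_bool (?B w < ?l w) * k ((1 + a1 R) * (?l w - ?B w) + gainC1 R n w))"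
  have bound: "norm (?e w * ((?b w * of_bool p) * of_bool q * k z)) \<le> C" if "w \<in> space (base R)" for w p q z
    unfolding mult.assoc using that
    by (intro norm_mult_le_bound exp_gap_le_1 exp_gain_time_le_1 norm_of_bool_le_1 kb)
  have int0: "integrable (base R) ?i0"
    by (intro integrable_const_bound[of _ C] AE_I2 bound) auto
  have int1: "integrable (base R) ?i1"
    by (intro integrable_const_bound[of _ C] AE_I2 bound) auto
  have sh0: "(\<integral>w. k (v + input (Inr (Inl n)) w) \<partial>base R) = shift0 k v" for v
    using expectation_hyperexponential[OF _ gain0_cdf wq_nonneg wq_sum mu_pos k kb, of n v] by simp
  have sh1: "(\<integral>w. k (v + input (Inr (Inr n)) w) \<partial>base R) = shift1 k v" for v
    using expectation_hyperexponential[OF _ gain1_cdf wh_nonneg wh_sum nu_pos k kb, of n v] by simp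
  have "chain_int k (Suc n) x = (\<integral>w. ?i0 w + ?i1 w \<partial>base R)"
    unfolding chain_int_def
  proof (rule integral_cong_AE)
    show "AE w in base R. of_real (exp (- (\<alpha> * gain_time R (Suc n) w))) *
        (of_bool (0 < level R x w (Suc n)) * k (level R x w (Suc n))) = ?i0 w + ?i1 w"
      using gains_pos(1)[of n] gains_pos(2)[of n]
    proof eventually_elim
      case (elim w)
      have e: "complex_of_real (exp (- (\<alpha> * gain_time R (Suc n) w))) = ?e w * ?b w"
        by (simp add: gain_time_def distrib_left exp_add[symmetric] flip: of_real_mult)
      show ?case
      proof (cases "?B w < ?l w")
        case True
        \<comment> \<open>With positive gains, being positive after the gain is the same as being
          positive before it, so survival at the next gain is the event
          \<open>?B w < ?l w\<close>.\<close>
        have "0 < (1 + a0 R) * (?l w - ?B w) + gainC0 R n w" "0 < (1 + a1 R) * (?l w - ?B w) + gainC1 R n w"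
          using elim a_pos True by (auto intro!: add_pos_pos mult_pos_pos)
        then show ?thesis unfolding e using True by (auto simp: Let_def)
      next
        case False
        then show ?thesis unfolding e by (auto simp: Let_def)
      qed
    qed
  qed (simp_all del: level.simps)
  also have "\<dots> = (\<integral>w. ?i0 w \<partial>base R) + (\<integral>w. ?i1 w \<partial>base R)"
    by (rule Bochner_Integration.integral_add[OF int0 int1])
  also have "(\<integral>w. ?i0 w \<partial>base R) = (\<integral>w. ?e w * (of_bool (0 < ?l w) * kern J0 (1 + a0 R) (shift0 k) (?l w)) \<partial>base R)"
    using branch_step[of "\<lambda>b t. b \<le> t" "Inr (Inl n)" n k "shift0 k" C x "1 + a0 R", OF _ _ sh0 k kb _ shift0_bounded[OF k kb]]
    by simp
  also have "(\<integral>w. ?i1 w \<partial>base R) = (\<integral>w. ?e w * (of_bool (0 < ?l w) * kern J1 (1 + a1 R) (shift1 k) (?l w)) \<partial>base R)"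
    using branch_step[of "\<lambda>b t. t < b" "Inr (Inr n)" n k "shift1 k" C x "1 + a1 R", OF _ _ sh1 k kb _ shift1_bounded[OF k kb]]
    by simp
  also have "(\<integral>w. ?e w * (of_bool (0 < ?l w) * kern J0 (1 + a0 R) (shift0 k) (?l w)) \<partial>base R)
     + (\<integral>w. ?e w * (of_bool (0 < ?l w) * kern J1 (1 + a1 R) (shift1 k) (?l w)) \<partial>base R) = chain_int (trans_op k) n x"
  proof -
    have ik: "integrable (base R) (\<lambda>w. ?e w * (of_bool (0 < ?l w) * kern J c g (?l w)))"
      if [measurable]: "g \<in> borel_measurable borel" "Measurable.pred (base R) J"
      and g: "\<And>v. norm (g v) \<le> C" for J c g
      by (intro integrable_const_bound[of _ C] AE_I2 norm_mult_le_bound exp_gain_time_le_1 norm_of_bool_le_1 kern_bounded[OF that]) auto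
    have "integrable (base R) (\<lambda>w. ?e w * (of_bool (0 < ?l w) * kern J0 (1 + a0 R) (shift0 k) (?l w)))"
      by (rule ik[OF _ _ shift0_bounded[OF k kb]]) auto
    moreover have "integrable (base R) (\<lambda>w. ?e w * (of_bool (0 < ?l w) * kern J1 (1 + a1 R) (shift1 k) (?l w)))"
      by (rule ik[OF _ _ shift1_bounded[OF k kb]]) auto
    ultimately show ?thesis
      unfolding chain_int_def trans_op_def
      by (subst Bochner_Integration.integral_add[symmetric]) (auto simp: algebra_simps)
  qed
  finally show ?thesis .
qed

lemma trans_op_iterate:
  assumes "k \<in> borel_measurable borel" and "\<And>x. norm (k x) \<le> C"
  shows "(trans_op ^^ n) k \<in> borel_measurable borel" "norm ((trans_op ^^ n) k x) \<le> rho ^ n * C"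
proof -
  have "(trans_op ^^ n) k \<in> borel_measurable borel \<and> (\<forall>x. norm ((trans_op ^^ n) k x) \<le> rho ^ n * C)"
  proof (induction n)
    case (Suc n)
    then show ?case using trans_op_bounded[of "(trans_op ^^ n) k" "rho ^ n * C"] by (auto simp: mult.assoc)
  qed (use assms in auto)
  then show "(trans_op ^^ n) k \<in> borel_measurable borel" "norm ((trans_op ^^ n) k x) \<le> rho ^ n * C" by auto
qed

lemma chain_int_eq_iterate:
  assumes "k \<in> borel_measurable borel" "\<And>x. norm (k x) \<le> C" and x: "x > 0"
  shows "chain_int k n x = (trans_op ^^ n) k x"
  using assms(1,2)
proof (induction n arbitrary: k C)
  case 0
  then show ?case using x by (simp add: chain_int_def gain_time_def prob_space)
next
  case (Suc n)
  then show ?case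
    using chain_step[OF Suc.prems] Suc.IH[of "trans_op k" "rho * C"] trans_op_bounded[OF Suc.prems]
    by (simp add: funpow_swap1)
qed

text \<open>The discounted probability of ruin before the first gain, where ruin then occurs at time
  y. The cut-off at 0 keeps it bounded on the whole line.\<close>

definition psi :: "real \<Rightarrow> complex" where
  "psi y = of_bool (0 < y) * (\<integral>w. of_bool (y \<le> gapB R 0 w) * exp (- (of_real \<alpha> * of_real y)) \<partial>base R)"

lemma psi_measurable [measurable]: "psi \<in> borel_measurable borel"
  unfolding psi_def[abs_def] by measurable

lemma psi_bounded: "norm (psi y) \<le> 1"
proof (cases "0 < y")
  case True
  have "norm (\<integral>w. of_bool (y \<le> gapB R 0 w) * exp (- (of_real \<alpha> * of_real y)) \<partial>base R :: complex) \<le> (\<integral>w. 1 \<partial>base R)"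
  proof (rule order_trans[OF integral_norm_bound], rule integral_mono)
    show b: "norm (of_bool (y \<le> gapB R 0 w) * exp (- (of_real \<alpha> * of_real y)) :: complex) \<le> 1" for w
      using True discount_rate_pos by (simp add: norm_mult)
    show "integrable (base R) (\<lambda>w. norm (of_bool (y \<le> gapB R 0 w) * exp (- (of_real \<alpha> * of_real y)) :: complex))"
      using b by (intro integrable_norm integrable_const_bound[of _ 1] AE_I2) auto
  qed auto
  then show ?thesis using True by (simp add: psi_def prob_space)
qed (simp add: psi_def)

text \<open>Given the past, only the current gap decides whether ruin falls into it; averaging over
  that gap turns the n-th summand of \<open>discount_ruin_time_sums\<close> into \<open>psi\<close>
  at the current level.\<close>

lemma ruin_term_expectation:
  "(\<integral>w. complex_of_real (of_bool (0 < level R x w n \<and> level R x w n \<le> gapB R n w) * exp (- (\<alpha> * (gain_time R n w + level R x w n)))) \<partial>base R)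
    = chain_int psi n x"
proof -
  let ?b = "Inl (Inl n) :: (nat + nat) + (nat + nat)"
  let ?X = "\<lambda>w. restrict (\<lambda>i. input i w) (past n)" and ?Y = "\<lambda>w. restrict (\<lambda>i. input i w) {?b}"
  define h where "h = (\<lambda>(p, q). complex_of_real (exp (- (\<alpha> * path_time n p))) *
     (of_bool (0 < path_level R x p n) * (of_bool (path_level R x p n \<le> q ?b) * exp (- (of_real \<alpha> * of_real (path_level R x p n))))))"
  have ind: "indep_var (Pi\<^sub>M (past n) (\<lambda>_. borel)) ?X (Pi\<^sub>M {?b} (\<lambda>_. borel)) ?Y"
    by (rule indep_var_restrict[OF indep]) auto
  have m: "h \<in> borel_measurable (Pi\<^sub>M (past n) (\<lambda>_. borel) \<Otimes>\<^sub>M Pi\<^sub>M {?b} (\<lambda>_. borel))"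
  proof -
    have [measurable]: "path_time n \<in> borel_measurable (Pi\<^sub>M (past n) (\<lambda>_. borel))"
      "(\<lambda>p. path_level R x p n) \<in> borel_measurable (Pi\<^sub>M (past n) (\<lambda>_. borel))"
      by (auto intro!: path_time_measurable path_level_measurable)
    have [measurable]: "(\<lambda>p. p ?b) \<in> borel_measurable (Pi\<^sub>M {?b} (\<lambda>_. borel :: real measure))"
      using measurable_component_singleton[of ?b "{?b}" "\<lambda>_. borel"] by simp
    show ?thesis unfolding h_def by measurable
  qed
  have h: "h (?X w, ?Y w') = of_real (exp (- (\<alpha> * gain_time R n w))) *
     (of_bool (0 < level R x w n) * (of_bool (level R x w n \<le> gapB R n w') * exp (- (of_real \<alpha> * of_real (level R x w n)))))" for w w'
    by (simp add: h_def level_eq_path gain_time_eq_path path_level_restrict path_time_restrict)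
  have inner: "of_bool (0 < y) * (\<integral>w'. of_bool (y \<le> gapB R n w') * exp (- (of_real \<alpha> * of_real y)) \<partial>base R) = psi y" for y
  proof -
    have "(\<integral>w'. of_bool (y \<le> gapB R m w') * exp (- (of_real \<alpha> * of_real y)) \<partial>base R)
      = (\<integral>z. of_bool (y \<le> z) * exp (- (of_real \<alpha> * of_real y)) \<partial>distr (base R) borel (gapB R m) :: complex)" for m
      by (subst integral_distr) auto
    from this[of n] this[of 0] show ?thesis unfolding psi_def by (simp only: gap_distr[of n])
  qed
  have "(\<integral>w. h (?X w, ?Y w) \<partial>base R) = (\<integral>w. (\<integral>w'. h (?X w, ?Y w') \<partial>base R) \<partial>base R)"
  proof (rule indep_expectation[OF ind m])
    show "integrable (base R) (\<lambda>w. h (?X w, ?Y w))"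
      unfolding h
    proof (rule integrable_const_bound[of _ 1], rule AE_I2, rule norm_mult_le_bound[OF exp_gain_time_le_1], assumption)
      show "norm (of_bool (0 < level R x w n) * (of_bool (level R x w n \<le> gapB R n w) * exp (- (of_real \<alpha> * of_real (level R x w n)))) :: complex) \<le> 1" for w
        using discount_rate_pos by (simp add: norm_mult)
    qed auto
  qed
  also have "\<dots> = chain_int psi n x"
  proof -
    have "of_bool (0 < y) * psi y = psi y" for y by (simp add: psi_def)
    then show ?thesis unfolding h chain_int_def by (simp only: integral_mult_right_zero inner)
  qed
  also have "(\<integral>w. h (?X w, ?Y w) \<partial>base R) = (\<integral>w. complex_of_real (of_bool (0 < level R x w n \<and> level R x w n \<le> gapB R n w) * exp (- (\<alpha> * (gain_time R n w + level R x w n)))) \<partial>base R)"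
    unfolding h by (intro Bochner_Integration.integral_cong refl) (auto simp: distrib_left exp_add[symmetric] exp_of_real[symmetric] simp flip: of_real_mult)
  finally show ?thesis .
qed

text \<open>The Neumann series for f = psi + P f. It is defined, measurable and bounded on the whole
  line, and has its probabilistic meaning at positive arguments.\<close>

definition ruin_lt :: "real \<Rightarrow> complex" where
  "ruin_lt x = (\<Sum>n. (trans_op ^^ n) psi x)"

lemma iterates_summable:
  assumes "k \<in> borel_measurable borel" "\<And>x. norm (k x) \<le> C"
  shows "summable (\<lambda>n. norm ((trans_op ^^ n) k x))" "summable (\<lambda>n. (trans_op ^^ n) k x)"
proof -
  have "summable (\<lambda>n. rho ^ n * C)" using rho by (intro summable_mult2 summable_geometric) auto
  then show "summable (\<lambda>n. norm ((trans_op ^^ n) k x))"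
    by (rule summable_comparison_test') (use trans_op_iterate(2)[OF assms] in auto)
  then show "summable (\<lambda>n. (trans_op ^^ n) k x)" by (rule summable_norm_cancel)
qed

text \<open>The n-th term of the Neumann series is the expected discount on the event that ruin
  falls into gap n.\<close>

lemma expected_discount:
  assumes x: "x > 0"
  shows "complex_of_real (\<integral>w. discount \<alpha> (ruin_time R x w) \<partial>base R) = ruin_lt x"
    and "norm (ruin_lt x) \<le> exp (- (\<alpha> * x))"
proof -
  let ?t = "\<lambda>n w. of_bool (0 < level R x w n \<and> level R x w n \<le> gapB R n w) * exp (- (\<alpha> * (gain_time R n w + level R x w n)))"
  have good: "AE w in base R. (\<forall>n. gainC0 R n w > 0) \<and> (\<forall>n. gainC1 R n w > 0) \<and> (\<exists>n. gain_time R n w > x) \<and> w \<in> space (base R)"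
    using gains_pos gain_times_unbounded[of x] by (auto simp: AE_all_countable)
  have sums: "AE w in base R. (\<lambda>n. ?t n w) sums discount \<alpha> (ruin_time R x w)"
    using good by eventually_elim (auto intro!: discount_ruin_time_sums gap_pos a_pos x discount_rate_pos)
  have le: "AE w in base R. discount \<alpha> (ruin_time R x w) \<le> exp (- (\<alpha> * x))"
    using good by eventually_elim (auto intro!: discount_ruin_time_sums(2) gap_pos a_pos x discount_rate_pos)
  have nonneg: "0 \<le> discount \<alpha> (ruin_time R x w)" "discount \<alpha> (ruin_time R x w) \<le> 1" for w
    using discount_bounded[OF discount_rate_pos ruin_time_nonneg, of R x w] by auto
  have tb: "norm (complex_of_real (?t n w)) \<le> 1" if "w \<in> space (base R)" for n w
    using gain_time_ge_0[OF that, of n] discount_rate_pos by (auto intro!: mult_nonneg_nonneg)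
  have it: "integrable (base R) (\<lambda>w. complex_of_real (?t n w))" for n
    by (intro integrable_const_bound[of _ 1] AE_I2 tb) auto
  \<comment> \<open>The summands are nonnegative, so their L1 norms are the terms of the Neumann
    series themselves, and its geometric decay permits exchanging sum and expectation.\<close>
  have nt: "(\<integral>w. norm (complex_of_real (?t n w)) \<partial>base R) = norm ((trans_op ^^ n) psi x)" for n
  proof -
    have "complex_of_real (\<integral>w. norm (complex_of_real (?t n w)) \<partial>base R) = (\<integral>w. complex_of_real (?t n w) \<partial>base R)"
    proof -
      have nn: "norm (complex_of_real (?t n w)) = ?t n w" for w by (simp only: norm_of_real) simp
      show ?thesis unfolding nn by (rule integral_complex_of_real[symmetric])
    qed
    also have "\<dots> = (trans_op ^^ n) psi x"
      unfolding ruin_term_expectation by (rule chain_int_eq_iterate[OF psi_measurable psi_bounded x])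
    finally have "norm (complex_of_real (\<integral>w. norm (complex_of_real (?t n w)) \<partial>base R)) = norm ((trans_op ^^ n) psi x)" by simp
    moreover have "(\<integral>w. norm (complex_of_real (?t n w)) \<partial>base R) \<ge> 0" by (intro integral_nonneg_AE) auto
    ultimately show ?thesis by (simp only: norm_of_real abs_of_nonneg)
  qed
  have "(\<lambda>n. \<integral>w. complex_of_real (?t n w) \<partial>base R) sums (\<integral>w. (\<Sum>n. complex_of_real (?t n w)) \<partial>base R)"
  proof (rule sums_integral[OF it])
    show "AE w in base R. summable (\<lambda>n. norm (complex_of_real (?t n w)))"
      using sums by eventually_elim (auto simp: sums_iff norm_mult)
    show "summable (\<lambda>n. \<integral>w. norm (complex_of_real (?t n w)) \<partial>base R)"
      unfolding nt by (rule iterates_summable(1)[OF psi_measurable psi_bounded])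
  qed
  then have "(\<integral>w. (\<Sum>n. complex_of_real (?t n w)) \<partial>base R) = ruin_lt x"
    unfolding ruin_term_expectation ruin_lt_def
    using chain_int_eq_iterate[OF psi_measurable psi_bounded x] by (simp add: sums_iff)
  moreover have "(\<integral>w. (\<Sum>n. complex_of_real (?t n w)) \<partial>base R) = (\<integral>w. complex_of_real (discount \<alpha> (ruin_time R x w)) \<partial>base R)"
  proof (rule integral_cong_AE)
    show "AE w in base R. (\<Sum>n. complex_of_real (?t n w)) = complex_of_real (discount \<alpha> (ruin_time R x w))"
      using sums
    proof eventually_elim
      case (elim w)
      show ?case by (rule sums_unique[OF sums_of_real[OF elim], symmetric])
    qed
    show "(\<lambda>w. complex_of_real (discount \<alpha> (ruin_time R x w))) \<in> borel_measurable (base R)"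
      using ruin_time_measurable[OF x] by measurable
  qed auto
  ultimately show e: "complex_of_real (\<integral>w. discount \<alpha> (ruin_time R x w) \<partial>base R) = ruin_lt x" by simp
  have [measurable]: "(\<lambda>w. discount \<alpha> (ruin_time R x w)) \<in> borel_measurable (base R)"
    using ruin_time_measurable[OF x] by measurable
  have "integrable (base R) (\<lambda>w. discount \<alpha> (ruin_time R x w))"
    by (rule integrable_const_bound[of _ 1]) (use nonneg in auto)
  then have "(\<integral>w. discount \<alpha> (ruin_time R x w) \<partial>base R) \<le> (\<integral>w. exp (- (\<alpha> * x)) \<partial>base R)"
    by (rule integral_mono_AE) (use le in auto)
  moreover have "(\<integral>w. discount \<alpha> (ruin_time R x w) \<partial>base R) \<ge> 0" using nonneg by (intro integral_nonneg_AE) auto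
  ultimately show "norm (ruin_lt x) \<le> exp (- (\<alpha> * x))" unfolding e[symmetric] by (simp add: prob_space)
qed

subsection \<open>The functional equation\<close>

lemma laplace_iterates_sums:
  assumes k: "k \<in> borel_measurable borel" "\<And>x. norm (k x) \<le> C" and s: "Re s > 0"
  shows "(\<lambda>n. laplace ((trans_op ^^ n) k) s) sums laplace (\<lambda>x. \<Sum>n. (trans_op ^^ n) k x) s"
proof -
  note it = trans_op_iterate[OF k]
  let ?f = "\<lambda>n x. indicator {0<..} x *\<^sub>R (exp (- (s * of_real x)) * (trans_op ^^ n) k x)"
  have i: "integrable lborel (?f n)" for n by (rule laplace_bounded(1)[OF it s])
  have sm: "summable (\<lambda>n. norm ((trans_op ^^ n) k x))" and sm': "(\<lambda>n. (trans_op ^^ n) k x) sums (\<Sum>n. (trans_op ^^ n) k x)" for x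
    using iterates_summable[OF k] by (auto intro: summable_sums)
  have "(\<lambda>n. integral\<^sup>L lborel (?f n)) sums (\<integral>x. (\<Sum>n. ?f n x) \<partial>lborel)"
  proof (rule sums_integral[OF i])
    show "AE x in lborel. summable (\<lambda>n. norm (?f n x))"
      using sm by (intro AE_I2) (auto simp: norm_mult intro!: summable_mult)
    have "norm (\<integral>x. norm (?f n x) \<partial>lborel) \<le> rho ^ n * (C * (1 / Re s))" for n
    proof -
      have "norm (\<integral>x. norm (?f n x) \<partial>lborel) = (\<integral>x. norm (?f n x) \<partial>lborel)"
        by (auto intro!: integral_nonneg_AE)
      also have "\<dots> \<le> (\<integral>x. rho ^ n * C * (indicator {0<..} x * exp (- (Re s * x))) \<partial>lborel)"
      proof (rule integral_mono)
        show "norm (?f n x) \<le> rho ^ n * C * (indicator {0<..} x * exp (- (Re s * x)))" for x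
          using mult_right_mono[OF it(2)[of n x], of "exp (- (Re s * x))"] by (auto simp: indicator_def norm_mult mult.commute)
        show "integrable lborel (\<lambda>x. rho ^ n * C * (indicator {0<..} x * exp (- (Re s * x))))"
          by (intro integrable_mult_right exp_integral_Ioi(1)[OF s])
      qed (rule integrable_norm[OF i])
      also have "\<dots> = rho ^ n * (C * (1 / Re s))"
        unfolding integral_mult_right_zero exp_integral_Ioi(2)[OF s] by simp
      finally show ?thesis .
    qed
    then show "summable (\<lambda>n. \<integral>x. norm (?f n x) \<partial>lborel)"
    proof (rule summable_comparison_test'[rotated])
      show "summable (\<lambda>n. rho ^ n * (C * (1 / Re s)))" by (intro summable_mult2 summable_geometric) (use rho in auto)
    qed
  qed
  moreover have "(\<Sum>n. ?f n x) = indicator {0<..} x *\<^sub>R (exp (- (s * of_real x)) * (\<Sum>n. (trans_op ^^ n) k x))" for x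
    by (rule sums_unique[symmetric]) (intro sums_scaleR_right sums_mult sm')
  ultimately show ?thesis by (simp add: laplace_def set_lebesgue_integral_def)
qed

lemma laplace_kern:
  fixes g :: "real \<Rightarrow> complex"
  assumes [measurable]: "g \<in> borel_measurable borel" "Measurable.pred (base R) J"
    and g: "\<And>v. norm (g v) \<le> C" and c: "c > 0" and s: "Re s > 0"
  shows "laplace (kern J c g) s = (\<integral>w. exp (- ((s + of_real \<alpha>) * of_real (gapB R 0 w))) * of_bool (J w) \<partial>base R) / of_real c * laplace g (s / of_real c)"
proof -
  have nb: "norm (complex_of_real (exp (- (\<alpha> * gapB R 0 w))) * of_bool (J w)) \<le> 1" if "w \<in> space (base R)" for w
    by (intro norm_mult_le_bound exp_gap_le_1 norm_of_bool_le_1 that)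
  have "laplace (kern J c g) s = (\<integral>w. exp (- (s * of_real (gapB R 0 w))) * (of_real (exp (- (\<alpha> * gapB R 0 w))) * of_bool (J w)) \<partial>base R) / of_real c * laplace g (s / of_real c)"
    unfolding kern_def[abs_def]
    by (rule laplace_kernel[OF _ _ assms(1) gap_pos nb g c s]) auto
  also have "(\<integral>w. exp (- (s * of_real (gapB R 0 w))) * (of_real (exp (- (\<alpha> * gapB R 0 w))) * of_bool (J w)) \<partial>base R)
     = (\<integral>w. exp (- ((s + of_real \<alpha>) * of_real (gapB R 0 w))) * of_bool (J w) \<partial>base R)"
    by (intro Bochner_Integration.integral_cong refl) (simp add: exp_of_real[symmetric] mult_exp_exp algebra_simps)
  finally show ?thesis .
qed

lemma laplace_trans_op:
  assumes k [measurable]: "k \<in> borel_measurable borel" and kb: "\<And>x. norm (k x) \<le> C" and s: "Re s > 0"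
  shows "laplace (trans_op k) s =
    hat0 s * (\<Sum>j=1..nK R. of_real (wq R j) * laplace (exp_shift (mu R j) k) (down0 s))
    + hat1 s * (\<Sum>i=1..nL R. of_real (wh R i) * laplace (exp_shift (nu R i) k) (down1 s))"
proof -
  have sc: "Re (s / of_real c) > 0" if "c > 0" for c :: real using s that by (simp add: Re_divide_of_real)
  have s0: "laplace (shift0 k) z = (\<Sum>j=1..nK R. of_real (wq R j) * laplace (exp_shift (mu R j) k) z)" if "Re z > 0" for z
    unfolding hyper_shift_def[abs_def]
    by (rule laplace_sum[OF _ exp_shift_integrable(2)[OF k kb mu_pos] that]) auto
  have s1: "laplace (shift1 k) z = (\<Sum>i=1..nL R. of_real (wh R i) * laplace (exp_shift (nu R i) k) z)" if "Re z > 0" for z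
    unfolding hyper_shift_def[abs_def]
    by (rule laplace_sum[OF _ exp_shift_integrable(2)[OF k kb nu_pos] that]) auto
  have "laplace (trans_op k) s = laplace (kern J0 (1 + a0 R) (shift0 k)) s + laplace (kern J1 (1 + a1 R) (shift1 k)) s"
    unfolding trans_op_def[abs_def]
    by (rule laplace_add[OF _ kern_bounded[OF _ _ shift0_bounded[OF k kb]] _ kern_bounded[OF _ _ shift1_bounded[OF k kb]] s]) auto
  also have "laplace (kern J0 (1 + a0 R) (shift0 k)) s = hat0 s * laplace (shift0 k) (down0 s)"
    using a_pos unfolding chi0_hat_def chi0_def by (intro laplace_kern[OF _ _ shift0_bounded[OF k kb] _ s]) auto
  also have "laplace (kern J1 (1 + a1 R) (shift1 k)) s = hat1 s * laplace (shift1 k) (down1 s)"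
    using a_pos unfolding chi1_hat_def chi1_def by (intro laplace_kern[OF _ _ shift1_bounded[OF k kb] _ s]) auto
  also have "laplace (shift0 k) (down0 s) = (\<Sum>j=1..nK R. of_real (wq R j) * laplace (exp_shift (mu R j) k) (down0 s))"
    using a_pos by (intro s0 sc) simp
  also have "laplace (shift1 k) (down1 s) = (\<Sum>i=1..nL R. of_real (wh R i) * laplace (exp_shift (nu R i) k) (down1 s))"
    using a_pos by (intro s1 sc) simp
  finally show ?thesis .
qed

lemma laplace_psi: "Re s > 0 \<Longrightarrow> laplace psi s = (1 - phi R (s + of_real \<alpha>)) / (s + of_real \<alpha>)"
  unfolding phi_def
  by (subst laplace_truncated_exp[symmetric]) (auto intro!: laplace_cong gap_pos discount_rate_pos simp: psi_def)

text \<open>\<open>sing R\<close> consists of the points that some nonempty sequence of scalings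
  carries to a pole, the last scaling being of the kind that belongs to the rate. Its complement is
  therefore stable under both scalings.\<close>

lemma not_sing_scaled:
  assumes "s \<notin> sing R"
  shows "down0 s \<notin> sing R" "down1 s \<notin> sing R"
    and "j \<in> {1..nK R} \<Longrightarrow> down0 s \<noteq> of_real (mu R j)"
    and "i \<in> {1..nL R} \<Longrightarrow> down1 s \<noteq> of_real (nu R i)"
proof -
  have nz: "complex_of_real (1 + a0 R) \<noteq> 0" "complex_of_real (1 + a1 R) \<noteq> 0"
    using a_pos by (simp_all only: of_real_eq_0_iff)
  have S: "of_real (mu R j * (1 + a0 R) ^ (l + 1) * (1 + a1 R) ^ m) \<in> sing R" if "j \<in> {1..nK R}" for j l m
    using that unfolding sing_def by blast
  have S': "of_real (nu R i * (1 + a0 R) ^ l * (1 + a1 R) ^ (m + 1)) \<in> sing R" if "i \<in> {1..nL R}" for i l m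
    using that unfolding sing_def by blast
  show "down0 s \<notin> sing R"
  proof
    assume "down0 s \<in> sing R"
    then consider j l m where "j \<in> {1..nK R}" "down0 s = of_real (mu R j * (1 + a0 R) ^ (l + 1) * (1 + a1 R) ^ m)"
      | i l m where "i \<in> {1..nL R}" "down0 s = of_real (nu R i * (1 + a0 R) ^ l * (1 + a1 R) ^ (m + 1))"
      unfolding sing_def by blast
    then show False
    proof cases
      case 1
      then have "s = of_real (mu R j * (1 + a0 R) ^ (Suc l + 1) * (1 + a1 R) ^ m)"
        using nz by (simp add: nonzero_divide_eq_eq mult_ac)
      then show ?thesis using S[OF 1(1), of "Suc l" m] assms by simp
    next
      case 2
      then have "s = of_real (nu R i * (1 + a0 R) ^ (Suc l) * (1 + a1 R) ^ (m + 1))"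
        using nz by (simp add: nonzero_divide_eq_eq mult_ac)
      then show ?thesis using S'[OF 2(1), of "Suc l" m] assms by simp
    qed
  qed
  show "down1 s \<notin> sing R"
  proof
    assume "down1 s \<in> sing R"
    then consider j l m where "j \<in> {1..nK R}" "down1 s = of_real (mu R j * (1 + a0 R) ^ (l + 1) * (1 + a1 R) ^ m)"
      | i l m where "i \<in> {1..nL R}" "down1 s = of_real (nu R i * (1 + a0 R) ^ l * (1 + a1 R) ^ (m + 1))"
      unfolding sing_def by blast
    then show False
    proof cases
      case 1
      then have "s = of_real (mu R j * (1 + a0 R) ^ (l + 1) * (1 + a1 R) ^ (Suc m))"
        using nz by (simp add: nonzero_divide_eq_eq mult_ac)
      then show ?thesis using S[OF 1(1), of l "Suc m"] assms by simp
    next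
      case 2
      then have "s = of_real (nu R i * (1 + a0 R) ^ l * (1 + a1 R) ^ (Suc m + 1))"
        using nz by (simp add: nonzero_divide_eq_eq mult_ac)
      then show ?thesis using S'[OF 2(1), of l "Suc m"] assms by simp
    qed
  qed
  show "down0 s \<noteq> of_real (mu R j)" if "j \<in> {1..nK R}"
  proof
    assume "down0 s = of_real (mu R j)"
    then have "s = of_real (mu R j * (1 + a0 R) ^ (0 + 1) * (1 + a1 R) ^ 0)"
      using nz by (simp add: nonzero_divide_eq_eq)
    then show False using S[OF that, of 0 0] assms by simp
  qed
  show "down1 s \<noteq> of_real (nu R i)" if "i \<in> {1..nL R}"
  proof
    assume "down1 s = of_real (nu R i)"
    then have "s = of_real (nu R i * (1 + a0 R) ^ 0 * (1 + a1 R) ^ (0 + 1))"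
      using nz by (simp add: nonzero_divide_eq_eq)
    then show False using S'[OF that, of 0 0] assms by simp
  qed
qed

definition step_op :: "(complex \<Rightarrow> complex) \<Rightarrow> complex \<Rightarrow> complex" where
  "step_op \<Phi> s = L10 R \<alpha> s * \<Phi> (down0 s) + L01 R \<alpha> s * \<Phi> (down1 s)"

text \<open>The inhomogeneous part of the functional equation, apart from the contribution of \<open>psi\<close>.\<close>

definition corr :: "(nat \<Rightarrow> complex) \<Rightarrow> (nat \<Rightarrow> complex) \<Rightarrow> complex \<Rightarrow> complex" where
  "corr u v s =
     hat0 s *
       (\<Sum>j=1..nK R. of_real (wq R j) *
          (of_real (mu R j) / (of_real (mu R j) - down0 s)) * u j)
     + hat1 s *
       (\<Sum>i=1..nL R. of_real (wh R i) *
          (of_real (nu R i) / (of_real (nu R i) - down1 s)) * v i)"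

lemma Ktil_eq: "Ktil R \<alpha> u v s = (1 - phi R (s + of_real \<alpha>)) / (s + of_real \<alpha>) - corr u v s"
  by (simp add: Ktil_def corr_def)

text \<open>Here each divided difference from \<open>laplace_exp_shift\<close> is split into its two
  parts, which is possible only away from the poles. The values at the rates belong to
  \<open>k\<close> itself, so \<open>corr\<close> changes with \<open>k\<close>.\<close>

lemma laplace_trans_op_eq:
  assumes k: "k \<in> borel_measurable borel" "\<And>x. norm (k x) \<le> C" and s: "Re s > 0" "s \<notin> sing R"
  shows "laplace (trans_op k) s = step_op (laplace k) s
    - corr (\<lambda>j. laplace k (of_real (mu R j))) (\<lambda>i. laplace k (of_real (nu R i))) s"
proof -
  have sc: "Re (down0 s) > 0" "Re (down1 s) > 0"
    using s a_pos by (simp_all add: Re_divide_of_real)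
  have e0: "laplace (exp_shift (mu R j) k) (down0 s) = of_real (mu R j) / (of_real (mu R j) - down0 s) *
      (laplace k (down0 s) - laplace k (of_real (mu R j)))" if "j \<in> {1..nK R}" for j
    using laplace_exp_shift[OF k mu_pos[OF that] sc(1) not_sing_scaled(3)[OF s(2) that]] by simp
  have e1: "laplace (exp_shift (nu R i) k) (down1 s) = of_real (nu R i) / (of_real (nu R i) - down1 s) *
      (laplace k (down1 s) - laplace k (of_real (nu R i)))" if "i \<in> {1..nL R}" for i
    using laplace_exp_shift[OF k nu_pos[OF that] sc(2) not_sing_scaled(4)[OF s(2) that]] by simp
  have "(\<Sum>j=1..nK R. of_real (wq R j) * laplace (exp_shift (mu R j) k) (down0 s))
    = (\<Sum>j=1..nK R. of_real (wq R j) * (of_real (mu R j) / (of_real (mu R j) - down0 s))) * laplace k (down0 s)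
      - (\<Sum>j=1..nK R. of_real (wq R j) * (of_real (mu R j) / (of_real (mu R j) - down0 s)) * laplace k (of_real (mu R j)))"
    unfolding sum_distrib_right sum_subtractf[symmetric] by (intro sum.cong refl) (simp only: e0 right_diff_distrib mult.assoc)
  moreover have "(\<Sum>i=1..nL R. of_real (wh R i) * laplace (exp_shift (nu R i) k) (down1 s))
    = (\<Sum>i=1..nL R. of_real (wh R i) * (of_real (nu R i) / (of_real (nu R i) - down1 s))) * laplace k (down1 s)
      - (\<Sum>i=1..nL R. of_real (wh R i) * (of_real (nu R i) / (of_real (nu R i) - down1 s)) * laplace k (of_real (nu R i)))"
    unfolding sum_distrib_right sum_subtractf[symmetric] by (intro sum.cong refl) (simp only: e1 right_diff_distrib mult.assoc)
  ultimately show ?thesis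
    unfolding laplace_trans_op[OF k s(1)] step_op_def corr_def L10_def L01_def
    by (simp only: right_diff_distrib mult.assoc) simp
qed

lemma tau_eq_laplace: "tau R \<alpha> s = laplace ruin_lt s"
  unfolding tau_def laplace_def[symmetric] by (rule laplace_cong) (rule expected_discount(1))

text \<open>Summed along the Neumann series: \<open>laplace_trans_op_eq\<close> links consecutive
  terms, and the values of the terms at the rates add up to those of \<open>tau\<close>. The term of
  index 0 contributes the transform of \<open>psi\<close>.\<close>

lemma tau_functional_equation:
  assumes s: "Re s > 0" "s \<notin> sing R"
  shows "tau R \<alpha> s = Ktil R \<alpha> (\<lambda>j. tau R \<alpha> (of_real (mu R j))) (\<lambda>i. tau R \<alpha> (of_real (nu R i))) s + step_op (tau R \<alpha>) s"
proof -
  let ?l = "\<lambda>n. laplace ((trans_op ^^ n) psi)"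
  have L: "(\<lambda>n. ?l n z) sums tau R \<alpha> z" if "Re z > 0" for z
    using laplace_iterates_sums[OF psi_measurable psi_bounded that] by (simp add: tau_eq_laplace ruin_lt_def[abs_def])
  have sc: "Re (down0 s) > 0" "Re (down1 s) > 0"
    using s a_pos by (simp_all add: Re_divide_of_real)
  have m: "(\<lambda>n. ?l n (of_real (mu R j))) sums tau R \<alpha> (of_real (mu R j))" if "j \<in> {1..nK R}" for j
    using mu_pos[OF that] by (intro L) simp
  have n: "(\<lambda>n. ?l n (of_real (nu R i))) sums tau R \<alpha> (of_real (nu R i))" if "i \<in> {1..nL R}" for i
    using nu_pos[OF that] by (intro L) simp
  have "(\<lambda>n. ?l (Suc n) s) sums (step_op (tau R \<alpha>) s - corr (\<lambda>j. tau R \<alpha> (of_real (mu R j))) (\<lambda>i. tau R \<alpha> (of_real (nu R i))) s)"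
  proof -
    have "?l (Suc n) s = step_op (?l n) s - corr (\<lambda>j. ?l n (of_real (mu R j))) (\<lambda>i. ?l n (of_real (nu R i))) s" for n
      using laplace_trans_op_eq[OF trans_op_iterate[OF psi_measurable psi_bounded] s, of n] by simp
    then show ?thesis
      unfolding step_op_def corr_def
      by (simp only:) (intro sums_diff sums_add sums_mult sums_sum L sc m n)
  qed
  then have "(\<lambda>n. ?l n s) sums (step_op (tau R \<alpha>) s - corr (\<lambda>j. tau R \<alpha> (of_real (mu R j))) (\<lambda>i. tau R \<alpha> (of_real (nu R i))) s + ?l 0 s)"
    by (subst (asm) sums_Suc_iff) simp
  from sums_unique2[OF L[OF s(1)] this] show ?thesis
    by (simp add: Ktil_eq laplace_psi[OF s(1)])
qed

subsection \<open>Iteration of the functional equation\<close>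

text \<open>The recursion read backwards: each entry of diagonal n feeds two neighbours on diagonal
  n + 1, and collecting by the feeding entry leaves one application of T.\<close>

lemma diagonal_sum_Suc:
  "(\<Sum>l=0..Suc n. Ltil R \<alpha> s l (Suc n - l) * \<Phi> (scale R l (Suc n - l) s))
   = (\<Sum>l=0..n. Ltil R \<alpha> s l (n - l) * step_op \<Phi> (scale R l (n - l) s))"
proof -
  let ?t = "Ltil R \<alpha> s" and ?x = "\<lambda>l m. L10 R \<alpha> (scale R l m s)" and ?y = "\<lambda>l m. L01 R \<alpha> (scale R l m s)"
    and ?f = "\<lambda>l m. \<Phi> (scale R l m s)"
  \<comment> \<open>The case distinction supplies the value 0 for negative indices, since
    \<open>l - 1\<close> truncates at 0.\<close>
  let ?A = "\<lambda>l m. if l = 0 then 0 else ?t (l - 1) m * ?x (l - 1) m * ?f l m"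
  let ?B = "\<lambda>l m. if m = 0 then 0 else ?t l (m - 1) * ?y l (m - 1) * ?f l m"
  have "?t l (Suc n - l) * ?f l (Suc n - l) = ?A l (Suc n - l) + ?B l (Suc n - l)" for l
  proof (cases l)
    case 0
    then show ?thesis by simp
  next
    case (Suc l')
    then show ?thesis by (cases "Suc n - l") (auto simp: distrib_right)
  qed
  then have "(\<Sum>l=0..Suc n. ?t l (Suc n - l) * ?f l (Suc n - l))
     = (\<Sum>l=0..Suc n. ?A l (Suc n - l)) + (\<Sum>l=0..Suc n. ?B l (Suc n - l))"
    by (simp only: sum.distrib)
  also have "(\<Sum>l=0..Suc n. ?A l (Suc n - l)) = (\<Sum>l=0..n. ?t l (n - l) * ?x l (n - l) * ?f (Suc l) (n - l))"
    by (subst sum.atLeast0_atMost_Suc_shift) simp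
  also have "(\<Sum>l=0..Suc n. ?B l (Suc n - l)) = (\<Sum>l=0..n. ?t l (n - l) * ?y l (n - l) * ?f l (Suc (n - l)))"
    by (subst sum.atLeast0_atMost_Suc) (auto intro!: sum.cong simp: Suc_diff_le)
  also have "(\<Sum>l=0..n. ?t l (n - l) * ?x l (n - l) * ?f (Suc l) (n - l)) + (\<Sum>l=0..n. ?t l (n - l) * ?y l (n - l) * ?f l (Suc (n - l)))
     = (\<Sum>l=0..n. ?t l (n - l) * step_op \<Phi> (scale R l (n - l) s))"
    unfolding sum.distrib[symmetric] step_op_def scale_div by (intro sum.cong refl) (simp add: algebra_simps)
  finally show ?thesis .
qed

text \<open>\<open>Ltil R \<alpha> s l m\<close> sums the products of coefficients over all orders
  of l scalings of the first and m of the second kind. The argument reached does not depend on the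
  order, so T^n groups by l and m.\<close>

lemma diagonal_sum_eq_iterate:
  "(\<Sum>l=0..n. Ltil R \<alpha> s l (n - l) * \<Phi> (scale R l (n - l) s)) = (step_op ^^ n) \<Phi> s"
proof (induction n arbitrary: \<Phi>)
  case 0
  show ?case by (simp add: scale_def)
next
  case (Suc n)
  show ?case unfolding diagonal_sum_Suc Suc.IH by (simp add: funpow_swap1)
qed

lemma Ldiag_eq: "Ldiag R \<alpha> s n = (step_op ^^ n) (\<lambda>_. 1) s"
  using diagonal_sum_eq_iterate[of s n "\<lambda>_. 1"] by (simp add: Ldiag_def)

lemma LKdiag_eq: "LKdiag R \<alpha> u v s n = (step_op ^^ n) (Ktil R \<alpha> u v) s"
  unfolding LKdiag_def by (rule diagonal_sum_eq_iterate)

text \<open>Stable under both scalings, with the imaginary axis in its interior, and still at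
  distance \<alpha> / 2 from the boundary of the half-plane where the transforms of the gap at s +
  \<alpha> are under control.\<close>

definition half :: "complex set" where
  "half = {s. Re s > - (\<alpha> / 2)}"

lemma half_scaled:
  assumes "s \<in> half"
  shows "down0 s \<in> half" "down1 s \<in> half"
proof -
  have "Re s / c > - (\<alpha> / 2)" if "c > 1" for c
  proof (cases "Re s \<ge> 0")
    case True
    then have "Re s / c \<ge> 0" using that by simp
    then show ?thesis using discount_rate_pos by linarith
  next
    case False
    then have "Re s / 1 \<le> Re s / c" using that by (intro divide_left_mono_neg) auto
    then show ?thesis using assms by (simp add: half_def)
  qed
  from this[of "1 + a0 R"] this[of "1 + a1 R"] show "down0 s \<in> half" "down1 s \<in> half"
    using a_pos by (simp_all add: half_def Re_divide_of_real del: of_real_add)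
qed

definition growth :: real where
  "growth = 1 + min (a0 R) (a1 R)"

lemma growth_gt_1: "growth > 1"
  using a_pos by (simp add: growth_def)

lemma norm_scaled_le:
  fixes s :: complex
  shows
  "norm (down0 s) \<le> norm s / growth" "norm (down1 s) \<le> norm s / growth"
proof -
  have "norm (s / of_real c) \<le> norm s / growth" if "c \<ge> growth" for c
    using that growth_gt_1 unfolding norm_divide by (intro divide_left_mono mult_pos_pos) (auto simp: abs_if)
  then show "norm (down0 s) \<le> norm s / growth" "norm (down1 s) \<le> norm s / growth"
    by (auto simp: growth_def simp del: of_real_add)
qed

text \<open>The two events are complementary, so under the expectation the two moduli add up to exp
  (- Re z B).\<close>

lemma chi_bound:
  assumes "Re z \<ge> \<alpha> / 2"
  shows "norm (chi0 R z) + norm (chi1 R z) \<le> rho"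
proof -
  let ?e = "\<lambda>w. exp (- (Re z * gapB R 0 w))"
  have pos: "0 < Re z" using assms discount_rate_pos by simp
  have ie: "integrable (base R) ?e" using exp_gap_expectation(1)[OF pos] .
  have i: "integrable (base R) (\<lambda>w. ?e w * of_bool (J w))" if [measurable]: "Measurable.pred (base R) J" for J
    by (rule Bochner_Integration.integrable_bound[OF ie]) auto
  have b: "norm (\<integral>w. exp (- (z * of_real (gapB R 0 w))) * of_bool (J w) \<partial>base R) \<le> (\<integral>w. ?e w * of_bool (J w) \<partial>base R)"
    for J
  proof -
    have "norm (exp (- (z * of_real (gapB R 0 w))) * of_bool (J w)) = ?e w * of_bool (J w)" for w
      by (cases "J w") auto
    then show ?thesis
      using integral_norm_bound[of "base R" "\<lambda>w. exp (- (z * of_real (gapB R 0 w))) * of_bool (J w)"] by (simp only:)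
  qed
  have "norm (chi0 R z) + norm (chi1 R z) \<le> (\<integral>w. ?e w * of_bool (J0 w) \<partial>base R) + (\<integral>w. ?e w * of_bool (J1 w) \<partial>base R)"
    unfolding chi0_def chi1_def by (intro add_mono b)
  also have "\<dots> = (\<integral>w. ?e w * of_bool (J0 w) + ?e w * of_bool (J1 w) \<partial>base R)"
    by (rule Bochner_Integration.integral_add[symmetric]; rule i) auto
  also have "\<dots> = (\<integral>w. ?e w \<partial>base R)"
    by (intro Bochner_Integration.integral_cong) auto
  also have "\<dots> \<le> rho"
    unfolding rho_def
  proof (rule integral_mono[OF ie])
    show "integrable (base R) (\<lambda>w. exp (- ((\<alpha> / 2) * gapB R 0 w)))"
      using discount_rate_pos by (intro exp_gap_expectation(1)) simp
    show "?e w \<le> exp (- ((\<alpha> / 2) * gapB R 0 w))" if "w \<in> space (base R)" for w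
      using mult_right_mono[OF assms, of "gapB R 0 w"] gap_pos[OF that, of 0] by simp
  qed
  finally show ?thesis .
qed

lemma chi_bound_half:
  assumes "s \<in> half"
  shows "norm (chi0 R (s + of_real \<alpha>)) + norm (chi1 R (s + of_real \<alpha>)) \<le> rho"
    "norm (chi0 R (s + of_real \<alpha>)) \<le> 1" "norm (chi1 R (s + of_real \<alpha>)) \<le> 1"
proof -
  show b: "norm (chi0 R (s + of_real \<alpha>)) + norm (chi1 R (s + of_real \<alpha>)) \<le> rho"
    by (rule chi_bound) (use assms in \<open>simp add: half_def\<close>)
  show "norm (chi0 R (s + of_real \<alpha>)) \<le> 1" "norm (chi1 R (s + of_real \<alpha>)) \<le> 1"
    using b rho norm_ge_zero[of "chi0 R (s + of_real \<alpha>)"] norm_ge_zero[of "chi1 R (s + of_real \<alpha>)"] by linarith+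
qed

text \<open>Near \<open>0\<close> the poles of \<open>L10\<close>, \<open>L01\<close> are so far away that the hyperexponential factors
  do not outweigh the factors \<open>1 / (1 + a\<^sub>i)\<close>.\<close>

definition radius :: real where
  "radius = Min (insert (\<alpha> / 4) ((\<lambda>j. a0 R * mu R j) ` {1..nK R} \<union> (\<lambda>i. a1 R * nu R i) ` {1..nL R}))"

lemma radius: "radius > 0" "radius \<le> \<alpha> / 4"
  "j \<in> {1..nK R} \<Longrightarrow> radius \<le> a0 R * mu R j" "i \<in> {1..nL R} \<Longrightarrow> radius \<le> a1 R * nu R i"
proof -
  let ?S = "insert (\<alpha> / 4) ((\<lambda>j. a0 R * mu R j) ` {1..nK R} \<union> (\<lambda>i. a1 R * nu R i) ` {1..nL R})"
  have fin: "finite ?S" by simp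
  have "\<forall>x\<in>?S. x > 0" using discount_rate_pos a_pos mu_pos nu_pos by auto
  then show "radius > 0" unfolding radius_def by (subst Min_gr_iff[OF fin]) auto
  have "radius \<le> x" if "x \<in> ?S" for x unfolding radius_def by (rule Min_le[OF fin that])
  then show "radius \<le> \<alpha> / 4" "j \<in> {1..nK R} \<Longrightarrow> radius \<le> a0 R * mu R j" "i \<in> {1..nL R} \<Longrightarrow> radius \<le> a1 R * nu R i"
    by blast+
qed

text \<open>The denominator is at least m - a m / (1 + a) = m / (1 + a). The admissible size a m is
  chosen so that the resulting 1 + a is just the divisor in \<open>chi0_hat\<close> or
  \<open>chi1_hat\<close>; it is the origin of the products in \<open>radius\<close>.\<close>

lemma factor_bound:
  fixes m a :: real
  assumes "a > 0" "m > 0" "norm s \<le> a * m"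
  shows "norm (of_real m / (of_real m - s / of_real (1 + a)) :: complex) \<le> 1 + a"
proof -
  have "norm (s / of_real (1 + a)) \<le> (a * m) / (1 + a)"
    using assms unfolding norm_divide by (intro frac_le) (auto simp del: of_real_add)
  then have "norm (of_real m - s / of_real (1 + a) :: complex) \<ge> m - (a * m) / (1 + a)"
    using norm_triangle_ineq2[of "of_real m :: complex" "s / of_real (1 + a)"] assms by simp
  moreover have "m - (a * m) / (1 + a) = m / (1 + a)" using assms by (simp add: field_simps)
  ultimately have "norm (of_real m / (of_real m - s / of_real (1 + a)) :: complex) \<le> m / (m / (1 + a))"
    unfolding norm_divide using assms by (intro frac_le) auto
  then show ?thesis using assms by simp
qed

lemma mixture_factor_bound:
  fixes p r :: "nat \<Rightarrow> real" and t :: "nat \<Rightarrow> complex"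
  assumes "a > 0" "\<And>j. j \<in> {1..n} \<Longrightarrow> p j \<ge> 0" "(\<Sum>j=1..n. p j) = 1" "\<And>j. j \<in> {1..n} \<Longrightarrow> r j > 0"
    "\<And>j. j \<in> {1..n} \<Longrightarrow> norm s \<le> a * r j" "\<And>j. j \<in> {1..n} \<Longrightarrow> norm (t j) \<le> D"
  shows "norm (\<Sum>j=1..n. of_real (p j) * (of_real (r j) / (of_real (r j) - s / of_real (1 + a))) * t j) \<le> (1 + a) * D"
proof -
  have "norm (\<Sum>j=1..n. of_real (p j) * (of_real (r j) / (of_real (r j) - s / of_real (1 + a))) * t j) \<le> (\<Sum>j=1..n. p j * ((1 + a) * D))"
  proof (rule order_trans[OF norm_sum sum_mono])
    fix j assume j: "j \<in> {1..n}"
    have "norm (of_real (r j) / (of_real (r j) - s / of_real (1 + a))) * norm (t j) \<le> (1 + a) * D"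
      using assms(1) assms(6)[OF j] by (intro mult_mono factor_bound assms(4,5)[OF j]) auto
    then have "p j * (norm (of_real (r j) / (of_real (r j) - s / of_real (1 + a))) * norm (t j)) \<le> p j * ((1 + a) * D)"
      by (intro mult_left_mono assms(2)[OF j])
    then show "norm (of_real (p j) * (of_real (r j) / (of_real (r j) - s / of_real (1 + a))) * t j) \<le> p j * ((1 + a) * D)"
      using assms(2)[OF j] by (simp only: norm_mult norm_of_real abs_of_nonneg mult.assoc)
  qed
  also have "\<dots> = (1 + a) * D" using assms(3) by (simp flip: sum_distrib_right)
  finally show ?thesis .
qed

definition core :: "complex set" where
  "core = half \<inter> ball 0 radius"

lemma core_scaled:
  assumes "s \<in> core"
  shows "down0 s \<in> core" "down1 s \<in> core"
proof -
  have "norm s / growth \<le> norm s / 1" using growth_gt_1 by (intro divide_left_mono) auto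
  then show "down0 s \<in> core" "down1 s \<in> core"
    using assms half_scaled[of s] norm_scaled_le[of s] by (auto simp: core_def)
qed

text \<open>The factors 1 + a of the mixture bounds cancel the divisors of \<open>chi0_hat\<close>
  and \<open>chi1_hat\<close>, so the joint bound on \<open>chi0\<close> and \<open>chi1\<close>
  carries over to the coefficients.\<close>

lemma step_coefficients_bound:
  assumes "s \<in> core"
  shows "norm (L10 R \<alpha> s) + norm (L01 R \<alpha> s) \<le> rho"
proof -
  have s: "s \<in> half" "norm s \<le> radius" using assms by (auto simp: core_def)
  have "norm (\<Sum>j=1..nK R. of_real (wq R j) * (of_real (mu R j) / (of_real (mu R j) - down0 s)) * 1) \<le> (1 + a0 R) * 1"
    by (rule mixture_factor_bound) (use a_pos wq_nonneg wq_sum mu_pos radius(3) s(2) in \<open>auto intro: order_trans\<close>)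
  then have "norm (L10 R \<alpha> s) \<le> norm (hat0 s) * (1 + a0 R)"
    unfolding L10_def norm_mult by (intro mult_left_mono) auto
  also have "\<dots> = norm (chi0 R (s + of_real \<alpha>))"
    using a_pos by (simp add: chi0_hat_def norm_divide del: of_real_add)
  finally have 0: "norm (L10 R \<alpha> s) \<le> norm (chi0 R (s + of_real \<alpha>))" .
  have "norm (\<Sum>i=1..nL R. of_real (wh R i) * (of_real (nu R i) / (of_real (nu R i) - down1 s)) * 1) \<le> (1 + a1 R) * 1"
    by (rule mixture_factor_bound) (use a_pos wh_nonneg wh_sum nu_pos radius(4) s(2) in \<open>auto intro: order_trans\<close>)
  then have "norm (L01 R \<alpha> s) \<le> norm (hat1 s) * (1 + a1 R)"
    unfolding L01_def norm_mult by (intro mult_left_mono) auto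
  also have "\<dots> = norm (chi1 R (s + of_real \<alpha>))"
    using a_pos by (simp add: chi1_hat_def norm_divide del: of_real_add)
  finally have "norm (L01 R \<alpha> s) \<le> norm (chi1 R (s + of_real \<alpha>))" .
  with 0 chi_bound_half(1)[OF s(1)] show ?thesis by linarith
qed

lemma step_op_iterate_core:
  assumes \<Phi>: "\<And>z. z \<in> core \<Longrightarrow> norm (\<Phi> z) \<le> C" and s: "s \<in> core"
  shows "norm ((step_op ^^ n) \<Phi> s) \<le> rho ^ n * C"
  using s
proof (induction n arbitrary: s)
  case (Suc n)
  have C: "0 \<le> rho ^ n * C" using rho order_trans[OF norm_ge_zero \<Phi>[OF Suc.prems]] by simp
  note ih = Suc.IH[OF core_scaled(1)[OF Suc.prems]] Suc.IH[OF core_scaled(2)[OF Suc.prems]]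
  have "norm ((step_op ^^ Suc n) \<Phi> s) \<le> norm (L10 R \<alpha> s) * (rho ^ n * C) + norm (L01 R \<alpha> s) * (rho ^ n * C)"
    unfolding funpow.simps comp_def step_op_def[of "(step_op ^^ n) \<Phi>"]
    by (intro norm_triangle_le add_mono) (auto simp only: norm_mult intro!: mult_left_mono ih norm_ge_zero)
  also have "\<dots> \<le> rho * (rho ^ n * C)"
    using mult_right_mono[OF step_coefficients_bound[OF Suc.prems] C] by (simp add: distrib_right)
  finally show ?case by (simp add: mult.assoc)
qed (use \<Phi> in auto)

text \<open>Each scaling shrinks the modulus at least by the factor \<open>growth\<close>, so
  finitely many scalings lead from any point of \<open>half\<close> into
  \<open>core\<close>.\<close>

lemma half_induct [consumes 1, case_names core scaled]:
  assumes "s \<in> half" and core: "\<And>s. s \<in> core \<Longrightarrow> P s"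
    and scaled: "\<And>s. s \<in> half \<Longrightarrow> P (down0 s) \<Longrightarrow> P (down1 s) \<Longrightarrow> P s"
  shows "P s"
proof -
  have *: "P s" if "s \<in> half" "norm s < radius * growth ^ n" for n s
    using that
  proof (induction n arbitrary: s)
    case 0
    then show ?case by (intro core) (simp add: core_def)
  next
    case (Suc n)
    have "norm s / growth < radius * growth ^ n" using Suc.prems(2) growth_gt_1 by (simp add: field_simps)
    then have n: "norm (down0 s) < radius * growth ^ n" "norm (down1 s) < radius * growth ^ n"
      using norm_scaled_le[of s] by linarith+
    note h = half_scaled[OF Suc.prems(1)]
    show ?case by (rule scaled[OF Suc.prems(1) Suc.IH[OF h(1) n(1)] Suc.IH[OF h(2) n(2)]])
  qed
  obtain n where "norm s / radius < growth ^ n" using real_arch_pow[OF growth_gt_1] by blast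
  then have "norm s < radius * growth ^ n" using radius(1) by (simp add: field_simps)
  then show ?thesis using * assms(1) by blast
qed

text \<open>Outside \<open>core\<close> only finitely many coefficients intervene, and finite
  factors do not affect summability. Points of \<open>sing R\<close> are included: at a pole a
  coefficient is still a number, by the convention \<open>x / 0 = 0\<close>.\<close>

lemma step_op_iterate_summable:
  assumes \<Phi>: "\<And>z. z \<in> core \<Longrightarrow> norm (\<Phi> z) \<le> C" and s: "s \<in> half"
  shows "summable (\<lambda>n. norm ((step_op ^^ n) \<Phi> s))"
  using s
proof (induction rule: half_induct)
  case (core s)
  have "summable (\<lambda>n. rho ^ n * C)" using rho by (intro summable_mult2 summable_geometric) auto
  then show ?case
    by (rule summable_comparison_test') (use step_op_iterate_core[OF \<Phi> core] in auto)
next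
  case (scaled s)
  have "summable (\<lambda>n. norm (L10 R \<alpha> s) * norm ((step_op ^^ n) \<Phi> (down0 s))
      + norm (L01 R \<alpha> s) * norm ((step_op ^^ n) \<Phi> (down1 s)))"
    by (intro summable_add summable_mult scaled)
  then have "summable (\<lambda>n. norm ((step_op ^^ Suc n) \<Phi> s))"
  proof (rule summable_comparison_test')
    show "norm (norm ((step_op ^^ Suc n) \<Phi> s)) \<le> norm (L10 R \<alpha> s) * norm ((step_op ^^ n) \<Phi> (down0 s))
      + norm (L01 R \<alpha> s) * norm ((step_op ^^ n) \<Phi> (down1 s))" for n
      using norm_triangle_ineq[of "L10 R \<alpha> s * (step_op ^^ n) \<Phi> (down0 s)" "L01 R \<alpha> s * (step_op ^^ n) \<Phi> (down1 s)"]
      by (simp add: step_op_def[of "(step_op ^^ n) \<Phi>"] norm_mult)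
  qed
  then show ?case by (subst (asm) summable_Suc_iff[of "\<lambda>n. norm ((step_op ^^ n) \<Phi> s)"])
qed

lemma corr_bound: "\<exists>C. \<forall>s\<in>core. norm (corr u v s) \<le> C"
proof -
  define U where "U = (\<Sum>j=1..nK R. norm (u j)) + (\<Sum>i=1..nL R. norm (v i))"
  have "norm (corr u v s) \<le> U + U" if s: "s \<in> core" for s
  proof -
    have s': "s \<in> half" "norm s \<le> radius" using s by (auto simp: core_def)
    have nn: "(\<Sum>j=1..nK R. norm (u j)) \<ge> 0" "(\<Sum>i=1..nL R. norm (v i)) \<ge> 0" by (auto intro: sum_nonneg)
    have u: "norm (u j) \<le> U" if "j \<in> {1..nK R}" for j
      using member_le_sum[OF that, of "\<lambda>j. norm (u j)"] nn by (simp add: U_def)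
    have v: "norm (v i) \<le> U" if "i \<in> {1..nL R}" for i
      using member_le_sum[OF that, of "\<lambda>j. norm (v j)"] nn by (simp add: U_def)
    have U: "U \<ge> 0" using nn by (simp add: U_def)
    have m0: "norm (\<Sum>j=1..nK R. of_real (wq R j) * (of_real (mu R j) / (of_real (mu R j) - down0 s)) * u j) \<le> (1 + a0 R) * U"
      by (rule mixture_factor_bound) (use a_pos wq_nonneg wq_sum mu_pos radius(3) s'(2) u in \<open>auto intro: order_trans\<close>)
    have m1: "norm (\<Sum>i=1..nL R. of_real (wh R i) * (of_real (nu R i) / (of_real (nu R i) - down1 s)) * v i) \<le> (1 + a1 R) * U"
      by (rule mixture_factor_bound) (use a_pos wh_nonneg wh_sum nu_pos radius(4) s'(2) v in \<open>auto intro: order_trans\<close>)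
    have "norm (hat0 s) * ((1 + a0 R) * U) = norm (chi0 R (s + of_real \<alpha>)) * U"
      using a_pos by (simp add: chi0_hat_def norm_divide del: of_real_add)
    also have "\<dots> \<le> 1 * U" using chi_bound_half(2)[OF s'(1)] U by (rule mult_right_mono)
    finally have c0: "norm (hat0 s) * ((1 + a0 R) * U) \<le> U" by simp
    have "norm (hat1 s) * ((1 + a1 R) * U) = norm (chi1 R (s + of_real \<alpha>)) * U"
      using a_pos by (simp add: chi1_hat_def norm_divide del: of_real_add)
    also have "\<dots> \<le> 1 * U" using chi_bound_half(3)[OF s'(1)] U by (rule mult_right_mono)
    finally have c1: "norm (hat1 s) * ((1 + a1 R) * U) \<le> U" by simp
    show ?thesis
      unfolding corr_def
    proof (intro norm_triangle_le add_mono)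
      show "norm (hat0 s * (\<Sum>j=1..nK R. of_real (wq R j) * (of_real (mu R j) / (of_real (mu R j) - down0 s)) * u j)) \<le> U"
        unfolding norm_mult[of "hat0 s"] by (rule order_trans[OF mult_left_mono[OF m0 norm_ge_zero] c0])
      show "norm (hat1 s * (\<Sum>i=1..nL R. of_real (wh R i) * (of_real (nu R i) / (of_real (nu R i) - down1 s)) * v i)) \<le> U"
        unfolding norm_mult[of "hat1 s"] by (rule order_trans[OF mult_left_mono[OF m1 norm_ge_zero] c1])
    qed
  qed
  then show ?thesis by blast
qed

lemma Ktil_bound: "\<exists>C. \<forall>s\<in>core. norm (Ktil R \<alpha> u v s) \<le> C"
proof -
  obtain C where C: "\<And>s. s \<in> core \<Longrightarrow> norm (corr u v s) \<le> C" using corr_bound by blast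
  \<comment> \<open>The numerator 1 - phi has norm at most 2, its denominator norm at least \<alpha>
    / 2.\<close>
  have "norm (Ktil R \<alpha> u v s) \<le> 4 / \<alpha> + C" if s: "s \<in> core" for s
  proof -
    have re: "Re (s + of_real \<alpha>) \<ge> \<alpha> / 2" using s by (simp add: core_def half_def)
    have "norm (phi R (s + of_real \<alpha>)) \<le> (\<integral>w. 1 \<partial>base R)"
      unfolding phi_def
    proof (rule order_trans[OF integral_norm_bound], rule integral_mono)
      have r0: "Re (s + of_real \<alpha>) \<ge> 0" using re discount_rate_pos by linarith
      show le: "norm (exp (- ((s + of_real \<alpha>) * of_real (gapB R 0 w)))) \<le> 1" if "w \<in> space (base R)" for w
        using mult_nonneg_nonneg[OF r0, of "gapB R 0 w"] gap_pos[OF that, of 0] by simp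
      show "integrable (base R) (\<lambda>w. norm (exp (- ((s + of_real \<alpha>) * of_real (gapB R 0 w)))))"
        using le by (intro integrable_norm integrable_const_bound[of _ 1] AE_I2) auto
    qed auto
    then have "norm (phi R (s + of_real \<alpha>)) \<le> 1" by (simp add: prob_space)
    then have n: "norm (1 - phi R (s + of_real \<alpha>)) \<le> 2"
      using norm_triangle_ineq4[of 1 "phi R (s + of_real \<alpha>)"] by simp
    have d: "norm (s + of_real \<alpha>) \<ge> \<alpha> / 2" using re complex_Re_le_cmod[of "s + of_real \<alpha>"] by linarith
    have "norm ((1 - phi R (s + of_real \<alpha>)) / (s + of_real \<alpha>)) \<le> 2 / (\<alpha> / 2)"
      unfolding norm_divide using n d discount_rate_pos by (intro frac_le) auto
    then show ?thesis
      unfolding Ktil_eq using C[OF s] norm_triangle_ineq4[of "(1 - phi R (s + of_real \<alpha>)) / (s + of_real \<alpha>)" "corr u v s"]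
      by simp
  qed
  then show ?thesis by blast
qed

section \<open>Convergence of the series and its identification with the transform of the expected
  discount\<close>

lemma Ldiag_tendsto_0: "s \<in> half \<Longrightarrow> Ldiag R \<alpha> s \<longlonglongrightarrow> 0"
proof -
  assume s: "s \<in> half"
  have "summable (\<lambda>n. norm ((step_op ^^ n) (\<lambda>_. 1) s))"
    by (rule step_op_iterate_summable[of _ 1]) (use s in auto)
  then have "(\<lambda>n. norm (Ldiag R \<alpha> s n)) \<longlonglongrightarrow> 0"
    unfolding Ldiag_eq by (rule summable_LIMSEQ_zero)
  then show ?thesis by (rule tendsto_norm_zero_cancel)
qed

lemma LKdiag_summable: "s \<in> half \<Longrightarrow> summable (LKdiag R \<alpha> u v s)"
proof -
  assume s: "s \<in> half"
  obtain C where "\<And>z. z \<in> core \<Longrightarrow> norm (Ktil R \<alpha> u v z) \<le> C" using Ktil_bound by blast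
  from step_op_iterate_summable[OF this s] show ?thesis
    unfolding LKdiag_eq[abs_def] by (rule summable_norm_cancel)
qed

lemma tau_series_eq: "s \<in> half \<Longrightarrow> tau_series R \<alpha> u v s = (\<Sum>n. (step_op ^^ n) (Ktil R \<alpha> u v) s)"
  unfolding tau_series_def using limI[OF Ldiag_tendsto_0] by (simp add: LKdiag_eq[abs_def])

lemma tau_series_functional_equation:
  assumes s: "s \<in> half"
  shows "tau_series R \<alpha> u v s = Ktil R \<alpha> u v s + step_op (tau_series R \<alpha> u v) s"
proof -
  let ?T = "\<lambda>n. (step_op ^^ n) (Ktil R \<alpha> u v)"
  have sums: "(\<lambda>n. ?T n z) sums tau_series R \<alpha> u v z" if "z \<in> half" for z
    using LKdiag_summable[OF that, of u v] unfolding tau_series_eq[OF that] LKdiag_eq[abs_def] by (rule summable_sums)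
  have "(\<lambda>n. ?T (Suc n) s) sums step_op (tau_series R \<alpha> u v) s"
    unfolding funpow.simps comp_def step_op_def[of "(step_op ^^ _) _"] step_op_def[of "tau_series R \<alpha> u v"]
    by (intro sums_add sums_mult sums half_scaled s)
  then have "(\<lambda>n. ?T n s) sums (step_op (tau_series R \<alpha> u v) s + ?T 0 s)"
    by (subst (asm) sums_Suc_iff) simp
  from sums_unique2[OF sums[OF s] this] show ?thesis by simp
qed

lemma ruin_lt_measurable: "ruin_lt \<in> borel_measurable borel"
  unfolding ruin_lt_def[abs_def] by (intro borel_measurable_suminf trans_op_iterate(1)[OF psi_measurable psi_bounded])

lemma ruin_lt_bounded: "norm (ruin_lt x) \<le> (\<Sum>n. rho ^ n * 1)"
  unfolding ruin_lt_def
  by (rule order_trans[OF summable_norm suminf_le])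
     (use rho iterates_summable(1)[OF psi_measurable psi_bounded] trans_op_iterate(2)[OF psi_measurable psi_bounded] in
       \<open>auto intro!: summable_geometric\<close>)

lemma tau_tendsto: "Re s > 0 \<Longrightarrow> (tau R \<alpha> \<longlongrightarrow> tau R \<alpha> s) (at s)"
  unfolding tau_eq_laplace[abs_def] by (rule laplace_tendsto[OF ruin_lt_measurable ruin_lt_bounded])

lemma tau_bound: "s \<in> half \<Longrightarrow> norm (tau R \<alpha> s) \<le> 2 / \<alpha>"
proof -
  assume s: "s \<in> half"
  have "norm (laplace ruin_lt s) \<le> 1 / (Re s + \<alpha>)"
    by (rule laplace_integrable(2)[OF ruin_lt_measurable]) (use expected_discount(2) s discount_rate_pos in \<open>auto simp: half_def\<close>)
  also have "\<dots> \<le> 1 / (\<alpha> / 2)" using s discount_rate_pos by (intro divide_left_mono) (auto simp: half_def intro!: mult_pos_pos)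
  finally show ?thesis by (simp add: tau_eq_laplace)
qed

text \<open>After n uses of the functional equation the remainder is T^n applied to
  \<open>tau\<close>. It tends to 0 because \<open>tau\<close> is bounded on \<open>core\<close>,
  including the part of \<open>core\<close> left of the imaginary axis.\<close>

lemma tau_eq_tau_series:
  assumes s: "Re s > 0" "s \<notin> sing R"
  shows "tau R \<alpha> s = tau_series R \<alpha> (\<lambda>j. tau R \<alpha> (of_real (mu R j))) (\<lambda>i. tau R \<alpha> (of_real (nu R i))) s"
proof -
  let ?K = "Ktil R \<alpha> (\<lambda>j. tau R \<alpha> (of_real (mu R j))) (\<lambda>i. tau R \<alpha> (of_real (nu R i)))"
  have rem: "tau R \<alpha> s - (\<Sum>i<n. (step_op ^^ i) ?K s) = (step_op ^^ n) (tau R \<alpha>) s" for n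
    using s
  proof (induction n arbitrary: s)
    case (Suc n)
    have sc: "Re (down0 s) > 0" "Re (down1 s) > 0"
      using Suc.prems(1) a_pos by (simp_all add: Re_divide_of_real del: of_real_add)
    note nsc = not_sing_scaled(1,2)[OF Suc.prems(2)]
    have "(step_op ^^ Suc n) (tau R \<alpha>) s = step_op (tau R \<alpha>) s - (\<Sum>i<n. (step_op ^^ Suc i) ?K s)"
      unfolding funpow.simps comp_def step_op_def[of "(step_op ^^ n) _"] Suc.IH[OF sc(1) nsc(1), symmetric] Suc.IH[OF sc(2) nsc(2), symmetric]
      unfolding step_op_def by (simp add: algebra_simps sum_distrib_left sum.distrib)
    also have "step_op (tau R \<alpha>) s = tau R \<alpha> s - ?K s"
      using tau_functional_equation[OF Suc.prems] by simp
    finally show ?case by (simp only: sum.lessThan_Suc_shift) simp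
  qed simp
  have h: "s \<in> half" using s discount_rate_pos by (simp add: half_def)
  have "summable (\<lambda>n. norm ((step_op ^^ n) (tau R \<alpha>) s))"
    by (rule step_op_iterate_summable[OF _ h]) (use tau_bound in \<open>auto simp: core_def\<close>)
  then have "(\<lambda>n. (step_op ^^ n) (tau R \<alpha>) s) \<longlonglongrightarrow> 0"
    by (rule tendsto_norm_zero_cancel[OF summable_LIMSEQ_zero])
  then have "(\<lambda>n. tau R \<alpha> s - (\<Sum>i<n. (step_op ^^ i) ?K s)) \<longlonglongrightarrow> 0" unfolding rem .
  moreover have "(\<lambda>n. tau R \<alpha> s - (\<Sum>i<n. (step_op ^^ i) ?K s)) \<longlonglongrightarrow> tau R \<alpha> s - (\<Sum>n. (step_op ^^ n) ?K s)"
    using LKdiag_summable[OF h] unfolding LKdiag_eq[abs_def] by (intro tendsto_intros summable_LIMSEQ)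
  ultimately have "tau R \<alpha> s - (\<Sum>n. (step_op ^^ n) ?K s) = 0" by (rule LIMSEQ_unique[symmetric])
  then show ?thesis using tau_series_eq[OF h] by simp
qed

section \<open>Holomorphy near 0 and the exceptional set\<close>

lemma core_open: "open core" and half_open: "open half"
  unfolding core_def half_def by (auto intro!: open_Int open_halfspace_Re_gt)

lemma chi_holomorphic:
  "(\<lambda>s. hat0 s) holomorphic_on half" "(\<lambda>s. hat1 s) holomorphic_on half"
  "(\<lambda>s. phi R (s + of_real \<alpha>)) holomorphic_on half"
proof -
  have t: "(\<lambda>s. F (s + of_real \<alpha>)) holomorphic_on half" if "F holomorphic_on {s. Re s > 0}" for F
  proof -
    have "(F \<circ> (\<lambda>s. s + of_real \<alpha>)) holomorphic_on half"
      by (rule holomorphic_on_compose_gen[OF _ that])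
         (use discount_rate_pos in \<open>auto intro!: holomorphic_intros simp: half_def\<close>)
    then show ?thesis by (simp add: comp_def)
  qed
  have "chi0 R holomorphic_on {s. Re s > 0}"
    unfolding chi0_def[abs_def] by (rule exp_transform_holomorphic) (auto intro: gap_pos)
  moreover have "chi1 R holomorphic_on {s. Re s > 0}"
    unfolding chi1_def[abs_def] by (rule exp_transform_holomorphic) (auto intro: gap_pos)
  ultimately show "(\<lambda>s. hat0 s) holomorphic_on half" "(\<lambda>s. hat1 s) holomorphic_on half"
    unfolding chi0_hat_def chi1_hat_def using a_pos
    by (auto intro!: holomorphic_intros t simp del: of_real_add)
  have "(\<lambda>s. \<integral>w. exp (- (s * of_real (gapB R 0 w))) * 1 \<partial>base R) holomorphic_on {s. Re s > 0}"
    by (rule exp_transform_holomorphic) (auto intro: gap_pos)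
  then have "phi R holomorphic_on {s. Re s > 0}"
    by (simp add: phi_def[abs_def])
  then show "(\<lambda>s. phi R (s + of_real \<alpha>)) holomorphic_on half" by (rule t)
qed

lemma core_pole_free:
  assumes "s \<in> core"
  shows "j \<in> {1..nK R} \<Longrightarrow> of_real (mu R j) - down0 s \<noteq> 0"
    and "i \<in> {1..nL R} \<Longrightarrow> of_real (nu R i) - down1 s \<noteq> 0"
proof -
  have ne: "of_real m - s / of_real (1 + a) \<noteq> 0" if "m > 0" "a > 0" "norm s < a * m" for m a :: real
  proof
    assume "of_real m - s / of_real (1 + a) = 0"
    then have "norm (of_real m :: complex) = norm (s / of_real (1 + a))" by simp
    then have "m * (1 + a) = norm s" using that by (simp add: norm_divide field_simps del: of_real_add)
    then show False using that by (simp add: algebra_simps)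
  qed
  have n: "norm s < radius" using assms by (simp add: core_def)
  show "of_real (mu R j) - down0 s \<noteq> 0" if "j \<in> {1..nK R}"
    using radius(3)[OF that] n by (intro ne mu_pos that a_pos) linarith
  show "of_real (nu R i) - down1 s \<noteq> 0" if "i \<in> {1..nL R}"
    using radius(4)[OF that] n by (intro ne nu_pos that a_pos) linarith
qed

lemma core_holomorphic:
  "L10 R \<alpha> holomorphic_on core" "L01 R \<alpha> holomorphic_on core" "Ktil R \<alpha> u v holomorphic_on core"
proof -
  have sub: "core \<subseteq> half" by (auto simp: core_def)
  note chi = chi_holomorphic[THEN holomorphic_on_subset, OF sub]
  have c: "complex_of_real (1 + a0 R) \<noteq> 0" "complex_of_real (1 + a1 R) \<noteq> 0"
    using a_pos by (simp_all only: of_real_eq_0_iff)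
  have nz: "s + of_real \<alpha> \<noteq> 0" if "s \<in> core" for s
  proof
    assume "s + of_real \<alpha> = 0"
    then have "Re (s + of_real \<alpha>) = 0" by (simp only: zero_complex.sel)
    then show False using that discount_rate_pos by (simp add: core_def half_def)
  qed
  show "L10 R \<alpha> holomorphic_on core" "L01 R \<alpha> holomorphic_on core" "Ktil R \<alpha> u v holomorphic_on core"
    unfolding L10_def[abs_def] L01_def[abs_def] Ktil_def[abs_def]
    using core_pole_free nz c by (intro holomorphic_intros chi; blast)+
qed

lemma step_op_holomorphic:
  assumes "\<Phi> holomorphic_on core"
  shows "step_op \<Phi> holomorphic_on core"
proof -
  have c: "complex_of_real (1 + a0 R) \<noteq> 0" "complex_of_real (1 + a1 R) \<noteq> 0"
    using a_pos by (simp_all only: of_real_eq_0_iff)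
  have "(\<Phi> \<circ> (\<lambda>s. down0 s)) holomorphic_on core"
    by (rule holomorphic_on_compose_gen[OF _ assms]) (use c core_scaled in \<open>auto intro!: holomorphic_intros simp del: of_real_add\<close>)
  moreover have "(\<Phi> \<circ> (\<lambda>s. down1 s)) holomorphic_on core"
    by (rule holomorphic_on_compose_gen[OF _ assms]) (use c core_scaled in \<open>auto intro!: holomorphic_intros simp del: of_real_add\<close>)
  ultimately show ?thesis
    unfolding step_op_def[abs_def] comp_def by (intro holomorphic_intros core_holomorphic)
qed

text \<open>On \<open>core\<close> the terms have no poles and a common geometric majorant.
  Holomorphy is proved only here; farther out it has to come from the functional equation.\<close>

lemma tau_series_holomorphic_core: "tau_series R \<alpha> u v holomorphic_on core"
proof -
  obtain C where C: "\<And>z. z \<in> core \<Longrightarrow> norm (Ktil R \<alpha> u v z) \<le> C" using Ktil_bound by blast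
  let ?T = "\<lambda>n. (step_op ^^ n) (Ktil R \<alpha> u v)"
  have hol: "?T n holomorphic_on core" for n
    by (induction n) (auto intro: core_holomorphic step_op_holomorphic)
  have unif: "uniform_limit core (\<lambda>n s. \<Sum>i<n. ?T i s) (\<lambda>s. \<Sum>i. ?T i s) sequentially"
    by (rule Weierstrass_m_test[of _ _ "\<lambda>n. rho ^ n * C"])
       (use step_op_iterate_core[OF C] rho in \<open>auto intro!: summable_mult2 summable_geometric\<close>)
  have "(\<lambda>s. \<Sum>i. ?T i s) holomorphic_on core"
  proof (rule holomorphic_uniform_sequence[OF core_open])
    show "(\<lambda>s. \<Sum>i<n. ?T i s) holomorphic_on core" for n by (intro holomorphic_intros hol)
    fix x assume "x \<in> core"
    then obtain d where d: "d > 0" "cball x d \<subseteq> core" using core_open open_contains_cball by blast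
    then show "\<exists>d>0. cball x d \<subseteq> core \<and> uniform_limit (cball x d) (\<lambda>n s. \<Sum>i<n. ?T i s) (\<lambda>s. \<Sum>i. ?T i s) sequentially"
      using uniform_limit_on_subset[OF unif] by blast
  qed
  then show ?thesis
    by (rule holomorphic_transform) (simp add: tau_series_eq core_def)
qed

text \<open>Every exceptional point is a rate times a product of dilation factors, each at least
  \<open>growth\<close>; with rates bounded below, a bounded disc admits only boundedly many
  factors.\<close>

lemma sing_bounded_finite: "finite (sing R \<inter> cball 0 r)"
proof -
  \<comment> \<open>\<open>radius\<close> is at most each product a0 mu and a1 nu, so this quotient
    is a positive lower bound for all rates.\<close>
  define d where "d = radius / max (a0 R) (a1 R)"
  have d: "d > 0" using radius(1) a_pos by (simp add: d_def)
  have mx: "max (a0 R) (a1 R) > 0" using a_pos by simp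
  have mu_ge: "d \<le> mu R j" if "j \<in> {1..nK R}" for j
  proof -
    have "radius \<le> max (a0 R) (a1 R) * mu R j"
      using mu_pos[OF that] by (intro order_trans[OF radius(3)[OF that]] mult_right_mono) auto
    then show ?thesis unfolding d_def using mx by (simp add: pos_divide_le_eq mult.commute)
  qed
  have nu_ge: "d \<le> nu R i" if "i \<in> {1..nL R}" for i
  proof -
    have "radius \<le> max (a0 R) (a1 R) * nu R i"
      using nu_pos[OF that] by (intro order_trans[OF radius(4)[OF that]] mult_right_mono) auto
    then show ?thesis unfolding d_def using mx by (simp add: pos_divide_le_eq mult.commute)
  qed
  obtain N where N: "r / d < growth ^ N" using real_arch_pow[OF growth_gt_1] by blast
  have small: "l < N \<and> m < N" if le: "norm (complex_of_real (x * (1 + a0 R) ^ l * (1 + a1 R) ^ m)) \<le> r" and x: "d \<le> x" for l m x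
  proof -
    have g: "growth \<le> 1 + a0 R" "growth \<le> 1 + a1 R" "growth \<ge> 0" using growth_gt_1 by (auto simp: growth_def)
    have "d * (growth ^ l * growth ^ m) \<le> x * ((1 + a0 R) ^ l * (1 + a1 R) ^ m)"
      using g x d a_pos by (intro mult_mono power_mono) auto
    also have "\<dots> = norm (complex_of_real (x * (1 + a0 R) ^ l * (1 + a1 R) ^ m))"
      unfolding norm_of_real using x d a_pos by (subst abs_of_nonneg) (auto simp: mult.assoc)
    also have "\<dots> < d * growth ^ N" using le N d by (simp add: pos_divide_less_eq mult.commute)
    finally have "growth ^ (l + m) < growth ^ N" using d by (simp add: power_add)
    then have "l + m < N" using growth_gt_1 by (simp add: power_strict_increasing_iff)
    then show ?thesis by simp
  qed
  let ?f = "\<lambda>(j, l, m). complex_of_real (mu R j * (1 + a0 R) ^ l * (1 + a1 R) ^ m)"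
  let ?g = "\<lambda>(i, l, m). complex_of_real (nu R i * (1 + a0 R) ^ l * (1 + a1 R) ^ m)"
  have "sing R \<inter> cball 0 r \<subseteq> ?f ` ({1..nK R} \<times> {..<N} \<times> {..<N}) \<union> ?g ` ({1..nL R} \<times> {..<N} \<times> {..<N})"
  proof
    fix z assume "z \<in> sing R \<inter> cball 0 r"
    then have z: "z \<in> sing R" "norm z \<le> r" by auto
    from z(1) consider j l m where "j \<in> {1..nK R}" "z = of_real (mu R j * (1 + a0 R) ^ (l + 1) * (1 + a1 R) ^ m)"
      | i l m where "i \<in> {1..nL R}" "z = of_real (nu R i * (1 + a0 R) ^ l * (1 + a1 R) ^ (m + 1))"
      unfolding sing_def by blast
    then show "z \<in> ?f ` ({1..nK R} \<times> {..<N} \<times> {..<N}) \<union> ?g ` ({1..nL R} \<times> {..<N} \<times> {..<N})"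
    proof cases
      case 1
      have "l + 1 < N \<and> m < N" using small[of "mu R j" "l + 1" m] z(2) 1(2) mu_ge[OF 1(1)] by simp
      then have "z \<in> ?f ` ({1..nK R} \<times> {..<N} \<times> {..<N})"
        using 1 by (intro image_eqI[of _ _ "(j, l + 1, m)"]) auto
      then show ?thesis by blast
    next
      case 2
      have "l < N \<and> m + 1 < N" using small[of "nu R i" l "m + 1"] z(2) 2(2) nu_ge[OF 2(1)] by simp
      then have "z \<in> ?g ` ({1..nL R} \<times> {..<N} \<times> {..<N})"
        using 2 by (intro image_eqI[of _ _ "(i, l, m + 1)"]) auto
      then show ?thesis by blast
    qed
  qed
  then show ?thesis by (rule finite_subset) auto
qed

lemma eventually_not_sing: "eventually (\<lambda>z. z \<notin> sing R) (at s)"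
proof -
  let ?F = "sing R \<inter> cball 0 (norm s + 1) - {s}"
  have "finite ?F" using sing_bounded_finite by blast
  then have "open (ball 0 (norm s + 1) - ?F)" by (intro open_Diff finite_imp_closed) auto
  then have "eventually (\<lambda>z. z \<in> ball 0 (norm s + 1) - ?F) (at s)"
    by (rule eventually_at_in_open') auto
  moreover have "eventually (\<lambda>z. z \<noteq> s) (at s)" by (rule eventually_neq_at_within)
  ultimately show ?thesis by eventually_elim auto
qed

text \<open>\<open>sing R\<close> is locally finite, so agreement off it is agreement in a punctured
  neighbourhood of every point.\<close>

lemma Lim_off_sing:
  assumes S: "open S" "s \<in> S" and eq: "\<And>z. z \<in> S \<Longrightarrow> z \<notin> sing R \<Longrightarrow> h z = G z" and h: "(h \<longlongrightarrow> h s) (at s)"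
  shows "(G \<longlongrightarrow> h s) (at s)" "Lim (at s) G = h s"
proof -
  have "eventually (\<lambda>z. h z = G z) (at s)"
    using eventually_at_in_open'[OF S] eventually_not_sing[of s] by eventually_elim (rule eq)
  then show "(G \<longlongrightarrow> h s) (at s)" by (rule Lim_transform_eventually[OF h])
  then show "Lim (at s) G = h s" by (intro tendsto_Lim) auto
qed

abbreviation tau_mu :: "nat \<Rightarrow> complex" where "tau_mu \<equiv> \<lambda>j. tau R \<alpha> (of_real (mu R j))"
abbreviation tau_nu :: "nat \<Rightarrow> complex" where "tau_nu \<equiv> \<lambda>i. tau R \<alpha> (of_real (nu R i))"

text \<open>With the true values as parameters the singularities of the series in the right
  half-plane are removable, because the series agrees there, off \<open>sing R\<close>, with a
  continuous transform.\<close>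

lemma tau_series_tendsto:
  assumes "Re s > 0"
  shows "(tau_series R \<alpha> tau_mu tau_nu \<longlongrightarrow> tau R \<alpha> s) (at s)"
  by (rule Lim_off_sing(1)[of "{z. Re z > 0}"])
     (use assms in \<open>auto simp: open_halfspace_Re_gt tau_eq_tau_series intro: tau_tendsto\<close>)

lemma takes_value_tau: "Re s > 0 \<Longrightarrow> takes_value (sing R) (tau_series R \<alpha> tau_mu tau_nu) s (tau R \<alpha> s)"
  unfolding takes_value_def using tau_series_tendsto tau_eq_tau_series by auto

lemma tau_series_cong:
  assumes "\<And>j. j \<in> {1..nK R} \<Longrightarrow> u j = u' j" "\<And>i. i \<in> {1..nL R} \<Longrightarrow> v i = v' i"
  shows "tau_series R \<alpha> u v = tau_series R \<alpha> u' v'"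
proof -
  have "Ktil R \<alpha> u v = Ktil R \<alpha> u' v'"
    unfolding Ktil_def[abs_def] using assms by (auto intro!: ext sum.cong arg_cong2[of _ _ _ _ "(-)"] arg_cong2[of _ _ _ _ "(*)"])
  then show ?thesis unfolding tau_series_def[abs_def] LKdiag_def[abs_def] by simp
qed

lemma solves_system_tau:
  assumes "\<And>j. j \<in> {1..nK R} \<Longrightarrow> u j = tau_mu j" "\<And>i. i \<in> {1..nL R} \<Longrightarrow> v i = tau_nu i"
  shows "solves_system R \<alpha> u v"
proof -
  have "tau_series R \<alpha> u v = tau_series R \<alpha> tau_mu tau_nu" by (rule tau_series_cong) (use assms in auto)
  then show ?thesis
    unfolding solves_system_def using assms mu_pos nu_pos by (auto intro!: takes_value_tau)
qed

end

section \<open>Uniqueness of the solution of the linear system\<close>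

locale linear_system_solution = discounted_risk_model R \<alpha> for R :: "'w dual_risk" and \<alpha> :: real +
  fixes u v :: "nat \<Rightarrow> complex"
  assumes solution: "solves_system R \<alpha> u v"
begin

definition G :: "complex \<Rightarrow> complex" where
  "G s = tau_series R \<alpha> u v s - tau_series R \<alpha> tau_mu tau_nu s"

definition d :: "nat \<Rightarrow> complex" where "d j = u j - tau_mu j"
definition e :: "nat \<Rightarrow> complex" where "e i = v i - tau_nu i"

text \<open>The part of \<open>Ktil\<close> containing \<open>phi\<close> does not depend on the
  parameters and cancels, which leaves an equation linear in \<open>G\<close>, \<open>d\<close> and
  \<open>e\<close>.\<close>

lemma G_functional_equation: "s \<in> half \<Longrightarrow> G s = step_op G s - corr d e s"
proof -
  assume s: "s \<in> half"
  have "corr d e s = corr u v s - corr tau_mu tau_nu s"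
    unfolding corr_def d_def e_def by (simp add: right_diff_distrib sum_subtractf)
  moreover have "step_op G s = step_op (tau_series R \<alpha> u v) s - step_op (tau_series R \<alpha> tau_mu tau_nu) s"
    by (simp add: step_op_def G_def right_diff_distrib)
  moreover have "G s = (Ktil R \<alpha> u v s + step_op (tau_series R \<alpha> u v) s)
      - (Ktil R \<alpha> tau_mu tau_nu s + step_op (tau_series R \<alpha> tau_mu tau_nu) s)"
    unfolding tau_series_functional_equation[OF s, symmetric] by (rule G_def)
  ultimately show ?thesis by (simp add: Ktil_eq)
qed

text \<open>The right-hand side of the equation for \<open>G\<close> with its two parts recombined
  into divided differences. It takes values at the scaled points only, and removable singularities
  of it are already filled in.\<close>

definition extension_step :: "(complex \<Rightarrow> complex) \<Rightarrow> complex \<Rightarrow> complex" where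
  "extension_step h s =
     hat0 s * (\<Sum>j=1..nK R. of_real (wq R j) *
       (of_real (mu R j) * divided_diff h (d j) (of_real (mu R j)) (down0 s)))
     + hat1 s * (\<Sum>i=1..nL R. of_real (wh R i) *
       (of_real (nu R i) * divided_diff h (e i) (of_real (nu R i)) (down1 s)))"

lemma extension_step_eq_G:
  assumes s: "s \<in> half" "s \<notin> sing R"
    and h: "h (down0 s) = G (down0 s)" "h (down1 s) = G (down1 s)"
  shows "extension_step h s = G s"
proof -
  have e0: "of_real (mu R j) * divided_diff h (d j) (of_real (mu R j)) (down0 s)
     = of_real (mu R j) / (of_real (mu R j) - down0 s) * (G (down0 s) - d j)" if "j \<in> {1..nK R}" for j
    using not_sing_scaled(3)[OF s(2) that] h by (simp add: divided_diff_def)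
  have e1: "of_real (nu R i) * divided_diff h (e i) (of_real (nu R i)) (down1 s)
     = of_real (nu R i) / (of_real (nu R i) - down1 s) * (G (down1 s) - e i)" if "i \<in> {1..nL R}" for i
    using not_sing_scaled(4)[OF s(2) that] h by (simp add: divided_diff_def)
  have s0: "(\<Sum>j=1..nK R. of_real (wq R j) * (of_real (mu R j) * divided_diff h (d j) (of_real (mu R j)) (down0 s)))
    = (\<Sum>j=1..nK R. of_real (wq R j) * (of_real (mu R j) / (of_real (mu R j) - down0 s))) * G (down0 s)
      - (\<Sum>j=1..nK R. of_real (wq R j) * (of_real (mu R j) / (of_real (mu R j) - down0 s)) * d j)"
    unfolding sum_distrib_right sum_subtractf[symmetric] by (intro sum.cong refl) (simp only: e0 right_diff_distrib mult.assoc)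
  have s1: "(\<Sum>i=1..nL R. of_real (wh R i) * (of_real (nu R i) * divided_diff h (e i) (of_real (nu R i)) (down1 s)))
    = (\<Sum>i=1..nL R. of_real (wh R i) * (of_real (nu R i) / (of_real (nu R i) - down1 s))) * G (down1 s)
      - (\<Sum>i=1..nL R. of_real (wh R i) * (of_real (nu R i) / (of_real (nu R i) - down1 s)) * e i)"
    unfolding sum_distrib_right sum_subtractf[symmetric] by (intro sum.cong refl) (simp only: e1 right_diff_distrib mult.assoc)
  show ?thesis
    unfolding G_functional_equation[OF s(1)] extension_step_def s0 s1 step_op_def corr_def L10_def L01_def
    by (simp only: right_diff_distrib mult.assoc) simp
qed

section \<open>Analytic continuation of the difference of two series\<close>

lemma takes_value_diff:
  assumes "takes_value (sing R) (tau_series R \<alpha> u v) s c" "Re s > 0"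
    and S: "open S" "s \<in> S" and eq: "\<And>z. z \<in> S \<Longrightarrow> z \<notin> sing R \<Longrightarrow> h z = G z" and h: "h holomorphic_on S"
  shows "h s = c - tau R \<alpha> s"
proof (cases "s \<in> sing R")
  case False
  then show ?thesis using assms tau_eq_tau_series[of s] by (simp add: takes_value_def G_def)
next
  case True
  then have "(tau_series R \<alpha> u v \<longlongrightarrow> c) (at s)" using assms(1) by (simp add: takes_value_def)
  then have l: "(G \<longlongrightarrow> c - tau R \<alpha> s) (at s)"
    unfolding G_def[abs_def] by (intro tendsto_diff tau_series_tendsto assms)
  have "(h \<longlongrightarrow> h s) (at s)"
    using holomorphic_on_imp_continuous_on[OF h] S by (simp add: continuous_on_eq_continuous_at isCont_def)
  from Lim_off_sing(1)[OF S eq this] have "(G \<longlongrightarrow> h s) (at s)" .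
  from tendsto_unique[OF at_neq_bot this l] show ?thesis .
qed

text \<open>This is where the linear system enters: each of its equations fixes the value of a
  continuation at one rate, as a plain value or as a limit, and this is the matching condition of
  \<open>divided_diff_holomorphic\<close>.\<close>

lemma extension_value:
  assumes S: "open S" and eq: "\<And>z. z \<in> S \<Longrightarrow> z \<notin> sing R \<Longrightarrow> h z = G z" and h: "h holomorphic_on S"
  shows "j \<in> {1..nK R} \<Longrightarrow> of_real (mu R j) \<in> S \<Longrightarrow> h (of_real (mu R j)) = d j"
    and "i \<in> {1..nL R} \<Longrightarrow> of_real (nu R i) \<in> S \<Longrightarrow> h (of_real (nu R i)) = e i"
proof -
  show "h (of_real (mu R j)) = d j" if "j \<in> {1..nK R}" "of_real (mu R j) \<in> S"
    unfolding d_def using solution that mu_pos[OF that(1)]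
    by (intro takes_value_diff[OF _ _ S _ eq h]) (auto simp: solves_system_def)
  show "h (of_real (nu R i)) = e i" if "i \<in> {1..nL R}" "of_real (nu R i) \<in> S"
    unfolding e_def using solution that nu_pos[OF that(1)]
    by (intro takes_value_diff[OF _ _ S _ eq h]) (auto simp: solves_system_def)
qed

lemma extension_step_holomorphic:
  assumes S: "open S" and eq: "\<And>z. z \<in> S \<Longrightarrow> z \<notin> sing R \<Longrightarrow> h z = G z" and h: "h holomorphic_on S"
    and S': "S' \<subseteq> half" "\<And>s. s \<in> S' \<Longrightarrow> down0 s \<in> S" "\<And>s. s \<in> S' \<Longrightarrow> down1 s \<in> S"
  shows "extension_step h holomorphic_on S'"
proof -
  have c: "complex_of_real (1 + a0 R) \<noteq> 0" "complex_of_real (1 + a1 R) \<noteq> 0"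
    using a_pos by (simp_all only: of_real_eq_0_iff)
  have l0: "(\<lambda>s. down0 s) holomorphic_on S'" by (intro holomorphic_intros c)
  have l1: "(\<lambda>s. down1 s) holomorphic_on S'" by (intro holomorphic_intros c)
  have h0: "(\<lambda>s. divided_diff h (d j) (of_real (mu R j)) (down0 s)) holomorphic_on S'" if "j \<in> {1..nK R}" for j
    using holomorphic_on_compose_gen[OF l0 divided_diff_holomorphic[OF h S]] extension_value(1)[OF S eq h that] S'(2)
    by (auto simp: comp_def)
  have h1: "(\<lambda>s. divided_diff h (e i) (of_real (nu R i)) (down1 s)) holomorphic_on S'" if "i \<in> {1..nL R}" for i
    using holomorphic_on_compose_gen[OF l1 divided_diff_holomorphic[OF h S]] extension_value(2)[OF S eq h that] S'(3)
    by (auto simp: comp_def)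
  show ?thesis
    unfolding extension_step_def[abs_def]
    by (intro holomorphic_intros h0 h1 chi_holomorphic[THEN holomorphic_on_subset, OF S'(1)])
qed

text \<open>\<open>extension_step\<close> looks at scaled points only, so it enlarges the disc by
  the factor \<open>growth\<close>. New poles could arise only from rates inside the old disc, where
  the system has already fixed the values.\<close>

lemma extension_exists:
  "\<exists>h. h holomorphic_on (half \<inter> ball 0 (radius * growth ^ n)) \<and>
     (\<forall>s\<in>half \<inter> ball 0 (radius * growth ^ n). s \<notin> sing R \<longrightarrow> h s = G s)"
proof (induction n)
  case 0
  have "G holomorphic_on core"
    unfolding G_def[abs_def] by (intro holomorphic_intros tau_series_holomorphic_core)
  then show ?case by (intro exI[of _ G]) (simp add: core_def)
next
  case (Suc n)
  let ?S = "half \<inter> ball 0 (radius * growth ^ n)" and ?S' = "half \<inter> ball 0 (radius * growth ^ Suc n)"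
  obtain h where h: "h holomorphic_on ?S" "\<And>s. s \<in> ?S \<Longrightarrow> s \<notin> sing R \<Longrightarrow> h s = G s" using Suc by blast
  have sc: "down0 s \<in> ?S" "down1 s \<in> ?S" if "s \<in> ?S'" for s
  proof -
    have "norm s / growth < radius * growth ^ n" using that growth_gt_1 by (simp add: field_simps)
    then have "norm (down0 s) < radius * growth ^ n" "norm (down1 s) < radius * growth ^ n"
      using norm_scaled_le[of s] by linarith+
    then show "down0 s \<in> ?S" "down1 s \<in> ?S"
      using half_scaled[of s] that by (simp_all del: of_real_add)
  qed
  have "extension_step h holomorphic_on ?S'"
    by (rule extension_step_holomorphic[OF _ h(2) h(1)]) (use half_open sc in \<open>auto simp del: of_real_add\<close>)
  moreover have "extension_step h s = G s" if "s \<in> ?S'" "s \<notin> sing R" for s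
    using that by (intro extension_step_eq_G h(2) sc not_sing_scaled) auto
  ultimately show ?case by blast
qed

text \<open>As a limit of \<open>G\<close> this does not depend on a disc or on a chosen
  continuation, so the local continuations glue without further argument.\<close>

definition Gext :: "complex \<Rightarrow> complex" where
  "Gext s = Lim (at s) G"

lemma Gext_eq:
  assumes "open S" "s \<in> S" "\<And>z. z \<in> S \<Longrightarrow> z \<notin> sing R \<Longrightarrow> h z = G z" "(h \<longlongrightarrow> h s) (at s)"
  shows "Gext s = h s"
  unfolding Gext_def by (rule Lim_off_sing(2)[OF assms])

lemma Gext_holomorphic: "Gext holomorphic_on half"
  and Gext_eq_G: "s \<in> half \<Longrightarrow> s \<notin> sing R \<Longrightarrow> Gext s = G s"
proof -
  let ?S = "\<lambda>n. half \<inter> ball 0 (radius * growth ^ n)"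
  have op: "open (?S n)" for n using half_open by auto
  have loc: "\<exists>h. h holomorphic_on ?S n \<and> (\<forall>s\<in>?S n. s \<notin> sing R \<longrightarrow> h s = G s) \<and> (\<forall>s\<in>?S n. Gext s = h s)" for n
  proof -
    obtain h where h: "h holomorphic_on ?S n" "\<And>s. s \<in> ?S n \<Longrightarrow> s \<notin> sing R \<Longrightarrow> h s = G s" using extension_exists by blast
    have "Gext s = h s" if "s \<in> ?S n" for s
      using holomorphic_on_imp_continuous_on[OF h(1)] op that
      by (intro Gext_eq[OF op that h(2)]) (auto simp: continuous_on_eq_continuous_at isCont_def)
    then show ?thesis using h by blast
  qed
  have cover: "\<exists>n. s \<in> ?S n" if "s \<in> half" for s
  proof -
    obtain n where "norm s / radius < growth ^ n" using real_arch_pow[OF growth_gt_1] by blast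
    then have "norm s < radius * growth ^ n" using radius(1) by (simp add: field_simps)
    then show ?thesis using that by auto
  qed
  have "Gext holomorphic_on ?S n" for n
    using loc[of n] holomorphic_transform by metis
  then have "Gext holomorphic_on (\<Union>n. ?S n)" by (intro holomorphic_on_UN_open op)
  moreover have "half = (\<Union>n. ?S n)" using cover by auto
  ultimately show "Gext holomorphic_on half" by simp
  show "Gext s = G s" if "s \<in> half" "s \<notin> sing R"
    using cover[OF that(1)] loc that(2) by metis
qed

section \<open>Functional equation and decay of the continuation\<close>

lemma positive_in_half: "x > 0 \<Longrightarrow> of_real x \<in> half"
  using discount_rate_pos by (simp add: half_def)

lemma Gext_value:
  "j \<in> {1..nK R} \<Longrightarrow> Gext (of_real (mu R j)) = d j" "i \<in> {1..nL R} \<Longrightarrow> Gext (of_real (nu R i)) = e i"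
  by (rule extension_value[OF half_open Gext_eq_G Gext_holomorphic]; simp add: positive_in_half mu_pos nu_pos)+

text \<open>Both sides are holomorphic and agree with \<open>G\<close> off \<open>sing R\<close>; by
  continuity they also agree at the exceptional points.\<close>

lemma Gext_functional_equation:
  assumes s: "s \<in> half"
  shows "Gext s = extension_step Gext s"
proof (rule Gext_eq[OF half_open s])
  show "extension_step Gext z = G z" if "z \<in> half" "z \<notin> sing R" for z
    using that by (intro extension_step_eq_G Gext_eq_G half_scaled not_sing_scaled)
  have "extension_step Gext holomorphic_on half"
    by (rule extension_step_holomorphic[OF half_open Gext_eq_G Gext_holomorphic]) (auto intro: half_scaled simp del: of_real_add)
  from holomorphic_on_imp_continuous_on[OF this] show "(extension_step Gext \<longlongrightarrow> extension_step Gext s) (at s)"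
    using half_open s by (auto simp: continuous_on_eq_continuous_at isCont_def)
qed

text \<open>Boundedness comes first, spreading from a disc by the functional equation: far out, the
  value at s is dominated by the values at the two scaled points times a small factor. Inserting the
  bound into the functional equation once more yields the factor 1 / norm s.\<close>

lemma Gext_decay: "\<exists>C r. r \<ge> 1 \<and> (\<forall>s. Re s \<ge> 0 \<longrightarrow> norm s \<ge> r \<longrightarrow> norm (Gext s) \<le> C / norm s)"
proof -
  define W where "W = (\<Sum>j=1..nK R. mu R j) + (\<Sum>i=1..nL R. nu R i)"
  define D where "D = (\<Sum>j=1..nK R. norm (d j)) + (\<Sum>i=1..nL R. norm (e i))"
  have nn: "(\<Sum>j=1..nK R. mu R j) \<ge> 0" "(\<Sum>i=1..nL R. nu R i) \<ge> 0"
    "(\<Sum>j=1..nK R. norm (d j)) \<ge> 0" "(\<Sum>i=1..nL R. norm (e i)) \<ge> 0"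
    by (intro sum_nonneg; simp add: less_imp_le mu_pos nu_pos)+
  have W: "W \<ge> 0" and D: "D \<ge> 0" using nn by (auto simp: W_def D_def)
  have muW: "0 < mu R j \<and> mu R j \<le> W" if "j \<in> {1..nK R}" for j
  proof -
    have "mu R j \<le> (\<Sum>l=1..nK R. mu R l)"
      by (rule member_le_sum[OF that]) (rule less_imp_le[OF mu_pos], auto)
    then show ?thesis using nn mu_pos[OF that] by (simp add: W_def)
  qed
  have nuW: "0 < nu R i \<and> nu R i \<le> W" if "i \<in> {1..nL R}" for i
  proof -
    have "nu R i \<le> (\<Sum>l=1..nL R. nu R l)"
      by (rule member_le_sum[OF that]) (rule less_imp_le[OF nu_pos], auto)
    then show ?thesis using nn nu_pos[OF that] by (simp add: W_def)
  qed
  have dD: "norm (d j) \<le> D" if "j \<in> {1..nK R}" for j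
    using member_le_sum[OF that, of "\<lambda>j. norm (d j)"] nn by (auto simp: D_def)
  have eD: "norm (e i) \<le> D" if "i \<in> {1..nL R}" for i
    using member_le_sum[OF that, of "\<lambda>i. norm (e i)"] nn by (auto simp: D_def)
  \<comment> \<open>Beyond 2 W (1 + a0) and 2 W (1 + a1) the scaled points have modulus at least 2
    W, as \<open>mixture_divided_diff_bound\<close> requires; 8 W makes the factor 2 W / norm s at
    most 1 / 4.\<close>
  define r where "r = Max {1, 2 * W * (1 + a0 R), 2 * W * (1 + a1 R), 8 * W}"
  have r: "r \<ge> 1" "r \<ge> 2 * W * (1 + a0 R)" "r \<ge> 2 * W * (1 + a1 R)" "r \<ge> 8 * W" by (auto simp: r_def)
  have step: "norm (Gext s) \<le> 2 * W * (norm (Gext (down0 s)) + D) / norm s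
      + 2 * W * (norm (Gext (down1 s)) + D) / norm s" if s: "Re s \<ge> 0" "norm s \<ge> r" for s
  proof -
    have h: "s \<in> half" using s discount_rate_pos by (simp add: half_def)
    have ns: "norm s > 0" using s r by linarith
    have n0: "norm (down0 s) = norm s / (1 + a0 R)" "norm (down1 s) = norm s / (1 + a1 R)"
      using a_pos by (simp_all add: norm_divide del: of_real_add)
    have z0: "norm (down0 s) \<ge> 2 * W" "norm (down1 s) \<ge> 2 * W"
      "norm (down0 s) > 0" "norm (down1 s) > 0"
      unfolding n0 using s r ns a_pos by (auto simp: pos_le_divide_eq)
    have b0: "norm (hat0 s) \<le> 1 / (1 + a0 R)" "norm (hat1 s) \<le> 1 / (1 + a1 R)"
      using chi_bound_half(2,3)[OF h] a_pos by (auto simp: chi0_hat_def chi1_hat_def norm_divide divide_right_mono simp del: of_real_add)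
    let ?X = "\<lambda>x. 2 * W * (norm (Gext x) + D) / norm x"
    let ?m0 = "\<Sum>j=1..nK R. of_real (wq R j) * (of_real (mu R j) * divided_diff Gext (d j) (of_real (mu R j)) (down0 s))"
    let ?m1 = "\<Sum>i=1..nL R. of_real (wh R i) * (of_real (nu R i) * divided_diff Gext (e i) (of_real (nu R i)) (down1 s))"
    have "norm (hat0 s * ?m0) \<le> 1 / (1 + a0 R) * ?X (down0 s)"
      unfolding norm_mult[of "hat0 s"]
      by (intro mult_mono b0 mixture_divided_diff_bound wq_nonneg wq_sum muW dD z0) (use a_pos in auto)
    also have "\<dots> = 2 * W * (norm (Gext (down0 s)) + D) / norm s"
      unfolding n0 using a_pos by simp
    finally have t0: "norm (hat0 s * ?m0) \<le> \<dots>" .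
    have "norm (hat1 s * ?m1) \<le> 1 / (1 + a1 R) * ?X (down1 s)"
      unfolding norm_mult[of "hat1 s"]
      by (intro mult_mono b0 mixture_divided_diff_bound wh_nonneg wh_sum nuW eD z0) (use a_pos in auto)
    also have "\<dots> = 2 * W * (norm (Gext (down1 s)) + D) / norm s"
      unfolding n0 using a_pos by simp
    finally have t1: "norm (hat1 s * ?m1) \<le> \<dots>" .
    show ?thesis
      unfolding Gext_functional_equation[OF h] extension_step_def[of Gext s]
      by (rule order_trans[OF norm_triangle_ineq add_mono[OF t0 t1]])
  qed
  have "compact ({z. Re z \<ge> 0} \<inter> cball 0 r)"
    by (intro closed_Int_compact closed_halfspace_Re_ge) auto
  then have "compact (Gext ` ({z. Re z \<ge> 0} \<inter> cball 0 r))"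
    using discount_rate_pos
    by (intro compact_continuous_image continuous_on_subset[OF holomorphic_on_imp_continuous_on[OF Gext_holomorphic]]) (auto simp: half_def)
  from compact_imp_bounded[OF this] obtain M0 where M0: "\<forall>y\<in>Gext ` ({z. Re z \<ge> 0} \<inter> cball 0 r). norm y \<le> M0"
    unfolding bounded_iff ..
  \<comment> \<open>With M at least D, each of the two terms in \<open>step\<close> is at most (M +
    M) / 4, so the bound M reproduces itself.\<close>
  define M where "M = max M0 D"
  have near: "norm (Gext s) \<le> M" if "Re s \<ge> 0" "norm s \<le> r" for s
  proof -
    have "norm (Gext s) \<le> M0" using M0 that by auto
    then show ?thesis by (simp add: M_def)
  qed
  have bound: "norm (Gext s) \<le> M" if "Re s \<ge> 0" "norm s \<le> r * growth ^ n" for s n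
    using that
  proof (induction n arbitrary: s)
    case 0
    then show ?case by (intro near) auto
  next
    case (Suc n)
    show ?case
    proof (cases "norm s \<le> r")
      case True
      then show ?thesis using Suc.prems by (intro near) auto
    next
      case False
      have "norm s / growth \<le> r * growth ^ n" using Suc.prems(2) growth_gt_1 by (simp add: field_simps)
      then have n: "norm (down0 s) \<le> r * growth ^ n" "norm (down1 s) \<le> r * growth ^ n"
        using norm_scaled_le[of s] by linarith+
      have re: "Re (down0 s) \<ge> 0" "Re (down1 s) \<ge> 0"
        using Suc.prems(1) a_pos by (simp_all add: Re_divide_of_real del: of_real_add)
      have q: "2 * W * (x + D) / norm s \<le> M / 2" if x: "x \<le> M" "x \<ge> 0" for x
      proof -
        have "2 * W * (x + D) \<le> (norm s / 4) * (M + M)"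
          using False r x D W by (intro mult_mono) (auto simp: M_def)
        then have "2 * W * (x + D) \<le> M / 2 * norm s" by simp
        moreover have "0 < norm s" using False r by linarith
        ultimately show ?thesis by (simp only: pos_divide_le_eq)
      qed
      show ?thesis
        using step[OF Suc.prems(1)] False q[OF Suc.IH[OF re(1) n(1)] norm_ge_zero] q[OF Suc.IH[OF re(2) n(2)] norm_ge_zero] by linarith
    qed
  qed
  have M: "norm (Gext s) \<le> M" if "Re s \<ge> 0" for s
  proof -
    obtain n where "norm s / r < growth ^ n" using real_arch_pow[OF growth_gt_1] by blast
    then have "norm s \<le> r * growth ^ n" using r by (simp add: field_simps)
    then show ?thesis using bound that by blast
  qed
  have "norm (Gext s) \<le> (2 * W * (M + D) + 2 * W * (M + D)) / norm s" if s: "Re s \<ge> 0" "norm s \<ge> r" for s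
  proof -
    have re: "Re (down0 s) \<ge> 0" "Re (down1 s) \<ge> 0"
      using s a_pos by (simp_all add: Re_divide_of_real del: of_real_add)
    show ?thesis
      unfolding add_divide_distrib
      by (rule order_trans[OF step[OF s]], intro add_mono divide_right_mono mult_left_mono M re) (use W in auto)
  qed
  with r(1) show ?thesis by blast
qed

text \<open>Decay of order 1 / norm s is too weak for an absolutely convergent inversion integral of
  \<open>Gext\<close>. Its divided differences are inverted instead, by
  \<open>divided_diff_is_laplace\<close>; passing the mixtures through \<open>kern\<close> gives a
  function whose transform is the right-hand side of the functional equation.\<close>

lemma Gext_is_laplace:
  "\<exists>g C. g \<in> borel_measurable borel \<and> (\<forall>x. norm (g x) \<le> C) \<and> (\<forall>s. Re s > 0 \<longrightarrow> laplace g s = Gext s)"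
proof -
  obtain C r where r: "r \<ge> 1" and far: "\<And>s. Re s \<ge> 0 \<Longrightarrow> norm s \<ge> r \<Longrightarrow> norm (Gext s) \<le> C / norm s"
    using Gext_decay by blast
  have hol: "Gext holomorphic_on {s. Re s > - (\<alpha> / 2)}" using Gext_holomorphic by (simp add: half_def)
  have a2: "\<alpha> / 2 > 0" using discount_rate_pos by simp
  have "\<exists>g D. g \<in> borel_measurable borel \<and> (\<forall>x. norm (g x) \<le> D) \<and>
      (\<forall>z. Re z > 0 \<longrightarrow> laplace g z = of_real (mu R j) * divided_diff Gext (d j) (of_real (mu R j)) z)" if "j \<in> {1..nK R}" for j
    by (rule divided_diff_is_laplace[OF hol a2 mu_pos[OF that] Gext_value(1)[OF that] far r])
  then obtain \<gamma>0 D0 where g0: "\<And>j. j \<in> {1..nK R} \<Longrightarrow> \<gamma>0 j \<in> borel_measurable borel" "\<And>j x. j \<in> {1..nK R} \<Longrightarrow> norm (\<gamma>0 j x) \<le> D0 j"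
    "\<And>j z. j \<in> {1..nK R} \<Longrightarrow> Re z > 0 \<Longrightarrow> laplace (\<gamma>0 j) z = of_real (mu R j) * divided_diff Gext (d j) (of_real (mu R j)) z"
    by metis
  have "\<exists>g D. g \<in> borel_measurable borel \<and> (\<forall>x. norm (g x) \<le> D) \<and>
      (\<forall>z. Re z > 0 \<longrightarrow> laplace g z = of_real (nu R i) * divided_diff Gext (e i) (of_real (nu R i)) z)" if "i \<in> {1..nL R}" for i
    by (rule divided_diff_is_laplace[OF hol a2 nu_pos[OF that] Gext_value(2)[OF that] far r])
  then obtain \<gamma>1 D1 where g1: "\<And>i. i \<in> {1..nL R} \<Longrightarrow> \<gamma>1 i \<in> borel_measurable borel" "\<And>i x. i \<in> {1..nL R} \<Longrightarrow> norm (\<gamma>1 i x) \<le> D1 i"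
    "\<And>i z. i \<in> {1..nL R} \<Longrightarrow> Re z > 0 \<Longrightarrow> laplace (\<gamma>1 i) z = of_real (nu R i) * divided_diff Gext (e i) (of_real (nu R i)) z"
    by metis
  define k0 where "k0 x = (\<Sum>j=1..nK R. of_real (wq R j) * \<gamma>0 j x)" for x
  define k1 where "k1 x = (\<Sum>i=1..nL R. of_real (wh R i) * \<gamma>1 i x)" for x
  have m0: "k0 \<in> borel_measurable borel" and m1: "k1 \<in> borel_measurable borel"
    unfolding k0_def[abs_def] k1_def[abs_def] using g0(1) g1(1) by auto
  have b0: "norm (k0 x) \<le> (\<Sum>j=1..nK R. wq R j * D0 j)" for x
    unfolding k0_def by (rule order_trans[OF norm_sum sum_mono]) (use g0(2) wq_nonneg in \<open>auto simp: norm_mult intro!: mult_left_mono\<close>)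
  have b1: "norm (k1 x) \<le> (\<Sum>i=1..nL R. wh R i * D1 i)" for x
    unfolding k1_def by (rule order_trans[OF norm_sum sum_mono]) (use g1(2) wh_nonneg in \<open>auto simp: norm_mult intro!: mult_left_mono\<close>)
  have l0: "laplace k0 z = (\<Sum>j=1..nK R. of_real (wq R j) * (of_real (mu R j) * divided_diff Gext (d j) (of_real (mu R j)) z))" if "Re z > 0" for z
    unfolding k0_def[abs_def] using g0(3) that by (subst laplace_sum[OF g0(1,2) that]) auto
  have l1: "laplace k1 z = (\<Sum>i=1..nL R. of_real (wh R i) * (of_real (nu R i) * divided_diff Gext (e i) (of_real (nu R i)) z))" if "Re z > 0" for z
    unfolding k1_def[abs_def] using g1(3) that by (subst laplace_sum[OF g1(1,2) that]) auto
  define g where "g y = kern J0 (1 + a0 R) k0 y + kern J1 (1 + a1 R) k1 y" for y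
  have [measurable]: "k0 \<in> borel_measurable borel" "k1 \<in> borel_measurable borel" by (fact m0 m1)+
  have gm: "g \<in> borel_measurable borel" unfolding g_def[abs_def] by measurable
  have kb0: "norm (kern J0 (1 + a0 R) k0 y) \<le> (\<Sum>j=1..nK R. wq R j * D0 j)" for y
    by (rule kern_bounded[OF m0 _ b0]) auto
  have kb1: "norm (kern J1 (1 + a1 R) k1 y) \<le> (\<Sum>i=1..nL R. wh R i * D1 i)" for y
    by (rule kern_bounded[OF m1 _ b1]) auto
  have gb: "norm (g y) \<le> (\<Sum>j=1..nK R. wq R j * D0 j) + (\<Sum>i=1..nL R. wh R i * D1 i)" for y
    unfolding g_def by (intro norm_triangle_le add_mono kb0 kb1)
  have "laplace g s = Gext s" if s: "Re s > 0" for s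
  proof -
    have h: "s \<in> half" using s discount_rate_pos by (simp add: half_def)
    have re: "Re (down0 s) > 0" "Re (down1 s) > 0"
      using s a_pos by (simp_all add: Re_divide_of_real del: of_real_add)
    have "laplace g s = laplace (kern J0 (1 + a0 R) k0) s + laplace (kern J1 (1 + a1 R) k1) s"
      unfolding g_def[abs_def] by (rule laplace_add[OF _ kb0 _ kb1 s]) auto
    also have "laplace (kern J0 (1 + a0 R) k0) s = hat0 s * laplace k0 (down0 s)"
      using a_pos unfolding chi0_hat_def chi0_def by (intro laplace_kern[OF m0 _ b0 _ s]) auto
    also have "laplace (kern J1 (1 + a1 R) k1) s = hat1 s * laplace k1 (down1 s)"
      using a_pos unfolding chi1_hat_def chi1_def by (intro laplace_kern[OF m1 _ b1 _ s]) auto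
    finally show ?thesis
      unfolding Gext_functional_equation[OF h] extension_step_def l0[OF re(1)] l1[OF re(2)] .
  qed
  then show ?thesis using gm gb by blast
qed

text \<open>If a function has transform \<open>Gext\<close>, the values of that transform at the
  rates are \<open>d\<close> and \<open>e\<close>, so \<open>laplace_trans_op_eq\<close> for it is
  the equation for \<open>G\<close>, and applying P preserves the transform; exceptional points
  follow by continuity. Only transforms are compared, so g = P g is never claimed, while the bound
  improves by \<open>rho\<close> at each step.\<close>

lemma Gext_is_small_laplace:
  "\<exists>C. \<forall>n. \<exists>g. g \<in> borel_measurable borel \<and> (\<forall>x. norm (g x) \<le> rho ^ n * C) \<and> (\<forall>s. Re s > 0 \<longrightarrow> laplace g s = Gext s)"
proof -
  obtain g C where g: "g \<in> borel_measurable borel" "\<And>x. norm (g x) \<le> C" "\<And>s. Re s > 0 \<Longrightarrow> laplace g s = Gext s"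
    using Gext_is_laplace by blast
  have "\<forall>s. Re s > 0 \<longrightarrow> laplace ((trans_op ^^ n) g) s = Gext s" for n
  proof (induction n)
    case 0
    then show ?case using g(3) by simp
  next
    case (Suc n)
    let ?g = "(trans_op ^^ n) g"
    note it = trans_op_iterate[OF g(1,2), of n]
    note it' = trans_op_iterate[OF g(1,2), of "Suc n"]
    have off: "laplace (trans_op ?g) s = G s" if s: "Re s > 0" "s \<notin> sing R" for s
    proof -
      have h: "s \<in> half" using s discount_rate_pos by (simp add: half_def)
      have re: "Re (down0 s) > 0" "Re (down1 s) > 0"
        using s a_pos by (simp_all add: Re_divide_of_real del: of_real_add)
      have "corr (\<lambda>j. laplace ?g (of_real (mu R j))) (\<lambda>i. laplace ?g (of_real (nu R i))) s = corr d e s"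
      proof -
        have lm: "laplace ?g (of_real (mu R j)) = d j" if "j \<in> {1..nK R}" for j
          using Suc Gext_value(1)[OF that] mu_pos[OF that] by simp
        have ln: "laplace ?g (of_real (nu R i)) = e i" if "i \<in> {1..nL R}" for i
          using Suc Gext_value(2)[OF that] nu_pos[OF that] by simp
        show ?thesis unfolding corr_def by (simp only: lm ln cong: sum.cong)
      qed
      moreover have "step_op (laplace ?g) s = step_op G s"
        unfolding step_op_def using Suc re Gext_eq_G[OF half_scaled(1)[OF h] not_sing_scaled(1)[OF s(2)]]
          Gext_eq_G[OF half_scaled(2)[OF h] not_sing_scaled(2)[OF s(2)]] by simp
      ultimately show ?thesis
        using laplace_trans_op_eq[OF it s] G_functional_equation[OF h] by simp
    qed
    have "Gext s = laplace (trans_op ?g) s" if s: "Re s > 0" for s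
      by (rule Gext_eq[of "{z. Re z > 0}"])
         (use s off laplace_tendsto[OF it' s] in \<open>auto simp: open_halfspace_Re_gt\<close>)
    then show ?case by simp
  qed
  then show ?thesis using trans_op_iterate[OF g(1,2)] by blast
qed

lemma Gext_eq_0:
  assumes s: "Re s > 0"
  shows "Gext s = 0"
proof -
  obtain C where C: "\<And>n. \<exists>g. g \<in> borel_measurable borel \<and> (\<forall>x. norm (g x) \<le> rho ^ n * C) \<and> (\<forall>s. Re s > 0 \<longrightarrow> laplace g s = Gext s)"
    using Gext_is_small_laplace by blast
  have "norm (Gext s) \<le> rho ^ n * C / Re s" for n
  proof -
    obtain g where g: "g \<in> borel_measurable borel" "\<And>x. norm (g x) \<le> rho ^ n * C" "laplace g s = Gext s"
      using C[of n] s by blast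
    show ?thesis using laplace_bounded(2)[OF g(1,2) s] g(3) by simp
  qed
  moreover have "(\<lambda>n. rho ^ n * C / Re s) \<longlonglongrightarrow> 0 * C / Re s"
    using rho by (intro tendsto_intros LIMSEQ_power_zero) (use s in auto)
  ultimately have "norm (Gext s) \<le> 0"
    by (intro LIMSEQ_le_const[of "\<lambda>n. rho ^ n * C / Re s"]) auto
  then show ?thesis by simp
qed

lemma solution_unique:
  "j \<in> {1..nK R} \<Longrightarrow> u j = tau R \<alpha> (of_real (mu R j))" "i \<in> {1..nL R} \<Longrightarrow> v i = tau R \<alpha> (of_real (nu R i))"
  using Gext_value Gext_eq_0 mu_pos nu_pos by (simp_all add: d_def e_def)

end

theorem mainTheorem5:
  fixes R :: "'w dual_risk" and \<alpha> :: real
  assumes "dual_risk_model R" and "\<alpha> > 0"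
  shows "(\<forall>s. Re s > 0 \<and> s \<notin> sing R \<longrightarrow>
            convergent (Ldiag R \<alpha> s) \<and>
            summable (LKdiag R \<alpha> (\<lambda>j. tau R \<alpha> (of_real (mu R j))) (\<lambda>i. tau R \<alpha> (of_real (nu R i))) s) \<and>
            tau R \<alpha> s =
              tau_series R \<alpha> (\<lambda>j. tau R \<alpha> (of_real (mu R j))) (\<lambda>i. tau R \<alpha> (of_real (nu R i))) s) \<and>
         (\<forall>u v. solves_system R \<alpha> u v \<longleftrightarrow>
            (\<forall>j\<in>{1..nK R}. u j = tau R \<alpha> (of_real (mu R j))) \<and>
            (\<forall>i\<in>{1..nL R}. v i = tau R \<alpha> (of_real (nu R i))))"
proof -
  interpret discounted_risk_model R \<alpha>
    using assms by (intro discounted_risk_model.intro discounted_risk_model_axioms.intro)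
  have half: "s \<in> half" if "Re s > 0" for s
    using that discount_rate_pos by (simp add: half_def)
  show ?thesis
  proof (intro conjI allI impI iffI)
    fix s assume s: "Re s > 0 \<and> s \<notin> sing R"
    then show "convergent (Ldiag R \<alpha> s)"
      using Ldiag_tendsto_0[OF half] by (auto simp: convergent_def)
    show "summable (LKdiag R \<alpha> tau_mu tau_nu s)"
      using s by (intro LKdiag_summable half) simp
    show "tau R \<alpha> s = tau_series R \<alpha> tau_mu tau_nu s"
      using s by (intro tau_eq_tau_series) auto
  next
    fix u v assume "solves_system R \<alpha> u v"
    then interpret linear_system_solution R \<alpha> u v by unfold_locales
    show "\<forall>j\<in>{1..nK R}. u j = tau R \<alpha> (of_real (mu R j))" "\<forall>i\<in>{1..nL R}. v i = tau R \<alpha> (of_real (nu R i))"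
      using solution_unique by blast+
  next
    fix u v assume "(\<forall>j\<in>{1..nK R}. u j = tau R \<alpha> (of_real (mu R j))) \<and> (\<forall>i\<in>{1..nL R}. v i = tau R \<alpha> (of_real (nu R i)))"
    then show "solves_system R \<alpha> u v" by (intro solves_system_tau) auto
  qed
qed

end
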